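(* Assume the setting below with $m\ge1$, that $(h_1^* )$ holds, that $g_i,k_j$ satisfy $(h_2)$ and $(h_3)$, and that $\alpha_i>0$ with $$\alpha_i g_0^i<\lambda_0\quad\text{and}\quad \alpha_i g_\infty^i>\lambda_1^i\qquad\text{for all } i=1,\ldots,m.$$ Then there exists $\beta^{*}>0$ such that, if $\beta_j>\beta^{*}$ for all $j=0,\ldots,m+1$, the Dirichlet problem $$-\Delta u=\mathcal{F}(x,u)\ \text{in }\Omega,\qquad u=0\ \text{on }\partial\Omega$$ has at least $2^m-1$ positive radially symmetric classical solutions $u\in\mathcal{C}^2(\overline{\Omega})$.
   Context: Let $N\ge2$, $0<R_1<R_2$, and $\Omega=\{x\in\mathbb{R}^N: R_1<\|x\|<R_2\}$ (Euclidean norm). Let $m\ge1$, $\alpha_i>0$ ($i=1,\ldots,m$), $\beta_j>0$ ($j=0,\ldots,m+1$), let $A_i,B_j\colon[R_1,R_2]\to[0,+\infty)$ be continuous and $\mathcal{A}_i(x)=A_i(\|x\|)$, $\mathcal{B}_j(x)=B_j(\|x\|)$ for $x\in\overline\Omega$. Let $g_i,k_j\colon[0,+\infty)\to[0,+\infty)$ be continuous and $\mathcal{F}(x,s)=\sum_{i=1}^m\alpha_i\mathcal{A}_i(x)g_i(s)-\sum_{j=0}^{m+1}\beta_j\mathcal{B}_j(x)k_j(s)$. A solution is positive if $u>0$ in $\Omega$; radially symmetric means $u(x)=\mathcal{U}(\|x\|)$. $(h_1^* )$: there are points $R_1=\tau_0\le\sigma_1<\tau_1<\sigma_2<\cdots<\sigma_m<\tau_m\le\sigma_{m+1}=R_2$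 such that, for each $i$, $A_i\not\equiv0$ on $[\sigma_i,\tau_i]$ and $A_i\equiv0$ outside $[\sigma_i,\tau_i]$; for each $j=0,\ldots,m+1$, $B_j\equiv0$ outside $[\tau_j,\sigma_{j+1}]$, and whenever $\tau_j<\sigma_{j+1}$, $B_j$ is not identically zero on any right neighbourhood of $\tau_j$ nor on any left neighbourhood of $\sigma_{j+1}$ within $[\tau_j,\sigma_{j+1}]$. $(h_2)$: $g_i(0)=0$, $g_i(s)>0$ for $s>0$; $k_j(0)=0$, $k_j(s)>0$ for $s>0$. Notation: $g_0^i=\limsup_{s\to0^+}g_i(s)/s$, $g_\infty^i=\liminf_{s\to+\infty}g_i(s)/s$, $k_0^j=\limsup_{s\to0^+}k_j(s)/s$. $(h_3)$: $g_0^i<+\infty$, $g_\infty^i>0$, $k_0^j<+\infty$ for all $i,j$. Change of variables: $h(r)=\int_{R_1}^r\xi^{1-N}\,d\xi$, $L=h(R_2)$, $r(t)=h^{-1}(t)$ for $t\in[0,L]$, and $a_i(t)=r(t)^{2(N-1)}A_i(r(t))$. Then $\lambda_0>0$ is the first eigenvalue of $\varphi''+\lambda\bigl[\sum_{i=1}^m a_i(t)\bigr]\varphi=0$, $\varphi(0)=\varphi(L)=0$, and $\lambda_1^i>0$ is the first eigenvalue of $\varphi''+\lambda a_i(t)\varphi=0$ on $[h(\sigma_i),h(\tau_i)]$ with zero Dirichlet conditions at both endpoints.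
   Formalization: The sum of the terms β_j B_j k_j and the conditions on B_j, k_j run over j=0,…,m instead of j=0,…,m+1, because (h_1^* ) supplies no points τ_{m+1}, σ_{m+2} and so the interval for j=m+1 is undefined. *)

theory Defs
  imports "HOL-Analysis.Analysis"
begin

definition annulus :: "real \<Rightarrow> real \<Rightarrow> (real^'n) set" where
  "annulus R1 R2 = {x. R1 < norm x \<and> norm x < R2}"

definition classical_dirichlet_solution ::
  "(real^'n) set \<Rightarrow> (real^'n \<Rightarrow> real \<Rightarrow> real) \<Rightarrow> (real^'n \<Rightarrow> real) \<Rightarrow> bool" where
  "classical_dirichlet_solution \<Omega> F u \<longleftrightarrow>
     (\<exists>Du :: real^'n \<Rightarrow> real^'n. \<exists>D2u :: real^'n \<Rightarrow> real^'n^'n.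
        continuous_on (closure \<Omega>) u \<and> continuous_on (closure \<Omega>) Du \<and>
        continuous_on (closure \<Omega>) D2u \<and>
        (\<forall>x\<in>\<Omega>. (u has_derivative (\<lambda>h. Du x \<bullet> h)) (at x)) \<and>
        (\<forall>x\<in>\<Omega>. (Du has_derivative (\<lambda>h. D2u x *v h)) (at x)) \<and>
        (\<forall>x\<in>\<Omega>. - (\<Sum>i\<in>UNIV. D2u x $ i $ i) = F x (u x)) \<and>
        (\<forall>x\<in>frontier \<Omega>. u x = 0))"

definition dirichlet_eigenvalue :: "(real \<Rightarrow> real) \<Rightarrow> real \<Rightarrow> real \<Rightarrow> real \<Rightarrow> bool" where
  "dirichlet_eigenvalue a p q lam \<longleftrightarrow>
     (\<exists>\<phi> \<phi>'. (\<forall>t\<in>{p..q}. (\<phi> has_real_derivative \<phi>' t) (at t within {p..q}) \<and>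
                          (\<phi>' has_real_derivative (- lam * a t * \<phi> t)) (at t within {p..q})) \<and>
              \<phi> p = 0 \<and> \<phi> q = 0 \<and> (\<exists>t\<in>{p..q}. \<phi> t \<noteq> 0))"

definition first_dirichlet_eigenvalue :: "(real \<Rightarrow> real) \<Rightarrow> real \<Rightarrow> real \<Rightarrow> real" where
  "first_dirichlet_eigenvalue a p q = (LEAST lam. dirichlet_eigenvalue a p q lam)"

definition hvar :: "real \<Rightarrow> nat \<Rightarrow> real \<Rightarrow> real" where
  "hvar R1 N r = integral {R1..r} (\<lambda>\<xi>. \<xi> powr (1 - real N))"

definition rvar :: "real \<Rightarrow> real \<Rightarrow> nat \<Rightarrow> real \<Rightarrow> real" where
  "rvar R1 R2 N t = inv_into {R1..R2} (hvar R1 N) t"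

definition weight :: "real \<Rightarrow> real \<Rightarrow> nat \<Rightarrow> (real \<Rightarrow> real) \<Rightarrow> real \<Rightarrow> real" where
  "weight R1 R2 N Ai t = (rvar R1 R2 N t) ^ (2 * (N - 1)) * Ai (rvar R1 R2 N t)"

end

theory Submission
  imports Defs "HOL-Complex_Analysis.Great_Picard"
begin

text \<open>In the variable \<open>t = h(r)\<close> the problem becomes \<open>u'' + F(t, u) = 0\<close>, \<open>u(0) = u(L) = 0\<close>. For each
  nonempty set \<open>J\<close> of positivity intervals we find a solution whose maximum is at least \<open>r\<close> on the
  intervals in \<open>J\<close> and below \<open>r\<close> on the others; these are \<open>2\<^sup>m - 1\<close> different solutions.

  Instead of a degree computation, a multiplier \<open>\<mu> i\<close> is added on every interval in \<open>J\<close>, coupled to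
  the constraint that the maximum of \<open>u\<close> there lies in \<open>[r, R]\<close>, and Schauder's theorem is applied to
  the pair \<open>(u, \<mu>)\<close>. The parabola \<open>H t (L - t) / 2\<close> bounds \<open>u\<close> independently of \<open>\<beta>\<close>, so for large
  \<open>\<beta>\<close> the solution is small at the endpoints of all positivity intervals. On each of them this
  leaves a nearly Dirichlet problem, where \<open>\<alpha>\<^sub>i g\<^sub>0\<^sup>i < \<lambda>\<^sub>0\<close> excludes \<open>\<mu> i < 0\<close> and
  \<open>\<alpha>\<^sub>i g\<^sub>\<infinity>\<^sup>i > \<lambda>\<^sub>1\<^sup>i\<close> excludes \<open>\<mu> i > 0\<close>.\<close>

section \<open>A Schauder fixed point theorem\<close>

text \<open>Every constant depends only on earlier ones: \<open>r\<close> comes from the slopes at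
  zero, \<open>R\<close> from the slopes at infinity, \<open>N\<close> caps the multipliers, and
  \<open>H\<close> bounds the truncated source together with the multipliers. The terms with \<beta>
  enter with a negative sign and leave \<open>H\<close> alone. Bounds for the height of
  \<open>u\<close>, and one-sided bounds for its slope at the ends of the positivity intervals,
  follow from \<open>H\<close>; only then is \<beta> made large. On a gap between positivity
  intervals \<open>u\<close> is convex, ever more strongly as \<beta> grows, so a solution that is
  not small at an end of the gap would exceed its height bound. The eigenvalue
  \<open>\<lambda>\<^sub>0\<close> belongs to the sum of all weights on \<open>[0, L]\<close>,
  whereas smallness is needed on single intervals: a supersolution for the total weight that is
  positive up to the boundary restricts to each interval, because only one weight lives there. Once
  all multipliers vanish, the solution lies below every truncation level and solves the original
  problem. The empty set of intervals is excluded because the zero function would qualify for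
  it.\<close>

text \<open>The library states Brouwer's theorem for Euclidean types only; here the dimension must grow
  inside a proof, so Kuhn's lemma is used directly.\<close>

lemma approx_fixed_point_box:
  fixes f :: "(nat \<Rightarrow> real) \<Rightarrow> nat \<Rightarrow> real" and C e d :: real and n :: nat
  assumes C: "C > 0" and e: "e > 0" and d: "d > 0"
    and bd: "\<And>y i. \<lbrakk>\<forall>j<n. \<bar>y j\<bar> \<le> C; i < n\<rbrakk> \<Longrightarrow> \<bar>f y i\<bar> < C"
    and uc: "\<And>y z i. \<lbrakk>\<forall>j<n. \<bar>y j\<bar> \<le> C; \<forall>j<n. \<bar>z j\<bar> \<le> C; \<forall>j<n. \<bar>y j - z j\<bar> \<le> d; i < n\<rbrakk>
                \<Longrightarrow> \<bar>f y i - f z i\<bar> \<le> e"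
  obtains y where "\<forall>j<n. \<bar>y j\<bar> \<le> C" "\<forall>i<n. \<bar>f y i - y i\<bar> \<le> 2 * e"
proof -
  \<comment> \<open>The mesh must resolve the modulus of continuity of \<open>f\<close> and also
    bound, by \<open>e\<close>, the change of a coordinate between corners of one cell.\<close>
  define m where "m = min d e"
  have m: "m > 0" "m \<le> d" "m \<le> e" using d e by (auto simp: m_def)
  obtain p :: nat where p: "p > 0" "2 * C / real p \<le> m"
  proof -
    obtain p :: nat where "2 * C / m < real p" using reals_Archimedean2 by blast
    moreover have "0 < 2 * C / m" using C m by simp
    ultimately have "0 < real p" by linarith
    then show ?thesis using that[of p] \<open>2 * C / m < real p\<close> m by (simp add: field_simps)
  qed
  define Y where "Y = (\<lambda>x :: nat \<Rightarrow> nat. \<lambda>i. - C + 2 * C * (real (x i) / real p))"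
  have Ybox: "\<bar>Y x i\<bar> \<le> C" if "x i \<le> p" for x i
  proof -
    have "0 \<le> real (x i) / real p" "real (x i) / real p \<le> 1" using that p by auto
    then have "0 \<le> 2 * C * (real (x i) / real p)" "2 * C * (real (x i) / real p) \<le> 2 * C * 1"
      using C mult_left_mono[of "real (x i) / real p" 1 "2 * C"] by (simp_all del: times_divide_eq_right)
    then show ?thesis by (auto simp: Y_def)
  qed
  \<comment> \<open>The label tells in which direction \<open>f\<close> moves coordinate
    \<open>i\<close>. The strict bound \<open>C\<close> forces the label 1 on the upper face, as
    Kuhn's lemma demands. In the cell it yields, both labels occur for every \<open>i\<close>, so at
    the corner \<open>q\<close> the displacement is at most \<open>2 * e\<close> in modulus.\<close>
  define label where "label = (\<lambda>x i. if Y x i \<le> f (Y x) i then 0 else (1 :: nat))"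
  obtain q where q: "\<forall>i<n. q i < p"
    and rs: "\<forall>i<n. \<exists>r s. (\<forall>j<n. q j \<le> r j \<and> r j \<le> q j + 1) \<and>
                       (\<forall>j<n. q j \<le> s j \<and> s j \<le> q j + 1) \<and> label r i \<noteq> label s i"
  proof (rule kuhn_lemma[of p n label])
    show "\<forall>x. (\<forall>i<n. x i \<le> p) \<longrightarrow> (\<forall>i<n. x i = 0 \<longrightarrow> label x i = 0)"
    proof (intro allI impI)
      fix x i assume x: "\<forall>i<n. x i \<le> p" and i: "i < n" "x i = 0"
      have "\<bar>f (Y x) i\<bar> < C" using bd Ybox x i by blast
      then show "label x i = 0" using i by (simp add: label_def Y_def)
    qed
    show "\<forall>x. (\<forall>i<n. x i \<le> p) \<longrightarrow> (\<forall>i<n. x i = p \<longrightarrow> label x i = 1)"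
    proof (intro allI impI)
      fix x i assume x: "\<forall>i<n. x i \<le> p" and i: "i < n" "x i = p"
      have "\<bar>f (Y x) i\<bar> < C" using bd Ybox x i by blast
      moreover have "Y x i = C" using i p by (simp add: Y_def)
      ultimately show "label x i = 1" by (simp add: label_def)
    qed
  qed (use p in \<open>auto simp: label_def\<close>)
  have qbox: "\<forall>j<n. \<bar>Y q j\<bar> \<le> C" using q Ybox by (simp add: less_imp_le)
  have near: "(\<forall>j<n. \<bar>Y r j\<bar> \<le> C) \<and> (\<forall>j<n. \<bar>Y r j - Y q j\<bar> \<le> m)"
    if "\<forall>j<n. q j \<le> r j \<and> r j \<le> q j + 1" for r
  proof (intro conjI allI impI)
    fix j assume j: "j < n"
    show "\<bar>Y r j\<bar> \<le> C" using that q j Ybox[of r j] by fastforce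
    have "real (q j) \<le> real (r j)" "real (r j) \<le> real (q j) + 1" using that j
      by (auto simp flip: of_nat_Suc)
    then have "\<bar>real (r j) - real (q j)\<bar> \<le> 1" by simp
    then have "2 * C / real p * \<bar>real (r j) - real (q j)\<bar> \<le> 2 * C / real p * 1"
      using C by (intro mult_left_mono) auto
    moreover have "Y r j - Y q j = 2 * C / real p * (real (r j) - real (q j))"
      using p by (simp add: Y_def field_simps)
    ultimately show "\<bar>Y r j - Y q j\<bar> \<le> m" using p C by (simp add: abs_mult abs_divide)
  qed
  have "\<bar>f (Y q) i - Y q i\<bar> \<le> 2 * e" if i: "i < n" for i
  proof -
    have lo: "f (Y q) i - Y q i \<ge> - 2 * e"
      if "\<forall>j<n. q j \<le> r j \<and> r j \<le> q j + 1" "label r i = 0" for r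
    proof -
      have "Y r i \<le> f (Y r) i" using that(2) by (simp add: label_def split: if_splits)
      moreover have "\<bar>f (Y r) i - f (Y q) i\<bar> \<le> e"
        using near[OF that(1)] qbox m i by (intro uc) auto
      moreover have "\<bar>Y r i - Y q i\<bar> \<le> m" using near[OF that(1)] i by blast
      ultimately show ?thesis using m by linarith
    qed
    have hi: "f (Y q) i - Y q i \<le> 2 * e"
      if "\<forall>j<n. q j \<le> r j \<and> r j \<le> q j + 1" "label r i \<noteq> 0" for r
    proof -
      have "Y r i > f (Y r) i" using that(2) by (simp add: label_def split: if_splits)
      moreover have "\<bar>f (Y r) i - f (Y q) i\<bar> \<le> e"
        using near[OF that(1)] qbox m i by (intro uc) auto
      moreover have "\<bar>Y r i - Y q i\<bar> \<le> m" using near[OF that(1)] i by blast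
      ultimately show ?thesis using m by linarith
    qed
    obtain r s where r: "\<forall>j<n. q j \<le> r j \<and> r j \<le> q j + 1"
      and s: "\<forall>j<n. q j \<le> s j \<and> s j \<le> q j + 1" and ne: "label r i \<noteq> label s i"
      using rs i by blast
    show ?thesis
    proof (cases "label r i = 0")
      case True
      then have "label s i \<noteq> 0" using ne by simp
      then show ?thesis using lo[OF r True] hi[OF s] by linarith
    next
      case False
      then have "label s i = 0" using ne by (simp add: label_def split: if_splits)
      then show ?thesis using lo[OF s] hi[OF r False] by linarith
    qed
  qed
  then show ?thesis using that qbox by blast
qed

text \<open>Terms of weight zero may be arbitrary: with hat functions as weights, only nodes near
  the evaluation point count. With \<open>v = 0\<close> the same estimate shows that the
  interpolation is nonexpansive.\<close>

lemma weighted_mean_dist: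
  fixes w y :: "nat \<Rightarrow> real"
  assumes w: "\<And>j. j < n \<Longrightarrow> w j \<ge> 0" and W: "(\<Sum>j<n. w j) > 0"
    and y: "\<And>j. \<lbrakk>j < n; w j > 0\<rbrakk> \<Longrightarrow> \<bar>y j - v\<bar> \<le> c"
  shows "\<bar>(\<Sum>j<n. y j * w j) / (\<Sum>j<n. w j) - v\<bar> \<le> c"
proof -
  let ?W = "\<Sum>j<n. w j"
  have "(\<Sum>j<n. y j * w j) - v * ?W = (\<Sum>j<n. (y j - v) * w j)"
    by (simp add: left_diff_distrib sum_subtractf sum_distrib_left)
  also have "\<bar>\<dots>\<bar> \<le> (\<Sum>j<n. \<bar>(y j - v) * w j\<bar>)" by (rule sum_abs)
  also have "\<dots> \<le> (\<Sum>j<n. c * w j)"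
  proof (rule sum_mono)
    fix j assume "j \<in> {..<n}"
    then show "\<bar>(y j - v) * w j\<bar> \<le> c * w j"
      using w[of j] y[of j] by (cases "w j = 0") (auto simp: abs_mult intro!: mult_right_mono)
  qed
  also have "\<dots> = c * ?W" by (simp add: sum_distrib_left)
  finally have "\<bar>(\<Sum>j<n. y j * w j) - v * ?W\<bar> \<le> c * ?W" .
  moreover have "(\<Sum>j<n. y j * w j) / ?W - v = ((\<Sum>j<n. y j * w j) - v * ?W) / ?W"
    using W by (simp add: field_simps)
  ultimately show ?thesis using W by (simp add: abs_divide pos_divide_le_eq)
qed

text \<open>The bound and the Lipschitz constant are uniform over all continuous arguments, so the
  range of \<open>T\<close> is relatively compact and no invariant set has to be exhibited. Values
  at finitely many nodes, joined by a partition of unity, reduce the problem to a map of a box; the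
  approximate fixed points converge along a subsequence. \<open>S\<close> is an arbitrary compact
  set because isolated points will carry finitely many real unknowns.\<close>

theorem schauder_fixed_point:
  fixes S :: "real set" and T :: "(real \<Rightarrow> real) \<Rightarrow> real \<Rightarrow> real" and C K :: real
  assumes S: "compact S"
    and bd: "\<And>u t. \<lbrakk>continuous_on S u; t \<in> S\<rbrakk> \<Longrightarrow> \<bar>T u t\<bar> < C"
    and lip: "\<And>u s t. \<lbrakk>continuous_on S u; s \<in> S; t \<in> S\<rbrakk> \<Longrightarrow> \<bar>T u s - T u t\<bar> \<le> K * \<bar>s - t\<bar>"
    and uc: "\<And>e. e > 0 \<Longrightarrow> \<exists>d>0. \<forall>u v. continuous_on S u \<longrightarrow> continuous_on S v \<longrightarrow>
               (\<forall>t\<in>S. \<bar>u t - v t\<bar> \<le> d) \<longrightarrow> (\<forall>t\<in>S. \<bar>T u t - T v t\<bar> \<le> e)"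
  obtains u where "continuous_on S u" "\<And>t. t \<in> S \<Longrightarrow> T u t = u t"
proof (cases "S = {}")
  case True
  then show ?thesis using that by (metis continuous_on_empty empty_iff)
next
  case False
  then obtain t0 where t0: "t0 \<in> S" by blast
  have C: "C > 0" using bd[of "\<lambda>_. 0", OF _ t0] by (auto intro: le_less_trans)
  define K' where "K' = max K 1"
  have K': "K' > 0" and lip': "\<lbrakk>continuous_on S u; s \<in> S; t \<in> S\<rbrakk> \<Longrightarrow> \<bar>T u s - T u t\<bar> \<le> K' * \<bar>s - t\<bar>" for u s t
    using lip[of u s t] mult_right_mono[of K "max K 1" "\<bar>s - t\<bar>"] by (simp_all add: K'_def)
  have approx: "\<exists>u. continuous_on S u \<and> (\<forall>t\<in>S. \<bar>T u t - u t\<bar> \<le> e)" if e: "e > 0" for e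
  proof -
    obtain d where d: "d > 0" and dT: "\<And>u v t. \<lbrakk>continuous_on S u; continuous_on S v;
        \<forall>t\<in>S. \<bar>u t - v t\<bar> \<le> d; t \<in> S\<rbrakk> \<Longrightarrow> \<bar>T u t - T v t\<bar> \<le> e / 4"
      using uc[of "e / 4"] e by (metis zero_less_divide_iff zero_less_numeral)
    \<comment> \<open>Over a distance \<open>\<rho>\<close> a function \<open>T u\<close> varies by
      at most \<open>e / 2\<close>; the fixed point on the box, accurate up to
      \<open>2 * (e / 4)\<close> at the nodes, supplies the other half of the error.\<close>
    define \<rho> where "\<rho> = e / (2 * K')"
    have \<rho>: "\<rho> > 0" using e K' by (simp add: \<rho>_def)
    obtain X where X: "finite X" "X \<subseteq> S" "S \<subseteq> (\<Union>x\<in>X. ball x \<rho>)"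
      using seq_compact_imp_totally_bounded S \<rho> by (metis compact_imp_seq_compact)
    obtain x n where x: "X = x ` {i::nat. i < n}"
      using finite_imp_nat_seg_image_inj_on[OF X(1)] by blast
    define w where "w = (\<lambda>j t. max 0 (\<rho> - \<bar>t - x j\<bar>))"
    define W where "W = (\<lambda>t. \<Sum>j<n. w j t)"
    have w0: "w j t \<ge> 0" for j t by (simp add: w_def)
    have W: "W t > 0" if t: "t \<in> S" for t
    proof -
      obtain j where "j < n" "dist (x j) t < \<rho>" using X(3) t unfolding x by auto
      then have "w j t > 0" by (auto simp: w_def dist_real_def)
      then show ?thesis unfolding W_def using \<open>j < n\<close> w0 by (intro sum_pos2[of _ j]) auto
    qed
    define U where "U = (\<lambda>y t. (\<Sum>j<n. y j * w j t) / W t)"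
    have contU: "continuous_on S (U y)" for y
      unfolding U_def W_def w_def
      by (intro continuous_intros) (use W in \<open>fastforce simp: W_def w_def\<close>)
    have Udiff: "\<bar>U y t - U z t\<bar> \<le> c" if "t \<in> S" "\<forall>j<n. \<bar>y j - z j\<bar> \<le> c" for y z t c
    proof -
      have "U y t - U z t = (\<Sum>j<n. (y j - z j) * w j t) / (\<Sum>j<n. w j t) - 0"
        by (simp add: U_def W_def left_diff_distrib sum_subtractf diff_divide_distrib)
      also have "\<bar>\<dots>\<bar> \<le> c"
        using that w0 W by (intro weighted_mean_dist) (auto simp: W_def)
      finally show ?thesis .
    qed
    have xS: "x j \<in> S" if "j < n" for j using X x that by auto
    obtain y where y: "\<forall>j<n. \<bar>y j\<bar> \<le> C" "\<forall>i<n. \<bar>T (U y) (x i) - y i\<bar> \<le> 2 * (e / 4)"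
    proof (rule approx_fixed_point_box[of C "e / 4" d n "\<lambda>y i. T (U y) (x i)"])
      fix y i assume "i < n" then show "\<bar>T (U y) (x i)\<bar> < C" using bd contU xS by blast
    next
      fix y z :: "nat \<Rightarrow> real" and i
      assume "\<forall>j<n. \<bar>y j - z j\<bar> \<le> d" "i < n"
      then show "\<bar>T (U y) (x i) - T (U z) (x i)\<bar> \<le> e / 4"
        using dT[OF contU contU] Udiff xS by blast
    qed (use C e d in auto)
    have "\<bar>T (U y) t - U y t\<bar> \<le> e" if t: "t \<in> S" for t
    proof -
      have "\<bar>(\<Sum>j<n. y j * w j t) / (\<Sum>j<n. w j t) - T (U y) t\<bar> \<le> e"
      proof (rule weighted_mean_dist)
        fix j assume j: "j < n" "0 < w j t"
        then have "\<bar>x j - t\<bar> \<le> \<rho>" by (auto simp: w_def)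
        then have "K' * \<bar>x j - t\<bar> \<le> K' * \<rho>" using K' by simp
        also have "\<dots> = e / 2" using K' by (simp add: \<rho>_def)
        finally have "\<bar>T (U y) (x j) - T (U y) t\<bar> \<le> e / 2"
          using lip'[OF contU xS[OF j(1)] t] order_trans by blast
        moreover have "\<bar>T (U y) (x j) - y j\<bar> \<le> e / 2" using y(2) j by auto
        ultimately show "\<bar>y j - T (U y) t\<bar> \<le> e" by linarith
      qed (use w0 W[OF t] in \<open>auto simp: W_def\<close>)
      then show ?thesis by (simp add: U_def W_def abs_minus_commute)
    qed
    then show ?thesis using contU by blast
  qed
  have "\<forall>k. \<exists>u. continuous_on S u \<and> (\<forall>t\<in>S. \<bar>T u t - u t\<bar> \<le> inverse (real (Suc k)))"
    using approx by simp
  then obtain u where u: "\<And>k. continuous_on S (u k)"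
    and Tu: "\<And>k t. t \<in> S \<Longrightarrow> \<bar>T (u k) t - u k t\<bar> \<le> inverse (real (Suc k))"
    by metis
  obtain g k where g: "continuous_on S g" and k: "strict_mono (k :: nat \<Rightarrow> nat)"
    and lim: "\<And>e. 0 < e \<Longrightarrow> \<exists>N. \<forall>n x. n \<ge> N \<and> x \<in> S \<longrightarrow> norm (T (u (k n)) x - g x) < e"
  \<comment> \<open>Compactness is extracted from the images \<open>T (u n)\<close>: the functions
    \<open>u n\<close> are merely continuous, but lie close to their images.\<close>
  proof (rule Arzela_Ascoli[of S "\<lambda>n. T (u n)" C])
    fix x and e :: real assume x: "x \<in> S" "0 < e"
    show "\<exists>d>0. \<forall>n y. y \<in> S \<and> norm (x - y) < d \<longrightarrow> norm (T (u n) x - T (u n) y) < e"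
    proof (intro exI[of _ "e / K'"] conjI allI impI)
      fix n y assume "y \<in> S \<and> norm (x - y) < e / K'"
      then have "K' * \<bar>x - y\<bar> < e" using K' by (simp add: field_simps)
      then show "norm (T (u n) x - T (u n) y) < e"
        using lip'[OF u x(1), of y] \<open>y \<in> S \<and> _\<close> by (auto intro: le_less_trans)
    qed (use x K' in auto)
  qed (use S bd u in \<open>auto intro: less_imp_le\<close>)
  have "T g t = g t" if t: "t \<in> S" for t
  proof (rule ccontr)
    assume "T g t \<noteq> g t"
    define e where "e = \<bar>T g t - g t\<bar> / 3"
    have e: "e > 0" using \<open>T g t \<noteq> g t\<close> by (simp add: e_def)
    obtain d where d: "d > 0" and dT: "\<And>u v t. \<lbrakk>continuous_on S u; continuous_on S v;
        \<forall>t\<in>S. \<bar>u t - v t\<bar> \<le> d; t \<in> S\<rbrakk> \<Longrightarrow> \<bar>T u t - T v t\<bar> \<le> e"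
      using uc[of e] e by metis
    obtain N1 where N1: "\<And>n x. \<lbrakk>n \<ge> N1; x \<in> S\<rbrakk> \<Longrightarrow> \<bar>T (u (k n)) x - g x\<bar> < min e (d / 2)"
      using lim[of "min e (d / 2)"] e d by auto
    obtain N2 where N2: "inverse (real (Suc N2)) < d / 2"
      using reals_Archimedean[of "d / 2"] d by auto
    define n where "n = max N1 N2"
    have "N2 \<le> k n" using seq_suble[OF k, of n] by (simp add: n_def)
    then have "inverse (real (Suc (k n))) \<le> inverse (real (Suc N2))" by (simp add: le_imp_inverse_le)
    have near: "\<bar>u (k n) s - g s\<bar> \<le> d" if "s \<in> S" for s
    proof -
      have "\<bar>T (u (k n)) s - u (k n) s\<bar> \<le> d / 2"
        using Tu[OF that, of "k n"] N2 \<open>inverse _ \<le> inverse _\<close> by linarith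
      moreover have "\<bar>T (u (k n)) s - g s\<bar> < d / 2" using N1[of n s] that by (simp add: n_def)
      ultimately show ?thesis by linarith
    qed
    have "\<bar>T (u (k n)) t - T g t\<bar> \<le> e" by (intro dT[OF u g] ballI near t)
    moreover have "\<bar>T (u (k n)) t - g t\<bar> < e" using N1[of n t] t by (simp add: n_def)
    ultimately have "\<bar>T g t - g t\<bar> < 2 * e" by linarith
    then show False using e by (simp add: e_def)
  qed
  then show ?thesis using that g by blast
qed

section \<open>Comparison principles\<close>

text \<open>Derivatives relative to \<open>{p..q}\<close> are one-sided at the ends, which is all
  that a boundary value problem provides.\<close>

lemma mvt_within:
  fixes f f' :: "real \<Rightarrow> real"
  assumes f: "\<And>t. t \<in> {p..q} \<Longrightarrow> (f has_real_derivative f' t) (at t within {p..q})"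
    and xy: "p \<le> x" "x < y" "y \<le> q"
  obtains z where "x < z" "z < y" "f y - f x = f' z * (y - x)"
proof -
  have "\<exists>z\<in>{x<..<y}. f y - f x = (\<lambda>h. f' z * h) (y - x)"
  proof (rule mvt_simple)
    fix z assume "x \<le> z" "z \<le> y"
    then have "(f has_real_derivative f' z) (at z within {x..y})"
      using f[of z] xy by (auto intro: DERIV_subset)
    then show "(f has_derivative (\<lambda>h. f' z * h)) (at z within {x..y})"
      by (simp add: has_field_derivative_def)
  qed (use xy in auto)
  then show ?thesis using that by auto
qed

lemma mono_within:
  fixes f f' :: "real \<Rightarrow> real"
  assumes f: "\<And>t. t \<in> {p..q} \<Longrightarrow> (f has_real_derivative f' t) (at t within {p..q})"
    and pos: "\<And>t. p < t \<Longrightarrow> t < q \<Longrightarrow> f' t \<ge> 0"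
    and xy: "p \<le> x" "x \<le> y" "y \<le> q"
  shows "f x \<le> f y"
proof (cases "x = y")
  case False
  then have "x < y" using xy by simp
  obtain z where z: "x < z" "z < y" "f y - f x = f' z * (y - x)"
    by (rule mvt_within[OF f xy(1) \<open>x < y\<close> xy(3)])
  have "f' z \<ge> 0" using pos z xy by simp
  then have "f' z * (y - x) \<ge> 0" using xy by simp
  then show ?thesis using z by simp
qed simp

lemma antimono_within:
  fixes f f' :: "real \<Rightarrow> real"
  assumes f: "\<And>t. t \<in> {p..q} \<Longrightarrow> (f has_real_derivative f' t) (at t within {p..q})"
    and neg: "\<And>t. p < t \<Longrightarrow> t < q \<Longrightarrow> f' t \<le> 0"
    and xy: "p \<le> x" "x \<le> y" "y \<le> q"
  shows "f y \<le> f x"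
proof -
  have "- f x \<le> - f y"
  proof (rule mono_within[of p q "\<lambda>t. - f t" "\<lambda>t. - f' t"])
    show "((\<lambda>t. - f t) has_real_derivative - f' t) (at t within {p..q})" if "t \<in> {p..q}" for t
      using f[OF that] by (rule DERIV_minus)
    show "0 \<le> - f' t" if "p < t" "t < q" for t using neg[OF that] by simp
  qed (rule xy)+
  then show ?thesis by simp
qed

text \<open>The ends are the last point before \<open>t0\<close> and the first one after it where
  \<open>w\<close> is not positive; a negative value there would, by the intermediate value theorem,
  produce a zero still closer to \<open>t0\<close>.\<close>

lemma positive_component:
  fixes w :: "real \<Rightarrow> real"
  assumes cont: "continuous_on {p..q} w" and ends: "w p \<le> 0" "w q \<le> 0"
    and t0: "t0 \<in> {p..q}" "w t0 > 0"
  obtains c d where "p \<le> c" "c < t0" "t0 < d" "d \<le> q" "w c = 0" "w d = 0"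
    "\<And>t. c < t \<Longrightarrow> t < d \<Longrightarrow> w t > 0"
proof -
  define Z1 where "Z1 = {p..t0} \<inter> w -` {..0}"
  define Z2 where "Z2 = {t0..q} \<inter> w -` {..0}"
  have c1: "continuous_on {p..t0} w" "continuous_on {t0..q} w"
    using cont t0 by (auto intro: continuous_on_subset)
  have cl: "closed Z1" "closed Z2" unfolding Z1_def Z2_def
    using continuous_closed_preimage[OF c1(1)] continuous_closed_preimage[OF c1(2)] by auto
  have ne: "p \<in> Z1" "q \<in> Z2" using ends t0 by (auto simp: Z1_def Z2_def)
  have bd: "bdd_above Z1" "bdd_below Z2" by (auto simp: Z1_def Z2_def intro: bdd_aboveI[of _ t0] bdd_belowI[of _ t0])
  define c where "c = Sup Z1"
  define d where "d = Inf Z2"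
  have cZ: "c \<in> Z1" unfolding c_def using cl ne bd by (intro closed_contains_Sup) auto
  have dZ: "d \<in> Z2" unfolding d_def using cl ne bd by (intro closed_contains_Inf) auto
  have lt: "c < t0" "t0 < d" using cZ dZ t0 by (auto simp: Z1_def Z2_def less_le)
  have pos: "w t > 0" if "c < t" "t < d" for t
  proof (rule ccontr)
    assume "\<not> w t > 0"
    then consider "t \<in> Z1" | "t \<in> Z2"
      using \<open>c < t\<close> \<open>t < d\<close> cZ dZ by (cases "t \<le> t0") (simp_all add: Z1_def Z2_def)
    then show False
      using cSup_upper[of t Z1] cInf_lower[of t Z2] bd that by cases (auto simp: c_def d_def)
  qed
  have cw: "w c = 0"
  proof (rule ccontr)
    assume "w c \<noteq> 0"
    then have "w c < 0" using cZ by (auto simp: Z1_def)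
    then obtain x where "c \<le> x" "x \<le> t0" "w x = 0"
      using IVT'[of w c 0 t0] t0 lt continuous_on_subset[OF c1(1), of "{c..t0}"] cZ
      by (auto simp: Z1_def)
    then have "x \<noteq> c" "c < x" "x < d" using \<open>w c < 0\<close> lt by (auto simp: less_le)
    then show False using pos \<open>w x = 0\<close> by force
  qed
  have dw: "w d = 0"
  proof (rule ccontr)
    assume "w d \<noteq> 0"
    then have "w d < 0" using dZ by (auto simp: Z2_def)
    then obtain x where "t0 \<le> x" "x \<le> d" "w x = 0"
      using IVT2'[of w d 0 t0] t0 lt continuous_on_subset[OF c1(2), of "{t0..d}"] dZ
      by (auto simp: Z2_def)
    then have "x \<noteq> d" "c < x" "x < d" using \<open>w d < 0\<close> lt by (auto simp: less_le)
    then show False using pos \<open>w x = 0\<close> by force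
  qed
  show ?thesis using that[of c d] cZ dZ lt cw dw pos by (auto simp: Z1_def Z2_def)
qed

text \<open>The Wronskian of \<open>u\<close> and \<open>\<psi>\<close> is nondecreasing where \<open>u > c \<psi>\<close>, so \<open>u / \<psi>\<close> cannot
  rise and then fall there.\<close>

lemma maximum_principle:
  fixes u u' u2 \<psi> \<psi>' \<psi>2 :: "real \<Rightarrow> real"
  assumes u: "\<And>t. t \<in> {p..q} \<Longrightarrow> (u has_real_derivative u' t) (at t within {p..q})"
    and u': "\<And>t. t \<in> {p..q} \<Longrightarrow> (u' has_real_derivative u2 t) (at t within {p..q})"
    and \<psi>: "\<And>t. t \<in> {p..q} \<Longrightarrow> (\<psi> has_real_derivative \<psi>' t) (at t within {p..q})"
    and \<psi>': "\<And>t. t \<in> {p..q} \<Longrightarrow> (\<psi>' has_real_derivative \<psi>2 t) (at t within {p..q})"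
    and pos: "\<And>t. t \<in> {p..q} \<Longrightarrow> \<psi> t > 0"
    and ends: "u p \<le> c * \<psi> p" "u q \<le> c * \<psi> q"
    and ineq: "\<And>t. \<lbrakk>p < t; t < q; u t > c * \<psi> t\<rbrakk> \<Longrightarrow> u2 t * \<psi> t \<ge> u t * \<psi>2 t"
    and t: "t \<in> {p..q}"
  shows "u t \<le> c * \<psi> t"
proof (rule ccontr)
  assume "\<not> u t \<le> c * \<psi> t"
  define w where "w = (\<lambda>t. u t / \<psi> t - c)"
  have wpos: "w s > 0 \<longleftrightarrow> u s > c * \<psi> s" if "s \<in> {p..q}" for s
    using pos[OF that] by (simp add: w_def field_simps)
  have w_le: "w s \<le> 0 \<longleftrightarrow> u s \<le> c * \<psi> s" if "s \<in> {p..q}" for s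
    using pos[OF that] by (simp add: w_def field_simps)
  define W where "W = (\<lambda>t. u' t * \<psi> t - u t * \<psi>' t)"
  have dw: "(w has_real_derivative W s / (\<psi> s)\<^sup>2) (at s within {p..q})" if "s \<in> {p..q}" for s
    unfolding w_def W_def using u[OF that] \<psi>[OF that] pos[OF that]
    by (auto intro!: derivative_eq_intros simp: power2_eq_square)
  have dW: "(W has_real_derivative (u2 s * \<psi> s - u s * \<psi>2 s)) (at s within {p..q})"
    if "s \<in> {p..q}" for s
    unfolding W_def using u[OF that] \<psi>[OF that] u'[OF that] \<psi>'[OF that]
    by (auto intro!: derivative_eq_intros simp: algebra_simps)
  have "continuous_on {p..q} w" using dw by (rule DERIV_continuous_on)
  moreover have "p \<in> {p..q}" "q \<in> {p..q}" using t by auto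
  ultimately obtain a b where ab: "p \<le> a" "a < t" "t < b" "b \<le> q" "w a = 0" "w b = 0"
    and posw: "\<And>s. a < s \<Longrightarrow> s < b \<Longrightarrow> w s > 0"
    using positive_component[of p q w t] ends t wpos w_le \<open>\<not> u t \<le> c * \<psi> t\<close> by (metis not_le)
  have wt: "w t > 0" using posw ab by blast
  obtain x where x: "a < x" "x < t" "w t - w a = W x / (\<psi> x)\<^sup>2 * (t - a)"
    using mvt_within[OF dw, of a t] ab t by auto
  obtain y where y: "t < y" "y < b" "w b - w t = W y / (\<psi> y)\<^sup>2 * (b - t)"
    using mvt_within[OF dw, of t b] ab t by auto
  have "\<psi> x > 0" "\<psi> y > 0" using x y ab pos by auto
  have "W x > 0"
  proof (rule ccontr)
    assume "\<not> W x > 0"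
    then have "W x / (\<psi> x)\<^sup>2 * (t - a) \<le> 0"
      using ab by (intro mult_nonpos_nonneg divide_nonpos_nonneg) auto
    then show False using x wt ab by simp
  qed
  have "W y < 0"
  proof (rule ccontr)
    assume "\<not> W y < 0"
    then have "W y / (\<psi> y)\<^sup>2 * (b - t) \<ge> 0"
      using ab by (intro mult_nonneg_nonneg divide_nonneg_nonneg) auto
    then show False using y wt ab by simp
  qed
  have "W x \<le> W y"
  proof (rule mono_within[of a b W "\<lambda>s. u2 s * \<psi> s - u s * \<psi>2 s"])
    show "(W has_real_derivative u2 s * \<psi> s - u s * \<psi>2 s) (at s within {a..b})" if "s \<in> {a..b}" for s
      using dW[of s] that ab by (auto intro: DERIV_subset)
    show "0 \<le> u2 s * \<psi> s - u s * \<psi>2 s" if "a < s" "s < b" for s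
      using ineq[of s] posw[OF that] wpos[of s] ab that by auto
  qed (use x y in auto)
  then show False using \<open>W x > 0\<close> \<open>W y < 0\<close> by simp
qed

lemma convex_le:
  fixes u u' u2 :: "real \<Rightarrow> real"
  assumes u: "\<And>t. t \<in> {p..q} \<Longrightarrow> (u has_real_derivative u' t) (at t within {p..q})"
    and u': "\<And>t. t \<in> {p..q} \<Longrightarrow> (u' has_real_derivative u2 t) (at t within {p..q})"
    and ends: "u p \<le> c" "u q \<le> c"
    and ineq: "\<And>t. \<lbrakk>p < t; t < q; u t > c\<rbrakk> \<Longrightarrow> u2 t \<ge> 0"
    and t: "t \<in> {p..q}"
  shows "u t \<le> c"
proof -
  have "u t \<le> c * 1"
    by (rule maximum_principle[of p q u u' u2 "\<lambda>_. 1" "\<lambda>_. 0" "\<lambda>_. 0"]) (use assms in auto)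
  then show ?thesis by simp
qed

text \<open>The sign of \<open>u2\<close> is demanded only where \<open>u\<close> is below
  \<open>c\<close>. This suits truncated problems: where a solution is negative, its truncated
  right-hand side is known and has the right sign.\<close>

lemma concave_ge:
  fixes u u' u2 :: "real \<Rightarrow> real"
  assumes u: "\<And>t. t \<in> {p..q} \<Longrightarrow> (u has_real_derivative u' t) (at t within {p..q})"
    and u': "\<And>t. t \<in> {p..q} \<Longrightarrow> (u' has_real_derivative u2 t) (at t within {p..q})"
    and ends: "u p \<ge> c" "u q \<ge> c"
    and ineq: "\<And>t. \<lbrakk>p < t; t < q; u t < c\<rbrakk> \<Longrightarrow> u2 t \<le> 0"
    and t: "t \<in> {p..q}"
  shows "u t \<ge> c"
proof -
  have "- u t \<le> - c"
  proof (rule convex_le[of p q "\<lambda>t. - u t" "\<lambda>t. - u' t" "\<lambda>t. - u2 t"])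
    show "((\<lambda>t. - u t) has_real_derivative - u' s) (at s within {p..q})"
      "((\<lambda>t. - u' t) has_real_derivative - u2 s) (at s within {p..q})" if "s \<in> {p..q}" for s
      using u[OF that] u'[OF that] by (auto intro: DERIV_minus)
  qed (use ends ineq t in auto)
  then show ?thesis by simp
qed

text \<open>Concavity puts \<open>u\<close> above the tent with apex \<open>u s\<close>. On either
  side the tent is at least \<open>u s\<close> times the product of \<open>(t - p) / (q - p)\<close>
  and \<open>(q - t) / (q - p)\<close>, since both factors are at most 1. The weaker polynomial
  bound has a shape independent of \<open>s\<close> and can therefore serve as a weight in
  integrals.\<close>

lemma concave_ge_parabola:
  fixes u u' u2 :: "real \<Rightarrow> real"
  assumes u: "\<And>t. t \<in> {p..q} \<Longrightarrow> (u has_real_derivative u' t) (at t within {p..q})"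
    and u': "\<And>t. t \<in> {p..q} \<Longrightarrow> (u' has_real_derivative u2 t) (at t within {p..q})"
    and ends: "u p \<ge> 0" "u q \<ge> 0"
    and conc: "\<And>t. \<lbrakk>p < t; t < q\<rbrakk> \<Longrightarrow> u2 t \<le> 0"
    and pq: "p < q" and s: "s \<in> {p..q}" and t: "t \<in> {p..q}"
  shows "u t \<ge> u s * ((t - p) * (q - t)) / (q - p)\<^sup>2"
proof -
  have u0: "u t \<ge> 0" if "t \<in> {p..q}" for t
    using concave_ge[OF u u', where c = 0 and t = t] ends conc that by auto
  have chord: "u x \<ge> v0 + (x - a) * (v1 - v0) / (b - a)"
    if ab: "p \<le> a" "a < b" "b \<le> q" "x \<in> {a..b}" and v: "u a \<ge> v0" "u b \<ge> v1" for a b x v0 v1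
  proof -
    define k where "k = (v1 - v0) / (b - a)"
    have "u x - (v0 + (x - a) * k) \<ge> 0"
    proof (rule concave_ge[of a b "\<lambda>x. u x - (v0 + (x - a) * k)" "\<lambda>x. u' x - k" u2 0])
      fix y assume y: "y \<in> {a..b}"
      have "(u has_real_derivative u' y) (at y within {a..b})"
        "(u' has_real_derivative u2 y) (at y within {a..b})"
        using u[of y] u'[of y] y ab by (auto intro: DERIV_subset)
      then show "((\<lambda>x. u x - (v0 + (x - a) * k)) has_real_derivative u' y - k) (at y within {a..b})"
        "((\<lambda>x. u' x - k) has_real_derivative u2 y) (at y within {a..b})"
        by (auto intro!: derivative_eq_intros)
    qed (use ab v conc in \<open>auto simp: k_def\<close>)
    then show ?thesis by (simp add: k_def)
  qed
  define e where "e = (t - p) * (q - t) / (q - p)\<^sup>2"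
  have us: "u s \<ge> 0" using u0 s by blast
  have "u t \<ge> u s * e"
  proof (cases "t \<le> s")
    case True
    show ?thesis
    proof (cases "t = p")
      case True then show ?thesis using ends by (simp add: e_def)
    next
      case False
      then have ps: "p < s" using True t by auto
      have "u t \<ge> 0 + (t - p) * (u s - 0) / (s - p)"
        using chord[of p s t 0 "u s"] ps True t s ends by auto
      moreover have "(t - p) / (s - p) \<ge> e"
      proof -
        have "(t - p) / (s - p) \<ge> (t - p) / (q - p)"
          using ps s t by (intro divide_left_mono) auto
        moreover have "(t - p) / (q - p) * ((q - t) / (q - p)) \<le> (t - p) / (q - p) * 1"
          using t pq by (intro mult_left_mono) auto
        ultimately show ?thesis by (simp add: e_def power2_eq_square)
      qed
      ultimately show ?thesis using mult_left_mono[OF _ us, of e "(t - p) / (s - p)"]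
        by (simp add: mult.commute)
    qed
  next
    case False
    then have qs: "s < q" using t by auto
    have "u t \<ge> u s + (t - s) * (0 - u s) / (q - s)"
      using chord[of s q t "u s" 0] qs False t s ends by auto
    also have "u s + (t - s) * (0 - u s) / (q - s) = u s * ((q - t) / (q - s))"
      using qs by (simp add: field_simps)
    finally have "u t \<ge> u s * ((q - t) / (q - s))" .
    moreover have "(q - t) / (q - s) \<ge> e"
    proof -
      have "(q - t) / (q - s) \<ge> (q - t) / (q - p)"
        using qs s t by (intro divide_left_mono) auto
      moreover have "(q - t) / (q - p) * ((t - p) / (q - p)) \<le> (q - t) / (q - p) * 1"
        using t pq by (intro mult_left_mono) auto
      ultimately show ?thesis by (simp add: e_def power2_eq_square mult.commute)
    qed
    ultimately show ?thesis using mult_left_mono[OF _ us, of e "(q - t) / (q - s)"] by simp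
  qed
  then show ?thesis by (simp add: e_def)
qed

lemma nonzero_interior:
  fixes f :: "real \<Rightarrow> real"
  assumes "p < q" "continuous_on {p..q} f" "t \<in> {p..q}" "f t \<noteq> 0"
  obtains s where "p < s" "s < q" "f s \<noteq> 0"
proof -
  have "\<exists>s\<in>{p<..<q}. f s \<noteq> 0"
  proof (rule ccontr)
    assume "\<not> ?thesis"
    then have "f t = 0"
      using continuous_constant_on_closure[of "{p<..<q}" f 0 t] assms by simp
    then show False using assms by simp
  qed
  then show ?thesis using that by auto
qed

lemma integral_pos_continuous:
  fixes f :: "real \<Rightarrow> real"
  assumes cont: "continuous_on {p..q} f" and nn: "\<And>t. t \<in> {p..q} \<Longrightarrow> f t \<ge> 0"
    and s: "p < q" "s \<in> {p..q}" "f s \<noteq> 0"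
  shows "integral {p..q} f > 0"
proof -
  have "integral {p..q} f \<ge> 0" using nn by (intro integral_nonneg integrable_continuous_real cont) auto
  moreover have "integral {p..q} f \<noteq> 0"
    using integral_eq_0_iff[OF cont s(1)] nn s by auto
  ultimately show ?thesis by simp
qed

text \<open>Lagrange's identity with all boundary terms kept. Comparing two equations by it replaces
  the variational characterisation of eigenvalues.\<close>

lemma wronskian_has_integral:
  fixes u u' u2 v v' v2 :: "real \<Rightarrow> real"
  assumes "p \<le> q"
    and "\<And>t. t \<in> {p..q} \<Longrightarrow> (u has_real_derivative u' t) (at t within {p..q})"
    and "\<And>t. t \<in> {p..q} \<Longrightarrow> (u' has_real_derivative u2 t) (at t within {p..q})"
    and "\<And>t. t \<in> {p..q} \<Longrightarrow> (v has_real_derivative v' t) (at t within {p..q})"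
    and "\<And>t. t \<in> {p..q} \<Longrightarrow> (v' has_real_derivative v2 t) (at t within {p..q})"
  shows "((\<lambda>t. u2 t * v t - u t * v2 t) has_integral
           (u' q * v q - u q * v' q) - (u' p * v p - u p * v' p)) {p..q}"
proof (rule fundamental_theorem_of_calculus[OF \<open>p \<le> q\<close>])
  fix t assume t: "t \<in> {p..q}"
  have "((\<lambda>t. u' t * v t - u t * v' t) has_real_derivative u2 t * v t - u t * v2 t) (at t within {p..q})"
    using assms(2-5)[OF t] by (auto intro!: derivative_eq_intros simp: algebra_simps)
  then show "((\<lambda>t. u' t * v t - u t * v' t) has_vector_derivative u2 t * v t - u t * v2 t) (at t within {p..q})"
    by (simp add: has_real_derivative_iff_has_vector_derivative)
qed

section \<open>The principal Dirichlet eigenvalue\<close>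

text \<open>The solution operator of \<open>- v'' = h\<close> with zero boundary values, written
  with iterated integrals instead of the Green kernel so that both derivatives come from the
  fundamental theorem of calculus.\<close>

definition green :: "real \<Rightarrow> real \<Rightarrow> (real \<Rightarrow> real) \<Rightarrow> real \<Rightarrow> real" where
  "green p q h t = (t - p) / (q - p) * integral {p..q} (\<lambda>s. integral {p..s} h)
     - integral {p..t} (\<lambda>s. integral {p..s} h)"

definition green' :: "real \<Rightarrow> real \<Rightarrow> (real \<Rightarrow> real) \<Rightarrow> real \<Rightarrow> real" where
  "green' p q h t = integral {p..q} (\<lambda>s. integral {p..s} h) / (q - p) - integral {p..t} h"

lemma green_ends: "p < q \<Longrightarrow> green p q h p = 0" "p < q \<Longrightarrow> green p q h q = 0"
  by (auto simp: green_def)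

lemma continuous_on_integral_upper:
  fixes h :: "real \<Rightarrow> real"
  assumes "continuous_on {p..q} h"
  shows "continuous_on {p..q} (\<lambda>s. integral {p..s} h)"
  using integral_has_real_derivative[OF assms] by (rule DERIV_continuous_on)

lemma green_deriv:
  assumes h: "continuous_on {p..q} h" and pq: "p < q" and t: "t \<in> {p..q}"
  shows "(green p q h has_real_derivative green' p q h t) (at t within {p..q})"
    "(green' p q h has_real_derivative - h t) (at t within {p..q})"
  unfolding green_def[abs_def] green'_def[abs_def]
  using integral_has_real_derivative[OF h t]
    integral_has_real_derivative[OF continuous_on_integral_upper[OF h] t]
  using pq by (auto intro!: derivative_eq_intros)

lemma continuous_on_green:
  "continuous_on {p..q} h \<Longrightarrow> p < q \<Longrightarrow> continuous_on {p..q} (green p q h)"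
  using green_deriv(1) by (rule DERIV_continuous_on)

lemma integral_upper_diff_le:
  fixes h k :: "real \<Rightarrow> real"
  assumes h: "continuous_on {p..q} h" and k: "continuous_on {p..q} k"
    and d: "\<And>t. t \<in> {p..q} \<Longrightarrow> \<bar>h t - k t\<bar> \<le> d" and t: "t \<in> {p..q}"
  shows "\<bar>integral {p..t} h - integral {p..t} k\<bar> \<le> d * (q - p)"
proof -
  have c: "continuous_on {p..t} h" "continuous_on {p..t} k"
    using h k t by (auto intro: continuous_on_subset)
  have "0 \<le> d" using d[OF t] by linarith
  have "integral {p..t} h - integral {p..t} k = integral {p..t} (\<lambda>s. h s - k s)"
    using c by (simp add: integral_diff integrable_continuous_real)
  moreover have "norm (integral {p..t} (\<lambda>s. h s - k s)) \<le> d * (t - p)"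
    using t c d by (intro integral_bound) (auto intro: continuous_intros)
  moreover have "d * (t - p) \<le> d * (q - p)" using \<open>0 \<le> d\<close> t by (intro mult_left_mono) auto
  ultimately show ?thesis by simp
qed

lemma green_diff_le:
  assumes h: "continuous_on {p..q} h" and k: "continuous_on {p..q} k" and pq: "p < q"
    and d: "\<And>t. t \<in> {p..q} \<Longrightarrow> \<bar>h t - k t\<bar> \<le> d" and t: "t \<in> {p..q}"
  shows "\<bar>green p q h t - green p q k t\<bar> \<le> 2 * d * (q - p)\<^sup>2"
    "\<bar>green' p q h t - green' p q k t\<bar> \<le> 2 * d * (q - p)"
proof -
  have tri: "\<bar>c\<bar> \<le> x + x" if "\<bar>a\<bar> \<le> x" "c = a - b" "\<bar>b\<bar> \<le> x" for a b c x :: real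
    using that by linarith
  let ?V = "\<lambda>h t. integral {p..t} (\<lambda>s. integral {p..s} h)"
  have V1: "\<bar>integral {p..t} h - integral {p..t} k\<bar> \<le> d * (q - p)" if "t \<in> {p..q}" for t
    using integral_upper_diff_le[OF h k d that] by blast
  have V: "\<bar>?V h t - ?V k t\<bar> \<le> d * (q - p) * (q - p)" if "t \<in> {p..q}" for t
    using integral_upper_diff_le[OF continuous_on_integral_upper[OF h] continuous_on_integral_upper[OF k] V1 that]
    by blast
  have Vq: "\<bar>?V h q - ?V k q\<bar> \<le> d * (q - p) * (q - p)" using V[of q] pq by simp
  have "\<bar>(t - p) / (q - p) * (?V h q - ?V k q)\<bar> \<le> d * (q - p) * (q - p)"
    unfolding abs_mult using mult_mono[of "\<bar>(t - p) / (q - p)\<bar>" 1, OF _ Vq] t pq by auto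
  moreover have "green p q h t - green p q k t = (t - p) / (q - p) * (?V h q - ?V k q) - (?V h t - ?V k t)"
    by (simp add: green_def right_diff_distrib)
  ultimately have "\<bar>green p q h t - green p q k t\<bar> \<le> d * (q - p) * (q - p) + d * (q - p) * (q - p)"
    using V[OF t] tri by blast
  then show "\<bar>green p q h t - green p q k t\<bar> \<le> 2 * d * (q - p)\<^sup>2"
    by (simp add: power2_eq_square mult.assoc)
  have "\<bar>(?V h q - ?V k q) / (q - p)\<bar> \<le> d * (q - p)"
    using Vq pq by (simp add: abs_divide divide_le_eq)
  moreover have "green' p q h t - green' p q k t =
      (?V h q - ?V k q) / (q - p) - (integral {p..t} h - integral {p..t} k)"
    by (simp add: green'_def diff_divide_distrib)
  ultimately have "\<bar>green' p q h t - green' p q k t\<bar> \<le> d * (q - p) + d * (q - p)"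
    using V1[OF t] tri by blast
  then show "\<bar>green' p q h t - green' p q k t\<bar> \<le> 2 * d * (q - p)" by (simp add: mult.assoc)
qed

lemma green_bound:
  assumes h: "continuous_on {p..q} h" and pq: "p < q"
    and M: "\<And>t. t \<in> {p..q} \<Longrightarrow> \<bar>h t\<bar> \<le> M" and t: "t \<in> {p..q}"
  shows "\<bar>green p q h t\<bar> \<le> 2 * M * (q - p)\<^sup>2" "\<bar>green' p q h t\<bar> \<le> 2 * M * (q - p)"
  using green_diff_le[OF h continuous_on_const[of _ 0] pq _ t, of M] M
  by (simp_all add: green_def green'_def)

lemma green_lipschitz:
  assumes h: "continuous_on {p..q} h" and pq: "p < q"
    and M: "\<And>t. t \<in> {p..q} \<Longrightarrow> \<bar>h t\<bar> \<le> M" and s: "s \<in> {p..q}" and t: "t \<in> {p..q}"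
  shows "\<bar>green p q h s - green p q h t\<bar> \<le> 2 * M * (q - p) * \<bar>s - t\<bar>"
proof -
  have "norm (green p q h s - green p q h t) \<le> 2 * M * (q - p) * norm (s - t)"
    by (rule field_differentiable_bound[of "{p..q}" _ "green' p q h"])
      (use green_deriv[OF h pq] green_bound[OF h pq M] s t in auto)
  then show ?thesis by simp
qed

lemma green_nonneg:
  assumes h: "continuous_on {p..q} h" and pq: "p < q"
    and pos: "\<And>t. t \<in> {p..q} \<Longrightarrow> h t \<ge> 0" and t: "t \<in> {p..q}"
  shows "green p q h t \<ge> 0"
  by (rule concave_ge[OF green_deriv[OF h pq]]) (use pos t pq in \<open>auto simp: green_ends\<close>)

text \<open>Testing with \<open>(t - p) * (q - t)\<close>, whose second derivative is -2, turns the
  weighted integral of \<open>h\<close> into twice the integral of the solution. The parabola bound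
  for concave functions, integrated over its base point \<open>s\<close>, then bounds the solution
  below by a parabola times its own integral. This quantitative positivity takes the place of a
  Krein-Rutman argument.\<close>

lemma green_lower_bound:
  assumes h: "continuous_on {p..q} h" and pq: "p < q"
    and pos: "\<And>t. t \<in> {p..q} \<Longrightarrow> h t \<ge> 0" and t: "t \<in> {p..q}"
  shows "green p q h t \<ge> (t - p) * (q - t) / (2 * (q - p) ^ 3) * integral {p..q} (\<lambda>s. (s - p) * (q - s) * h s)"
proof -
  let ?v = "green p q h" and ?e = "\<lambda>t. (t - p) * (q - t)"
  have "((\<lambda>t. - h t * ?e t - ?v t * (- 2)) has_integral
     (green' p q h q * ?e q - ?v q * (p + q - 2 * q)) - (green' p q h p * ?e p - ?v p * (p + q - 2 * p))) {p..q}"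
    by (rule wronskian_has_integral[where v' = "\<lambda>t. p + q - 2 * t"])
      (use pq green_deriv[OF h pq] in \<open>auto intro!: derivative_eq_intros\<close>)
  then have z: "((\<lambda>t. - h t * ?e t + 2 * ?v t) has_integral 0) {p..q}"
    using pq by (simp add: green_ends mult.commute)
  have cv: "continuous_on {p..q} ?v" using h pq by (rule continuous_on_green)
  have iv: "?v integrable_on {p..q}" using cv by (rule integrable_continuous_real)
  have ih: "(\<lambda>t. ?e t * h t) integrable_on {p..q}"
    by (intro integrable_continuous_real continuous_intros h)
  have "integral {p..q} (\<lambda>t. 2 * ?v t - ?e t * h t) = 0"
    using z by (intro integral_unique) (simp add: algebra_simps)
  then have eq: "integral {p..q} (\<lambda>t. ?e t * h t) = 2 * integral {p..q} ?v"
    using iv ih by (simp add: integral_diff)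
  have "?e t / (q - p)\<^sup>2 * ?v s \<le> ?v t" if s: "s \<in> {p..q}" for s
    using concave_ge_parabola[OF green_deriv[OF h pq] _ _ _ pq s t] pq pos by (simp add: green_ends mult.commute)
  then have "integral {p..q} (\<lambda>s. ?e t / (q - p)\<^sup>2 * ?v s) \<le> integral {p..q} (\<lambda>s. ?v t)"
    using pq by (intro integral_le integrable_continuous_real continuous_intros cv) auto
  then have "?e t / (q - p)\<^sup>2 * integral {p..q} ?v \<le> ?v t * (q - p)"
    using pq by (simp add: mult.commute)
  then have "(?e t / (q - p)\<^sup>2 * integral {p..q} ?v) / (q - p) \<le> ?v t"
    using pq by (simp add: pos_divide_le_eq mult_ac)
  moreover have "?e t / (2 * (q - p) ^ 3) * (2 * integral {p..q} ?v) = (?e t / (q - p)\<^sup>2 * integral {p..q} ?v) / (q - p)"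
    by (simp add: power2_eq_square power3_eq_cube mult.assoc)
  ultimately show ?thesis unfolding eq by linarith
qed

text \<open>With \<open>\<delta> = 0\<close> this is a principal eigenfunction; with small \<open>\<delta> > 0\<close> it is positive up to the
  boundary while \<open>\<kappa>\<close> is only slightly smaller. In the proof \<open>P\<close> pushes \<open>\<theta>\<close> away from zero, so that
  the normalising denominator is bounded below even for \<open>\<delta> = 0\<close>; at the fixed point \<open>P \<theta> = \<theta>\<close>.\<close>

lemma positive_eigenfunction_raised:
  fixes a :: "real \<Rightarrow> real" and p q \<delta> :: real
  assumes pq: "p < q" and a: "continuous_on {p..q} a" and a0: "\<And>t. t \<in> {p..q} \<Longrightarrow> a t \<ge> 0"
    and ne: "s0 \<in> {p..q}" "a s0 \<noteq> 0" and \<delta>: "\<delta> \<ge> 0"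
  obtains \<theta> \<theta>' \<kappa> where "\<kappa> > 0"
    "\<And>t. t \<in> {p..q} \<Longrightarrow> (\<theta> has_real_derivative \<theta>' t) (at t within {p..q})"
    "\<And>t. t \<in> {p..q} \<Longrightarrow> (\<theta>' has_real_derivative - \<kappa> * a t * \<theta> t) (at t within {p..q})"
    "\<theta> p = \<kappa> * \<delta>" "\<theta> q = \<kappa> * \<delta>"
    "\<And>t. t \<in> {p..q} \<Longrightarrow> \<theta> t \<ge> 0"
    "integral {p..q} (\<lambda>t. a t * ((t - p) * (q - t)) * \<theta> t) = 1"
proof -
  define e where "e = (\<lambda>t. (t - p) * (q - t))"
  define J where "J = integral {p..q} (\<lambda>t. a t * e t * e t)"
  define I0 where "I0 = integral {p..q} (\<lambda>t. a t * e t)"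
  have ce: "continuous_on {p..q} e" unfolding e_def by (intro continuous_intros)
  have e0: "e t \<ge> 0" if "t \<in> {p..q}" for t using that by (simp add: e_def)
  obtain s1 where s1: "p < s1" "s1 < q" "a s1 \<noteq> 0" using nonzero_interior[OF pq a ne] .
  then have es1: "e s1 \<noteq> 0" by (simp add: e_def)
  have J: "J > 0" unfolding J_def
    by (rule integral_pos_continuous[of _ _ _ s1]) (use a ce a0 e0 pq s1 es1 in \<open>auto intro!: continuous_intros\<close>)
  have I0: "I0 > 0" unfolding I0_def
    by (rule integral_pos_continuous[of _ _ _ s1]) (use a ce a0 e0 pq s1 es1 in \<open>auto intro!: continuous_intros\<close>)
  \<comment> \<open>The normalising functional. For concave nonnegative \<open>v\<close> the
    parabola bound, integrated against the weight, gives \<open>v t \<le> C1 * N v\<close>, so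
    dividing by \<open>N v\<close> yields functions bounded by \<open>C1\<close>.\<close>
  define N where "N = (\<lambda>f. integral {p..q} (\<lambda>t. a t * e t * f t))"
  have intN: "(\<lambda>t. a t * e t * f t) integrable_on {p..q}" if "continuous_on {p..q} f" for f
    by (intro integrable_continuous_real continuous_intros a ce that)
  have N_const: "N (\<lambda>_. c) = I0 * c" for c by (simp add: N_def I0_def)
  have N_mono: "N f \<le> N g" if "continuous_on {p..q} f" "continuous_on {p..q} g"
    "\<And>t. t \<in> {p..q} \<Longrightarrow> f t \<le> g t" for f g
    unfolding N_def using that a0 e0 by (intro integral_le intN mult_left_mono) auto
  have N_cmult: "N (\<lambda>t. c * f t) = c * N f" for c f
    by (simp add: N_def mult.left_commute)
  have N_add: "N (\<lambda>t. f t + g t) = N f + N g" if "continuous_on {p..q} f" "continuous_on {p..q} g" for f g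
    unfolding N_def using intN that by (simp add: distrib_left integral_add)
  have N_diff_le: "\<bar>N f - N g\<bar> \<le> I0 * d" if "continuous_on {p..q} f" "continuous_on {p..q} g"
    "\<And>t. t \<in> {p..q} \<Longrightarrow> \<bar>f t - g t\<bar> \<le> d" for f g d
  proof -
    have "N f \<le> N (\<lambda>t. g t + d)" "N g \<le> N (\<lambda>t. f t + d)"
      using that by (auto intro!: N_mono continuous_intros simp: abs_le_iff) (smt (verit) that(3) atLeastAtMost_iff)+
    then show ?thesis using that by (simp add: N_add N_const)
  qed
  obtain A where A: "A > 0" "\<And>t. t \<in> {p..q} \<Longrightarrow> \<bar>a t\<bar> \<le> A"
    using compact_imp_bounded[OF compact_continuous_image[OF a compact_Icc]] by (auto simp: bounded_pos)
  define C1 where "C1 = (q - p)\<^sup>2 / J"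
  \<comment> \<open>A lower bound for the denominator: with \<open>N (P \<theta>) \<ge> 1\<close>
    the Green estimate gives \<open>v \<theta> \<ge> e / (2 * (q - p) ^ 3)\<close>, and
    \<open>N e = J\<close>.\<close>
  define D0 where "D0 = J / (2 * (q - p) ^ 3)"
  have C1: "C1 > 0" and D0: "D0 > 0" using J pq by (auto simp: C1_def D0_def)
  define cl where "cl = (\<lambda>\<theta> :: real \<Rightarrow> real. \<lambda>t. max 0 (min (\<theta> t) C1))"
  \<comment> \<open>On the constant \<open>c\<close> the functional \<open>N\<close> takes the value
    \<open>I0 * c\<close>, so the added constant lifts \<open>N (P \<theta>)\<close> to at least 1
    and disappears once \<open>N (cl \<theta>)\<close> has reached 1.\<close>
  define P where "P = (\<lambda>\<theta> t. cl \<theta> t + max 0 (1 - N (cl \<theta>)) / I0)"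
  define h where "h = (\<lambda>\<theta> t. a t * P \<theta> t)"
  define v where "v = (\<lambda>\<theta> t. green p q (h \<theta>) t + \<delta>)"
  define T where "T = (\<lambda>\<theta> t. v \<theta> t / N (v \<theta>))"
  have ccl: "continuous_on {p..q} (cl \<theta>)" if "continuous_on {p..q} \<theta>" for \<theta>
    unfolding cl_def by (intro continuous_intros that)
  have cP: "continuous_on {p..q} (P \<theta>)" if "continuous_on {p..q} \<theta>" for \<theta>
    unfolding P_def using ccl[OF that] I0 by (intro continuous_intros) auto
  have ch: "continuous_on {p..q} (h \<theta>)" if "continuous_on {p..q} \<theta>" for \<theta>
    unfolding h_def by (intro continuous_intros cP that a)
  have cv: "continuous_on {p..q} (v \<theta>)" if "continuous_on {p..q} \<theta>" for \<theta>
    unfolding v_def by (intro continuous_intros continuous_on_green ch that pq)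
  have P_bd: "0 \<le> P \<theta> t" "P \<theta> t \<le> C1 + 1 / I0" if "continuous_on {p..q} \<theta>" for \<theta> t
  proof -
    have "N (\<lambda>_. 0) \<le> N (cl \<theta>)" using ccl[OF that] by (intro N_mono) (auto simp: cl_def)
    then have n0: "N (cl \<theta>) \<ge> 0" by (simp add: N_const)
    show "0 \<le> P \<theta> t" using I0 by (simp add: P_def cl_def)
    have "cl \<theta> t \<le> C1" using C1 by (simp add: cl_def)
    moreover have "max 0 (1 - N (cl \<theta>)) / I0 \<le> 1 / I0" using n0 I0 by (intro divide_right_mono) auto
    ultimately show "P \<theta> t \<le> C1 + 1 / I0" by (simp add: P_def)
  qed
  have h0: "h \<theta> t \<ge> 0" if "continuous_on {p..q} \<theta>" "t \<in> {p..q}" for \<theta> t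
    using P_bd that a0 by (simp add: h_def)
  have NP: "N (P \<theta>) \<ge> 1" if "continuous_on {p..q} \<theta>" for \<theta>
  proof -
    have "N (P \<theta>) = N (cl \<theta>) + I0 * (max 0 (1 - N (cl \<theta>)) / I0)"
      unfolding P_def using ccl[OF that] by (subst N_add) (auto simp: N_const)
    then show ?thesis using I0 by simp
  qed
  have v0: "v \<theta> t \<ge> 0" if "continuous_on {p..q} \<theta>" "t \<in> {p..q}" for \<theta> t
    unfolding v_def using green_nonneg[OF ch pq h0] that \<delta> by (simp add: add_nonneg_nonneg)
  have Nv: "N (v \<theta>) \<ge> D0" if c: "continuous_on {p..q} \<theta>" for \<theta>
  proof -
    have "1 / (2 * (q - p) ^ 3) * e t \<le> v \<theta> t" if t: "t \<in> {p..q}" for t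
    proof -
      have "integral {p..q} (\<lambda>s. (s - p) * (q - s) * h \<theta> s) = N (P \<theta>)"
        by (simp add: N_def h_def e_def mult_ac)
      then have "e t / (2 * (q - p) ^ 3) * N (P \<theta>) \<le> green p q (h \<theta>) t"
        using green_lower_bound[OF ch[OF c] pq h0[OF c] t] by (simp add: e_def)
      moreover have "e t / (2 * (q - p) ^ 3) * 1 \<le> e t / (2 * (q - p) ^ 3) * N (P \<theta>)"
        using NP[OF c] e0[OF t] pq by (intro mult_left_mono) auto
      ultimately show ?thesis using \<delta> by (simp add: v_def)
    qed
    then have "N (\<lambda>t. 1 / (2 * (q - p) ^ 3) * e t) \<le> N (v \<theta>)"
      using pq by (intro N_mono cv c continuous_intros ce) auto
    moreover have "N e = J" by (simp add: N_def J_def)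
    ultimately have "1 / (2 * (q - p) ^ 3) * J \<le> N (v \<theta>)" by (simp only: N_cmult)
    then show ?thesis by (simp add: D0_def)
  qed
  have dv: "(v \<theta> has_real_derivative green' p q (h \<theta>) t) (at t within {p..q})"
    "(green' p q (h \<theta>) has_real_derivative - h \<theta> t) (at t within {p..q})"
    if "continuous_on {p..q} \<theta>" "t \<in> {p..q}" for \<theta> t
    unfolding v_def using green_deriv[OF ch[OF that(1)] pq that(2)]
    by (auto intro!: derivative_eq_intros)
  have T_bd: "0 \<le> T \<theta> t" "T \<theta> t \<le> C1" if c: "continuous_on {p..q} \<theta>" and t: "t \<in> {p..q}" for \<theta> t
  proof -
    show "0 \<le> T \<theta> t" using v0 Nv D0 that by (simp add: T_def order.trans[OF less_imp_le])
    have "v \<theta> t / (q - p)\<^sup>2 * e s \<le> v \<theta> s" if s: "s \<in> {p..q}" for s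
      using concave_ge_parabola[OF dv[OF c] _ _ _ pq t s] v0[OF c] h0[OF c] pq by (simp add: e_def)
    then have "N (\<lambda>s. v \<theta> t / (q - p)\<^sup>2 * e s) \<le> N (v \<theta>)"
      using pq by (intro N_mono cv c continuous_intros ce) auto
    moreover have "N e = J" by (simp add: N_def J_def)
    ultimately have "v \<theta> t / (q - p)\<^sup>2 * J \<le> N (v \<theta>)" by (simp only: N_cmult)
    then have "v \<theta> t \<le> C1 * N (v \<theta>)" using pq J by (simp add: C1_def field_simps)
    then show "T \<theta> t \<le> C1" using Nv[OF c] D0 by (simp add: T_def pos_divide_le_eq)
  qed
  define M where "M = A * (C1 + 1 / I0)"
  have h_bd: "\<bar>h \<theta> t\<bar> \<le> M" if "continuous_on {p..q} \<theta>" "t \<in> {p..q}" for \<theta> t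
    unfolding h_def M_def abs_mult using A P_bd[OF that(1), of t] that by (intro mult_mono) auto
  have M0: "M \<ge> 0" using A C1 I0 by (simp add: M_def)
  obtain \<theta> where c\<theta>: "continuous_on {p..q} \<theta>" and fp: "\<And>t. t \<in> {p..q} \<Longrightarrow> T \<theta> t = \<theta> t"
  proof (rule schauder_fixed_point[of "{p..q}" T "C1 + 1" "2 * M * (q - p) / D0"])
    show "\<bar>T u t\<bar> < C1 + 1" if "continuous_on {p..q} u" "t \<in> {p..q}" for u t
      using T_bd[OF that] by simp
    show "\<bar>T u s - T u t\<bar> \<le> 2 * M * (q - p) / D0 * \<bar>s - t\<bar>"
      if c: "continuous_on {p..q} u" and s: "s \<in> {p..q}" and t: "t \<in> {p..q}" for u s t
    proof -
      have n: "N (v u) > 0" using Nv[OF c] D0 by linarith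
      have "\<bar>T u s - T u t\<bar> = \<bar>green p q (h u) s - green p q (h u) t\<bar> / N (v u)"
        using n by (simp add: T_def v_def abs_divide flip: diff_divide_distrib)
      also have "\<dots> \<le> (2 * M * (q - p) * \<bar>s - t\<bar>) / D0"
        using green_lipschitz[OF ch[OF c] pq h_bd[OF c] s t] Nv[OF c] D0 n
        by (intro frac_le) auto
      finally show ?thesis by simp
    qed
    fix \<epsilon> :: real assume \<epsilon>: "\<epsilon> > 0"
    define B where "B = 4 * A * (q - p)\<^sup>2 * (1 + C1 * I0) / D0"
    have B: "B > 0" using A pq C1 I0 D0 by (simp add: B_def add_pos_pos)
    show "\<exists>d>0. \<forall>u w. continuous_on {p..q} u \<longrightarrow> continuous_on {p..q} w \<longrightarrow>
        (\<forall>t\<in>{p..q}. \<bar>u t - w t\<bar> \<le> d) \<longrightarrow> (\<forall>t\<in>{p..q}. \<bar>T u t - T w t\<bar> \<le> \<epsilon>)"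
    proof (intro exI[of _ "\<epsilon> / B"] conjI allI impI ballI)
      fix u w t assume cu: "continuous_on {p..q} u" and cw: "continuous_on {p..q} w"
        and uw: "\<forall>t\<in>{p..q}. \<bar>u t - w t\<bar> \<le> \<epsilon> / B" and t: "t \<in> {p..q}"
      define d where "d = \<epsilon> / B"
      have d: "d \<ge> 0" using \<epsilon> B by (simp add: d_def)
      have cl_d: "\<bar>cl u t - cl w t\<bar> \<le> d" if "t \<in> {p..q}" for t
        using uw that by (fastforce simp: cl_def d_def)
      have "\<bar>N (cl u) - N (cl w)\<bar> \<le> I0 * d" by (rule N_diff_le[OF ccl[OF cu] ccl[OF cw] cl_d])
      then have "\<bar>max 0 (1 - N (cl u)) - max 0 (1 - N (cl w))\<bar> \<le> I0 * d" by linarith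
      then have "\<bar>max 0 (1 - N (cl u)) / I0 - max 0 (1 - N (cl w)) / I0\<bar> \<le> d"
        using I0 by (simp add: abs_divide pos_divide_le_eq mult.commute flip: diff_divide_distrib)
      then have P_d: "\<bar>P u t - P w t\<bar> \<le> 2 * d" if "t \<in> {p..q}" for t
        using cl_d[OF that] unfolding P_def by linarith
      have h_d: "\<bar>h u t - h w t\<bar> \<le> A * (2 * d)" if "t \<in> {p..q}" for t
        unfolding h_def right_diff_distrib[symmetric] abs_mult
        using A(2)[OF that] P_d[OF that] A(1) by (intro mult_mono) auto
      have v_d: "\<bar>v u t - v w t\<bar> \<le> 4 * A * (q - p)\<^sup>2 * d" if "t \<in> {p..q}" for t
        using green_diff_le(1)[OF ch[OF cu] ch[OF cw] pq h_d that] by (simp add: v_def mult_ac)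
      have N_d: "\<bar>N (v u) - N (v w)\<bar> \<le> I0 * (4 * A * (q - p)\<^sup>2 * d)"
        by (rule N_diff_le[OF cv[OF cu] cv[OF cw] v_d])
      have nu: "N (v u) > 0" and nw: "N (v w) > 0" using Nv[OF cu] Nv[OF cw] D0 by simp_all
      \<comment> \<open>Written so that the difference of the denominators multiplies the quotient
        \<open>T w t\<close>, already bounded by \<open>C1\<close>; \<open>B\<close> is the
        resulting Lipschitz constant.\<close>
      have "T u t - T w t = ((v u t - v w t) + T w t * (N (v w) - N (v u))) / N (v u)"
        using nu nw by (simp add: T_def field_simps)
      then have "\<bar>T u t - T w t\<bar> = \<bar>(v u t - v w t) + T w t * (N (v w) - N (v u))\<bar> / N (v u)"
        using nu by (simp add: abs_divide)
      also have "\<dots> \<le> (4 * A * (q - p)\<^sup>2 * d + C1 * (I0 * (4 * A * (q - p)\<^sup>2 * d))) / D0"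
      proof (rule frac_le)
        have "\<bar>T w t * (N (v w) - N (v u))\<bar> \<le> C1 * (I0 * (4 * A * (q - p)\<^sup>2 * d))"
          unfolding abs_mult using T_bd[OF cw t] N_d C1 by (intro mult_mono) auto
        then show "\<bar>(v u t - v w t) + T w t * (N (v w) - N (v u))\<bar>
          \<le> 4 * A * (q - p)\<^sup>2 * d + C1 * (I0 * (4 * A * (q - p)\<^sup>2 * d))"
          using v_d[OF t] by linarith
      qed (use Nv[OF cu] D0 A C1 I0 d in auto)
      also have "\<dots> = B * d" by (simp add: B_def algebra_simps)
      also have "\<dots> = \<epsilon>" using B by (simp add: d_def)
      finally show "\<bar>T u t - T w t\<bar> \<le> \<epsilon>" .
    qed (use \<epsilon> B in simp)
  qed (simp, blast)
  \<comment> \<open>The fixed point equation reads \<open>\<theta> = \<kappa> * v \<theta>\<close>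
    and gives \<open>N \<theta> = 1\<close>. Hence the clipping and the added constant are both
    inactive, and the source of \<open>v \<theta>\<close> is exactly
    \<open>a t * \<theta> t\<close>.\<close>
  define \<kappa> where "\<kappa> = 1 / N (v \<theta>)"
  have n: "N (v \<theta>) > 0" using Nv[OF c\<theta>] D0 by linarith
  have \<theta>v: "\<theta> t = \<kappa> * v \<theta> t" if "t \<in> {p..q}" for t using fp[OF that] by (simp add: T_def \<kappa>_def)
  have clt: "cl \<theta> t = \<theta> t" if "t \<in> {p..q}" for t
    using T_bd[OF c\<theta> that] fp[OF that] by (simp add: cl_def)
  have N_cong: "N f = N g" if "\<And>t. t \<in> {p..q} \<Longrightarrow> f t = g t" for f g
    unfolding N_def using that by (intro integral_cong) simp
  have N1: "N \<theta> = 1"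
  proof -
    have "N \<theta> = N (\<lambda>t. \<kappa> * v \<theta> t)" using \<theta>v by (rule N_cong)
    then show ?thesis using n unfolding N_cmult by (simp add: \<kappa>_def)
  qed
  have "N (cl \<theta>) = 1" using N_cong[OF clt] N1 by simp
  then have h_eq: "h \<theta> t = a t * \<theta> t" if "t \<in> {p..q}" for t
    using clt[OF that] by (simp add: h_def P_def)
  show ?thesis
  proof (rule that[of \<kappa> \<theta> "\<lambda>t. \<kappa> * green' p q (h \<theta>) t"])
    show "\<kappa> > 0" using n by (simp add: \<kappa>_def)
    fix t assume t: "t \<in> {p..q}"
    have "((\<lambda>t. \<kappa> * v \<theta> t) has_real_derivative \<kappa> * green' p q (h \<theta>) t) (at t within {p..q})"
      using dv(1)[OF c\<theta> t] by (auto intro!: derivative_eq_intros)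
    then show "(\<theta> has_real_derivative \<kappa> * green' p q (h \<theta>) t) (at t within {p..q})"
      by (rule has_field_derivative_transform_within[of _ _ _ _ 1]) (use t \<theta>v in auto)
    show "((\<lambda>t. \<kappa> * green' p q (h \<theta>) t) has_real_derivative - \<kappa> * a t * \<theta> t) (at t within {p..q})"
      using dv(2)[OF c\<theta> t] h_eq[OF t] by (auto intro!: derivative_eq_intros)
    show "\<theta> t \<ge> 0" using T_bd(1)[OF c\<theta> t] fp[OF t] by simp
  next
    show "\<theta> p = \<kappa> * \<delta>" "\<theta> q = \<kappa> * \<delta>" using pq \<theta>v by (simp_all add: v_def green_ends)
    show "integral {p..q} (\<lambda>t. a t * ((t - p) * (q - t)) * \<theta> t) = 1"
      using N1 by (simp add: N_def e_def)
  qed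
qed

text \<open>The first eigenvalue is defined as a least element, so one must be exhibited and all
  smaller ones excluded. A positive eigenfunction gives the candidate; for \<open>y\<close> below
  it, a raised eigenfunction is positive on the closed interval with some
  \<open>\<kappa> \<ge> y\<close>, and comparison with it forces any eigenfunction for
  \<open>y\<close> to vanish. These raised functions are part of the conclusion because they are the
  supersolutions needed later.\<close>

lemma principal_eigenvalue:
  fixes a :: "real \<Rightarrow> real" and p q :: real
  assumes pq: "p < q" and a: "continuous_on {p..q} a" and a0: "\<And>t. t \<in> {p..q} \<Longrightarrow> a t \<ge> 0"
    and ne: "s0 \<in> {p..q}" "a s0 \<noteq> 0"
  obtains lam \<phi> \<phi>' where "lam = first_dirichlet_eigenvalue a p q" "lam > 0"
    "\<And>t. t \<in> {p..q} \<Longrightarrow> (\<phi> has_real_derivative \<phi>' t) (at t within {p..q})"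
    "\<And>t. t \<in> {p..q} \<Longrightarrow> (\<phi>' has_real_derivative - lam * a t * \<phi> t) (at t within {p..q})"
    "\<phi> p = 0" "\<phi> q = 0" "\<And>t. p < t \<Longrightarrow> t < q \<Longrightarrow> \<phi> t > 0"
    "\<And>y. y < lam \<Longrightarrow> \<exists>\<kappa> \<psi> \<psi>'. y \<le> \<kappa> \<and> (\<forall>t\<in>{p..q}. \<psi> t > 0 \<and>
        (\<psi> has_real_derivative \<psi>' t) (at t within {p..q}) \<and>
        (\<psi>' has_real_derivative - \<kappa> * a t * \<psi> t) (at t within {p..q}))"
proof -
  let ?e = "\<lambda>t. (t - p) * (q - t)"
  obtain \<phi> \<phi>' lam where lam: "lam > 0"
    and \<phi>: "\<And>t. t \<in> {p..q} \<Longrightarrow> (\<phi> has_real_derivative \<phi>' t) (at t within {p..q})"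
    and \<phi>': "\<And>t. t \<in> {p..q} \<Longrightarrow> (\<phi>' has_real_derivative - lam * a t * \<phi> t) (at t within {p..q})"
    and \<phi>_ends0: "\<phi> p = lam * 0" "\<phi> q = lam * 0" and \<phi>0: "\<And>t. t \<in> {p..q} \<Longrightarrow> \<phi> t \<ge> 0"
    and \<phi>1: "integral {p..q} (\<lambda>t. a t * ?e t * \<phi> t) = 1"
    by (rule positive_eigenfunction_raised[OF pq a a0 ne order_refl]) (assumption, rule that)
  have \<phi>_ends: "\<phi> p = 0" "\<phi> q = 0" using \<phi>_ends0 by simp_all
  obtain s where s: "s \<in> {p..q}" "\<phi> s \<noteq> 0"
  proof (rule ccontr)
    assume "\<not> thesis"
    then have "\<And>t. t \<in> {p..q} \<Longrightarrow> \<phi> t = 0" using that by blast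
    then have "integral {p..q} (\<lambda>t. a t * ?e t * \<phi> t) = integral {p..q} (\<lambda>t. 0)"
      by (intro integral_cong) auto
    then show False using \<phi>1 by simp
  qed
  define c2 where "c2 = \<phi> s / (q - p)\<^sup>2"
  have c2: "c2 > 0" using s \<phi>0[OF s(1)] pq by (simp add: c2_def)
  have \<phi>_lower: "c2 * ?e t \<le> \<phi> t" if t: "t \<in> {p..q}" for t
    using concave_ge_parabola[OF \<phi> \<phi>' _ _ _ pq s(1) t] \<phi>_ends \<phi>0 a0 lam by (simp add: c2_def)
  have \<phi>_pos: "\<phi> t > 0" if "p < t" "t < q" for t
  proof -
    have "0 < c2 * ?e t" using that c2 by simp
    then show ?thesis using \<phi>_lower[of t] that by simp
  qed
  have super: "\<exists>\<kappa> \<psi> \<psi>'. y \<le> \<kappa> \<and> (\<forall>t\<in>{p..q}. \<psi> t > 0 \<and>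
        (\<psi> has_real_derivative \<psi>' t) (at t within {p..q}) \<and>
        (\<psi>' has_real_derivative - \<kappa> * a t * \<psi> t) (at t within {p..q}))" if y: "y < lam" for y
  proof -
    define c where "c = \<bar>\<phi>' p - \<phi>' q\<bar> + 1"
    have c: "c > 0" by (simp add: c_def)
    \<comment> \<open>Lagrange's identity for \<open>\<psi>\<close> and \<open>\<phi>\<close>
      equates \<open>lam - \<kappa>\<close> times the integral of
      \<open>a t * \<psi> t * \<phi> t\<close> with
      \<open>\<kappa> * \<delta> * (\<phi>' p - \<phi>' q)\<close>, and that integral is at least
      \<open>c2\<close>. So if \<open>\<kappa> < lam\<close>, the gap \<open>lam - \<kappa>\<close>
      is at most \<open>lam * \<delta> * c / c2\<close>, which this choice makes equal to
      \<open>lam - y\<close>.\<close>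
    define \<delta> where "\<delta> = (lam - y) * c2 / (lam * c)"
    have \<delta>: "\<delta> > 0" using y c2 lam c by (simp add: \<delta>_def)
    obtain \<psi> \<psi>' \<kappa> where \<kappa>: "\<kappa> > 0"
      and \<psi>: "\<And>t. t \<in> {p..q} \<Longrightarrow> (\<psi> has_real_derivative \<psi>' t) (at t within {p..q})"
      and \<psi>': "\<And>t. t \<in> {p..q} \<Longrightarrow> (\<psi>' has_real_derivative - \<kappa> * a t * \<psi> t) (at t within {p..q})"
      and \<psi>_ends: "\<psi> p = \<kappa> * \<delta>" "\<psi> q = \<kappa> * \<delta>" and \<psi>0: "\<And>t. t \<in> {p..q} \<Longrightarrow> \<psi> t \<ge> 0"
      and \<psi>1: "integral {p..q} (\<lambda>t. a t * ?e t * \<psi> t) = 1"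
      by (rule positive_eigenfunction_raised[OF pq a a0 ne less_imp_le[OF \<delta>]]) (assumption, rule that)
    have \<kappa>\<delta>: "\<kappa> * \<delta> > 0" using \<kappa> \<delta> by simp
    have \<psi>_pos: "\<psi> t > 0" if t: "t \<in> {p..q}" for t
    proof -
      have "\<psi> t \<ge> \<kappa> * \<delta>"
        by (rule concave_ge[OF \<psi> \<psi>' _ _ _ t]) (use \<psi>_ends \<psi>0 a0 \<kappa> in auto)
      then show ?thesis using \<kappa>\<delta> by linarith
    qed
    have "y \<le> \<kappa>"
    proof (cases "\<kappa> < lam")
      case True
      have c\<phi>: "continuous_on {p..q} \<phi>" "continuous_on {p..q} \<psi>"
        using DERIV_continuous_on[OF \<phi>] DERIV_continuous_on[OF \<psi>] by auto
      have int\<phi>: "(\<lambda>t. a t * \<psi> t * \<phi> t) integrable_on {p..q}"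
        "(\<lambda>t. c2 * (a t * ?e t * \<psi> t)) integrable_on {p..q}"
        by (intro integrable_continuous_real continuous_intros a c\<phi>)+
      have "((\<lambda>t. (- \<kappa> * a t * \<psi> t) * \<phi> t - \<psi> t * (- lam * a t * \<phi> t)) has_integral
          (\<psi>' q * \<phi> q - \<psi> q * \<phi>' q) - (\<psi>' p * \<phi> p - \<psi> p * \<phi>' p)) {p..q}"
        using pq by (intro wronskian_has_integral \<psi> \<psi>' \<phi> \<phi>') auto
      then have "((\<lambda>t. (lam - \<kappa>) * (a t * \<psi> t * \<phi> t)) has_integral \<kappa> * \<delta> * (\<phi>' p - \<phi>' q)) {p..q}"
        by (simp add: \<phi>_ends \<psi>_ends algebra_simps)
      then have "(lam - \<kappa>) * integral {p..q} (\<lambda>t. a t * \<psi> t * \<phi> t) = \<kappa> * \<delta> * (\<phi>' p - \<phi>' q)"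
        by (simp add: integral_unique flip: integral_mult_right)
      moreover have "c2 * 1 \<le> integral {p..q} (\<lambda>t. a t * \<psi> t * \<phi> t)"
      proof -
        have "c2 * (a t * ?e t * \<psi> t) \<le> a t * \<psi> t * \<phi> t" if "t \<in> {p..q}" for t
          using mult_left_mono[OF \<phi>_lower[OF that], of "a t * \<psi> t"] a0[OF that] \<psi>0[OF that]
          by (simp add: mult_ac)
        then have "integral {p..q} (\<lambda>t. c2 * (a t * ?e t * \<psi> t)) \<le> integral {p..q} (\<lambda>t. a t * \<psi> t * \<phi> t)"
          using int\<phi> by (intro integral_le) auto
        then show ?thesis using \<psi>1 by (simp only: integral_mult_right)
      qed
      ultimately have "(lam - \<kappa>) * c2 \<le> \<kappa> * \<delta> * (\<phi>' p - \<phi>' q)"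
        using True mult_left_mono[of "c2 * 1" "integral {p..q} (\<lambda>t. a t * \<psi> t * \<phi> t)" "lam - \<kappa>"] by simp
      also have "\<dots> \<le> \<kappa> * \<delta> * c" using \<kappa>\<delta> by (intro mult_left_mono) (auto simp: c_def)
      also have "\<dots> \<le> lam * \<delta> * c" using True \<delta> c by (intro mult_right_mono) auto
      also have "\<dots> = (lam - y) * c2" using lam c by (simp add: \<delta>_def)
      finally show ?thesis using c2 by simp
    qed (use y in simp)
    then show ?thesis using \<psi>_pos \<psi> \<psi>' by blast
  qed
  have "first_dirichlet_eigenvalue a p q = lam"
    unfolding first_dirichlet_eigenvalue_def
  proof (rule Least_equality)
    show "dirichlet_eigenvalue a p q lam"
      unfolding dirichlet_eigenvalue_def using \<phi> \<phi>' \<phi>_ends s by blast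
    fix y assume "dirichlet_eigenvalue a p q y"
    then obtain w and w' :: "real \<Rightarrow> real" and x where w: "\<And>t. t \<in> {p..q} \<Longrightarrow> (w has_real_derivative w' t) (at t within {p..q})"
      and w': "\<And>t. t \<in> {p..q} \<Longrightarrow> (w' has_real_derivative - y * a t * w t) (at t within {p..q})"
      and w_ends: "w p = 0" "w q = 0" and x: "x \<in> {p..q}" "w x \<noteq> 0"
      unfolding dirichlet_eigenvalue_def by blast
    show "lam \<le> y"
    proof (rule ccontr)
      assume "\<not> lam \<le> y"
      then obtain \<kappa> \<psi> \<psi>' where \<kappa>: "y \<le> \<kappa>" and \<psi>0: "\<And>t. t \<in> {p..q} \<Longrightarrow> \<psi> t > 0"
        and \<psi>: "\<And>t. t \<in> {p..q} \<Longrightarrow> (\<psi> has_real_derivative \<psi>' t) (at t within {p..q})"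
        and \<psi>': "\<And>t. t \<in> {p..q} \<Longrightarrow> (\<psi>' has_real_derivative - \<kappa> * a t * \<psi> t) (at t within {p..q})"
        using super[of y] by (metis not_le)
      have le: "f x \<le> 0" if f: "\<And>t. t \<in> {p..q} \<Longrightarrow> (f has_real_derivative f' t) (at t within {p..q})"
        "\<And>t. t \<in> {p..q} \<Longrightarrow> (f' has_real_derivative - y * a t * f t) (at t within {p..q})"
        "f p = 0" "f q = 0" for f f'
      proof -
        have "f x \<le> 0 * \<psi> x"
        proof (rule maximum_principle[OF f(1,2) \<psi> \<psi>' \<psi>0 _ _ _ x(1)])
          fix t assume t: "p < t" "t < q" "0 * \<psi> t < f t"
          then have "y * (a t * f t * \<psi> t) \<le> \<kappa> * (a t * f t * \<psi> t)"
            using \<kappa> a0[of t] \<psi>0[of t] by (intro mult_right_mono mult_nonneg_nonneg) auto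
          then show "f t * (- \<kappa> * a t * \<psi> t) \<le> - y * a t * f t * \<psi> t" by (simp add: mult_ac)
        qed (use f in auto)
        then show ?thesis by simp
      qed
      have "w x \<le> 0" using le w w' w_ends by blast
      moreover have "- w x \<le> 0"
      proof (rule le[of "\<lambda>t. - w t" "\<lambda>t. - w' t"])
        fix t assume t: "t \<in> {p..q}"
        show "((\<lambda>t. - w t) has_real_derivative - w' t) (at t within {p..q})"
          using w[OF t] by (rule DERIV_minus)
        show "((\<lambda>t. - w' t) has_real_derivative - y * a t * - w t) (at t within {p..q})"
          using DERIV_minus[OF w'[OF t]] by simp
      qed (use w_ends in auto)
      ultimately show False using x by simp
    qed
  qed
  then show ?thesis using that[of lam \<phi> \<phi>'] lam \<phi> \<phi>' \<phi>_ends \<phi>_pos super by blast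
qed

section \<open>A boundary value problem with multipliers\<close>

lemma Sup_image_diff_le:
  fixes f g :: "real \<Rightarrow> real"
  assumes ne: "X \<noteq> {}" and bd: "bdd_above (f ` X)" "bdd_above (g ` X)"
    and d: "\<And>x. x \<in> X \<Longrightarrow> \<bar>f x - g x\<bar> \<le> d"
  shows "\<bar>Sup (f ` X) - Sup (g ` X)\<bar> \<le> d"
proof -
  have "Sup (f ` X) \<le> Sup (g ` X) + d"
  proof (rule cSup_least)
    fix y assume "y \<in> f ` X"
    then obtain x where x: "x \<in> X" "y = f x" by blast
    have "g x \<le> Sup (g ` X)" using x bd by (intro cSup_upper) auto
    then show "y \<le> Sup (g ` X) + d" using d[OF x(1)] x by linarith
  qed (use ne in simp)
  moreover have "Sup (g ` X) \<le> Sup (f ` X) + d"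
  proof (rule cSup_least)
    fix y assume "y \<in> g ` X"
    then obtain x where x: "x \<in> X" "y = g x" by blast
    have "f x \<le> Sup (f ` X)" using x bd by (intro cSup_upper) auto
    then show "y \<le> Sup (f ` X) + d" using d[OF x(1)] x by linarith
  qed (use ne in simp)
  ultimately show ?thesis by linarith
qed

lemma clip_diff_le: "\<bar>max p (min q x) - max p (min q y)\<bar> \<le> \<bar>x - y\<bar>" for p q x y :: real
  by linarith

text \<open>Apart from the outer cut at \<open>N\<close>, the equation says that \<open>e\<close> is
  the projection of \<open>e + m\<close> onto \<open>[r, R]\<close>: then \<open>e\<close> lies in
  that interval and \<open>m\<close> is an outward normal at \<open>e\<close>, positive only at
  \<open>R\<close> and negative only at \<open>r\<close>. Where the cut is active, at
  \<open>m = N\<close> or \<open>m = - N\<close>, one of the two inequalities for \<open>e\<close>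
  survives.\<close>

lemma multiplier_cases:
  fixes m e r R N :: real
  assumes "r \<le> R" "N > 0" and fix_eq: "m = max (- N) (min N (m + max r (min R (e + m)) - e))"
  shows "m = 0 \<Longrightarrow> r \<le> e \<and> e \<le> R" "m > 0 \<Longrightarrow> e \<le> R \<and> (m < N \<longrightarrow> e = R)"
    "m < 0 \<Longrightarrow> r \<le> e \<and> (- N < m \<longrightarrow> e = r)"
  using assms by (simp_all add: max_def min_def split: if_splits)

text \<open>Solutions that are large on an interval are unstable for the usual fixed point operator, so
  no invariant set contains them. The multiplier \<open>\<mu> i\<close> removes the instability: it acts as a source
  when positive and as an absorption when negative (so that \<open>u \<ge> 0\<close> persists), and it is driven by
  the distance of the maximum of \<open>u\<close> from \<open>[r, R]\<close>. In the proof the pair \<open>(u, \<mu>)\<close> is one function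
  on \<open>[0, L]\<close> together with the isolated points \<open>slot i\<close>.\<close>

lemma bvp_with_multipliers:
  fixes F :: "real \<Rightarrow> real \<Rightarrow> real" and a :: "nat \<Rightarrow> real \<Rightarrow> real" and I :: "nat set"
    and sg ta :: "nat \<Rightarrow> real" and L H r R N :: real
  assumes L: "L > 0" and F: "continuous_on ({0..L} \<times> {0..}) (\<lambda>z. F (fst z) (snd z))"
    and F0: "\<And>t. t \<in> {0..L} \<Longrightarrow> F t 0 = 0"
    and I: "finite I" and a: "\<And>i. i \<in> I \<Longrightarrow> continuous_on {0..L} (a i)"
    and a0: "\<And>i t. \<lbrakk>i \<in> I; t \<in> {0..L}\<rbrakk> \<Longrightarrow> a i t \<ge> 0"
    and sub: "\<And>i. i \<in> I \<Longrightarrow> 0 \<le> sg i \<and> sg i \<le> ta i \<and> ta i \<le> L"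
    and rR: "r \<le> R" and N: "N > 0"
    and H: "\<And>t s. \<lbrakk>t \<in> {0..L}; s \<ge> 0\<rbrakk> \<Longrightarrow> F t s + N * (\<Sum>i\<in>I. a i t) \<le> H"
  obtains u u' :: "real \<Rightarrow> real" and \<mu> :: "nat \<Rightarrow> real" where
    "\<And>t. t \<in> {0..L} \<Longrightarrow> (u has_real_derivative u' t) (at t within {0..L})"
    "\<And>t. t \<in> {0..L} \<Longrightarrow> (u' has_real_derivative
        - (F t (u t) + (\<Sum>i\<in>I. a i t * (max 0 (\<mu> i) - max 0 (- \<mu> i) * u t)))) (at t within {0..L})"
    "u 0 = 0" "u L = 0" "\<And>t. t \<in> {0..L} \<Longrightarrow> 0 \<le> u t \<and> u t \<le> H * L\<^sup>2"
    "\<And>i. i \<in> I \<Longrightarrow> \<bar>\<mu> i\<bar> \<le> N"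
    "\<And>i. \<lbrakk>i \<in> I; \<mu> i = 0\<rbrakk> \<Longrightarrow> r \<le> Sup (u ` {sg i..ta i}) \<and> Sup (u ` {sg i..ta i}) \<le> R"
    "\<And>i. \<lbrakk>i \<in> I; \<mu> i > 0\<rbrakk> \<Longrightarrow> Sup (u ` {sg i..ta i}) \<le> R \<and> (\<mu> i < N \<longrightarrow> Sup (u ` {sg i..ta i}) = R)"
    "\<And>i. \<lbrakk>i \<in> I; \<mu> i < 0\<rbrakk> \<Longrightarrow> r \<le> Sup (u ` {sg i..ta i}) \<and> (- N < \<mu> i \<longrightarrow> Sup (u ` {sg i..ta i}) = r)"
proof -
  have H0: "H \<ge> 0"
  proof -
    have "0 \<le> N * (\<Sum>i\<in>I. a i 0)" using a0 N L by (intro mult_nonneg_nonneg sum_nonneg) auto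
    then show ?thesis using H[of 0 0] F0[of 0] L by simp
  qed
  \<comment> \<open>The height bound that the solution will turn out to satisfy; clipping at
    \<open>C\<close> makes the operator bounded on all continuous functions and is inactive at the
    fixed point.\<close>
  define C where "C = H * L\<^sup>2"
  have C0: "C \<ge> 0" using H0 by (simp add: C_def)
  \<comment> \<open>The points -1, -2, ... lie at distance at least 1 from \<open>{0..L}\<close> and
    from each other, so any bounded values there satisfy a Lipschitz condition. \<open>idx\<close>
    recovers the index.\<close>
  define slot where "slot = (\<lambda>i :: nat. - real (Suc i))"
  define idx where "idx = (\<lambda>t :: real. nat \<lfloor>- t - 1\<rfloor>)"
  have idx: "idx (slot i) = i" and slot0: "slot i \<le> -1" for i by (simp_all add: idx_def slot_def)
  define S where "S = {0..L} \<union> slot ` I"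
  define M where "M = (\<lambda>U i. max (- N) (min N (U (slot i))))"
  define cl where "cl = (\<lambda>U :: real \<Rightarrow> real. \<lambda>t. max 0 (min (U t) C))"
  define h where "h = (\<lambda>U t. F t (cl U t) + (\<Sum>i\<in>I. a i t * (max 0 (M U i) - max 0 (- M U i) * cl U t)))"
  define ell where "ell = (\<lambda>U i. Sup (cl U ` {sg i..ta i}))"
  define upd where "upd = (\<lambda>U i. max (- N) (min N (M U i + max r (min R (ell U i + M U i)) - ell U i)))"
  define T where "T = (\<lambda>U t. if t \<ge> 0 then green 0 L (h U) t else upd U (idx t))"
  have T_slot: "T U (slot i) = upd U i" for U i using slot0[of i] by (simp add: T_def idx)
  have T_in: "T U t = green 0 L (h U) t" if "t \<in> {0..L}" for U t using that by (simp add: T_def)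
  have cU: "continuous_on {0..L} U" if "continuous_on S U" for U
    using that by (rule continuous_on_subset) (simp add: S_def)
  have cl_bd: "0 \<le> cl U t" "cl U t \<le> C" for U t using C0 by (auto simp: cl_def)
  have M_bd: "\<bar>M U i\<bar> \<le> N" for U i using N by (auto simp: M_def)
  have ccl: "continuous_on {0..L} (cl U)" if "continuous_on S U" for U
    unfolding cl_def by (intro continuous_intros cU that)
  have ch: "continuous_on {0..L} (h U)" if "continuous_on S U" for U
  proof -
    have "continuous_on {0..L} (\<lambda>t. F t (cl U t))"
    proof -
      have "continuous_on {0..L} (\<lambda>t. (t, cl U t))" by (intro continuous_intros ccl that)
      then have "continuous_on {0..L} (\<lambda>t. F (fst (t, cl U t)) (snd (t, cl U t)))"
        by (rule continuous_on_compose2[OF F]) (use cl_bd in auto)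
      then show ?thesis by simp
    qed
    then show ?thesis unfolding h_def by (intro continuous_intros a ccl that)
  qed
  have cF: "continuous_on ({0..L} \<times> {0..C}) (\<lambda>z. F (fst z) (snd z))"
    using F by (rule continuous_on_subset) auto
  have comp: "compact ({0..L} \<times> {0..C})" by (intro compact_Times compact_Icc)
  obtain FB where FB: "FB > 0" "\<And>t s. t \<in> {0..L} \<Longrightarrow> s \<in> {0..C} \<Longrightarrow> \<bar>F t s\<bar> \<le> FB"
  proof -
    have "bounded ((\<lambda>z. F (fst z) (snd z)) ` ({0..L} \<times> {0..C}))"
      using compact_continuous_image[OF cF comp] by (rule compact_imp_bounded)
    then obtain b where "b > 0" "\<forall>z\<in>{0..L} \<times> {0..C}. norm (F (fst z) (snd z)) \<le> b"
      by (auto simp: bounded_pos)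
    then show ?thesis using that[of b] by fastforce
  qed
  define As where "As = (\<lambda>t. \<Sum>i\<in>I. a i t)"
  have As0: "As t \<ge> 0" if "t \<in> {0..L}" for t unfolding As_def using a0 that by (intro sum_nonneg) auto
  obtain AB where AB: "AB > 0" "\<And>t. t \<in> {0..L} \<Longrightarrow> As t \<le> AB"
  proof -
    have "bounded (As ` {0..L})" unfolding As_def
      by (intro compact_imp_bounded compact_continuous_image continuous_intros a compact_Icc)
    then obtain b where "b > 0" "\<forall>t\<in>{0..L}. norm (As t) \<le> b" by (auto simp: bounded_pos)
    then show ?thesis using that[of b] by (auto simp: abs_le_iff)
  qed
  have sum_le: "\<bar>\<Sum>i\<in>I. a i t * x i\<bar> \<le> AB * d"
    if t: "t \<in> {0..L}" and x: "\<And>i. i \<in> I \<Longrightarrow> \<bar>x i\<bar> \<le> d" and d: "d \<ge> 0" for t x d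
  proof -
    have "\<bar>\<Sum>i\<in>I. a i t * x i\<bar> \<le> (\<Sum>i\<in>I. \<bar>a i t * x i\<bar>)" by (rule sum_abs)
    also have "\<dots> \<le> (\<Sum>i\<in>I. a i t * d)"
      using a0 t x by (intro sum_mono) (auto simp: abs_mult intro: mult_left_mono)
    also have "\<dots> = As t * d" by (simp add: As_def sum_distrib_right)
    also have "\<dots> \<le> AB * d" using AB(2)[OF t] d by (rule mult_right_mono)
    finally show ?thesis .
  qed
  define HB where "HB = FB + AB * (N + N * C)"
  have HB: "HB > 0" unfolding HB_def using FB AB N C0 by (intro add_pos_nonneg mult_nonneg_nonneg) auto
  have h_bd: "\<bar>h U t\<bar> \<le> HB" if "t \<in> {0..L}" for U t
  proof -
    have "\<bar>F t (cl U t)\<bar> \<le> FB" using FB(2)[OF that] cl_bd by simp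
    moreover have "\<bar>\<Sum>i\<in>I. a i t * (max 0 (M U i) - max 0 (- M U i) * cl U t)\<bar> \<le> AB * (N + N * C)"
    proof (rule sum_le[OF that])
      fix i
      have "\<bar>max 0 (- M U i) * cl U t\<bar> \<le> N * C"
        unfolding abs_mult using M_bd[of U i] cl_bd[of U t] N by (intro mult_mono) auto
      moreover have "\<bar>max 0 (M U i)\<bar> \<le> N" using M_bd[of U i] by linarith
      ultimately show "\<bar>max 0 (M U i) - max 0 (- M U i) * cl U t\<bar> \<le> N + N * C" by linarith
    qed (use N C0 in auto)
    ultimately show ?thesis unfolding h_def HB_def by linarith
  qed
  have upd_bd: "\<bar>upd U i\<bar> \<le> N" for U i using N by (auto simp: upd_def)
  define CB where "CB = 2 * HB * L\<^sup>2 + N + 1"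
  have T_bd: "\<bar>T U t\<bar> < CB" if U: "continuous_on S U" and t: "t \<in> S" for U t
  proof (cases "t \<ge> 0")
    case True
    have "t \<noteq> slot i" for i using slot0[of i] True by linarith
    then have "t \<in> {0..L}" using t by (auto simp: S_def)
    then have "\<bar>green 0 L (h U) t\<bar> \<le> 2 * HB * (L - 0)\<^sup>2"
      by (intro green_bound(1) ch U L h_bd)
    then show ?thesis using True N by (simp add: T_def CB_def)
  next
    case False
    have "0 \<le> 2 * HB * L\<^sup>2" using HB by simp
    then show ?thesis using False upd_bd[of U "idx t"] by (simp add: T_def CB_def)
  qed
  have CB: "CB > 0" using HB N by (simp add: CB_def add_pos_pos add_nonneg_pos)
  have compS: "compact S" unfolding S_def using I by (intro compact_Un compact_Icc finite_imp_compact) auto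
  obtain U where U: "continuous_on S U" and fp: "\<And>t. t \<in> S \<Longrightarrow> T U t = U t"
  proof (rule schauder_fixed_point[of S T CB "2 * HB * (L - 0) + 2 * CB"])
    show "compact S" by (rule compS)
    show "\<And>u t. continuous_on S u \<Longrightarrow> t \<in> S \<Longrightarrow> \<bar>T u t\<bar> < CB" by (rule T_bd)
    show "\<bar>T u s - T u t\<bar> \<le> (2 * HB * (L - 0) + 2 * CB) * \<bar>s - t\<bar>"
      if u: "continuous_on S u" and s: "s \<in> S" and t: "t \<in> S" for u s t
    proof -
      consider "s = t" | "s \<in> {0..L}" "t \<in> {0..L}" | "\<bar>s - t\<bar> \<ge> 1"
      proof -
        have "\<bar>x - y\<bar> \<ge> 1" if x: "x \<in> {0..L}" and y: "y \<in> slot ` I" for x y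
        proof -
          obtain i where "y = slot i" using y by blast
          then show ?thesis using x slot0[of i] by auto
        qed
        moreover have "x = y \<or> \<bar>x - y\<bar> \<ge> 1" if "x \<in> slot ` I" "y \<in> slot ` I" for x y
          using that by (auto simp: slot_def abs_real_def)
        ultimately show ?thesis using s t that unfolding S_def by (metis Un_iff abs_minus_commute)
      qed
      then show ?thesis
      proof cases
        case 2
        have "\<bar>green 0 L (h u) s - green 0 L (h u) t\<bar> \<le> 2 * HB * (L - 0) * \<bar>s - t\<bar>"
          by (intro green_lipschitz ch u L h_bd 2)
        moreover have "0 \<le> 2 * CB * \<bar>s - t\<bar>" using CB by simp
        ultimately show ?thesis using 2 by (simp add: T_in distrib_right)
      next
        case 3
        have "\<bar>T u s - T u t\<bar> \<le> 2 * CB" using T_bd[OF u s] T_bd[OF u t] by linarith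
        also have "\<dots> \<le> (2 * HB * (L - 0) + 2 * CB) * 1" using HB L by simp
        also have "\<dots> \<le> (2 * HB * (L - 0) + 2 * CB) * \<bar>s - t\<bar>" using 3 HB L CB by (intro mult_left_mono) auto
        finally show ?thesis .
      qed simp
    qed
    fix \<epsilon> :: real assume \<epsilon>: "\<epsilon> > 0"
    define \<epsilon>1 where "\<epsilon>1 = \<epsilon> / (4 * L\<^sup>2)"
    have \<epsilon>1: "\<epsilon>1 > 0" using \<epsilon> L by (simp add: \<epsilon>1_def)
    obtain d1 where d1: "d1 > 0" and Fd: "\<And>t s s'. \<lbrakk>t \<in> {0..L}; s \<in> {0..C}; s' \<in> {0..C}; \<bar>s - s'\<bar> < d1\<rbrakk>
        \<Longrightarrow> \<bar>F t s - F t s'\<bar> < \<epsilon>1"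
    proof -
      have "uniformly_continuous_on ({0..L} \<times> {0..C}) (\<lambda>z. F (fst z) (snd z))"
        by (rule compact_uniformly_continuous[OF cF comp])
      then obtain d where d: "d > 0" "\<forall>x\<in>{0..L} \<times> {0..C}. \<forall>x'\<in>{0..L} \<times> {0..C}.
          dist x' x < d \<longrightarrow> dist (F (fst x') (snd x')) (F (fst x) (snd x)) < \<epsilon>1"
        unfolding uniformly_continuous_on_def using \<epsilon>1 by meson
      have "\<bar>F t s - F t s'\<bar> < \<epsilon>1" if "t \<in> {0..L}" "s \<in> {0..C}" "s' \<in> {0..C}" "\<bar>s - s'\<bar> < d" for t s s'
        using d(2)[rule_format, of "(t, s')" "(t, s)"] that by (simp add: dist_Pair_Pair dist_real_def)
      then show ?thesis using that d by blast
    qed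
    \<comment> \<open>\<open>\<epsilon>1\<close> and \<open>B\<close> split the tolerance: in the
      Green estimate \<open>F\<close> contributes \<open>\<epsilon> / 2\<close> and the multiplier
      terms \<open>B * d / 2\<close>. The entry \<open>\<epsilon> / 4\<close> in \<open>d\<close>
      serves the multiplier update, which moves by at most \<open>4 * d\<close>.\<close>
    define B where "B = 4 * L\<^sup>2 * AB * (1 + C + N)"
    have B: "B > 0" using L AB C0 N by (simp add: B_def add_nonneg_pos add_pos_pos)
    define d where "d = min (d1 / 2) (min (\<epsilon> / 4) (\<epsilon> / B))"
    have d: "d > 0" "d < d1" "4 * d \<le> \<epsilon>" "B * d \<le> \<epsilon>"
    proof -
      show "d > 0" using d1 \<epsilon> B by (simp add: d_def)
      have le: "d \<le> d1 / 2" "d \<le> \<epsilon> / 4" "d \<le> \<epsilon> / B"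
        unfolding d_def
        by (rule min.cobounded1, rule min.coboundedI2[OF min.cobounded1], rule min.coboundedI2[OF min.cobounded2])
      then show "d < d1" "4 * d \<le> \<epsilon>" using d1 by linarith+
      show "B * d \<le> \<epsilon>" using le(3) B by (simp add: field_simps)
    qed
    show "\<exists>d>0. \<forall>u v. continuous_on S u \<longrightarrow> continuous_on S v \<longrightarrow>
        (\<forall>t\<in>S. \<bar>u t - v t\<bar> \<le> d) \<longrightarrow> (\<forall>t\<in>S. \<bar>T u t - T v t\<bar> \<le> \<epsilon>)"
    proof (intro exI[of _ d] conjI allI impI ballI)
      fix u v t assume u: "continuous_on S u" and v: "continuous_on S v"
        and uv: "\<forall>t\<in>S. \<bar>u t - v t\<bar> \<le> d" and t: "t \<in> S"
      have tri: "\<bar>(x - p) - (y - q)\<bar> \<le> e1 + (e2 + e3)"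
        if "p - q = b + c" "\<bar>b\<bar> \<le> e2" "\<bar>c\<bar> \<le> e3" "\<bar>x - y\<bar> \<le> e1" for x y p q b c e1 e2 e3 :: real
        using that by linarith
      have cl_d: "\<bar>cl u s - cl v s\<bar> \<le> d" if "s \<in> {0..L}" for s
      proof -
        have "\<bar>u s - v s\<bar> \<le> d" using uv that by (simp add: S_def)
        then show ?thesis unfolding cl_def by linarith
      qed
      have M_d: "\<bar>M u i - M v i\<bar> \<le> d" if "i \<in> I" for i
      proof -
        have "\<bar>u (slot i) - v (slot i)\<bar> \<le> d" using uv that by (simp add: S_def)
        then show ?thesis unfolding M_def by linarith
      qed
      show "\<bar>T u t - T v t\<bar> \<le> \<epsilon>"
      proof (cases "t \<in> {0..L}")
        case True
        have "\<bar>h u s - h v s\<bar> \<le> \<epsilon>1 + AB * (d * (1 + C + N))" if s: "s \<in> {0..L}" for s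
        proof -
          have "\<bar>F s (cl u s) - F s (cl v s)\<bar> < \<epsilon>1"
            using Fd[OF s] cl_bd cl_d[OF s] d by simp
          moreover have "\<bar>\<Sum>i\<in>I. a i s * ((max 0 (M u i) - max 0 (- M u i) * cl u s)
              - (max 0 (M v i) - max 0 (- M v i) * cl v s))\<bar> \<le> AB * (d * (1 + C + N))"
          proof (rule sum_le[OF s])
            fix i assume i: "i \<in> I"
            have "max 0 (- M u i) * cl u s - max 0 (- M v i) * cl v s
              = (max 0 (- M u i) - max 0 (- M v i)) * cl u s + max 0 (- M v i) * (cl u s - cl v s)"
              by (simp add: algebra_simps)
            moreover have "\<bar>(max 0 (- M u i) - max 0 (- M v i)) * cl u s\<bar> \<le> d * C"
              unfolding abs_mult using M_d[OF i] cl_bd[of u s] d by (intro mult_mono) auto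
            moreover have "\<bar>max 0 (- M v i) * (cl u s - cl v s)\<bar> \<le> N * d"
              unfolding abs_mult using M_bd[of v i] cl_d[OF s] N by (intro mult_mono) auto
            moreover have "\<bar>max 0 (M u i) - max 0 (M v i)\<bar> \<le> d" using M_d[OF i] by linarith
            ultimately have "\<bar>(max 0 (M u i) - max 0 (- M u i) * cl u s)
              - (max 0 (M v i) - max 0 (- M v i) * cl v s)\<bar> \<le> d + (d * C + N * d)"
              using tri by blast
            then show "\<bar>(max 0 (M u i) - max 0 (- M u i) * cl u s)
              - (max 0 (M v i) - max 0 (- M v i) * cl v s)\<bar> \<le> d * (1 + C + N)" by (simp add: algebra_simps)
          qed (use d C0 N in simp)
          moreover have "h u s - h v s = (F s (cl u s) - F s (cl v s)) +
             (\<Sum>i\<in>I. a i s * ((max 0 (M u i) - max 0 (- M u i) * cl u s)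
              - (max 0 (M v i) - max 0 (- M v i) * cl v s)))"
            by (simp add: h_def right_diff_distrib sum_subtractf)
          ultimately show ?thesis by linarith
        qed
        then have "\<bar>green 0 L (h u) t - green 0 L (h v) t\<bar> \<le> 2 * (\<epsilon>1 + AB * (d * (1 + C + N))) * (L - 0)\<^sup>2"
          by (intro green_diff_le(1) ch u v L True)
        also have "\<dots> = \<epsilon> / 2 + B * d / 2" using L by (simp add: \<epsilon>1_def B_def field_simps)
        also have "\<dots> \<le> \<epsilon>" using d by simp
        finally show ?thesis using True by (simp add: T_in)
      next
        case False
        then obtain i where i: "i \<in> I" "t = slot i" using t by (auto simp: S_def)
        have "\<bar>ell u i - ell v i\<bar> \<le> d" unfolding ell_def
        proof (rule Sup_image_diff_le)
          show "bdd_above (cl u ` {sg i..ta i})" "bdd_above (cl v ` {sg i..ta i})"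
            using cl_bd by (auto intro!: bdd_aboveI[of _ C])
        qed (use sub[OF i(1)] cl_d in auto)
        then have "\<bar>upd u i - upd v i\<bar> \<le> 4 * d"
          using M_d[OF i(1)] clip_diff_le[of r R "ell u i + M u i" "ell v i + M v i"]
            clip_diff_le[of "- N" N "M u i + max r (min R (ell u i + M u i)) - ell u i"
              "M v i + max r (min R (ell v i + M v i)) - ell v i"] unfolding upd_def
          by argo
        then show ?thesis using i d T_slot by simp
      qed
    qed (rule d)
  qed (rule that)
  define u where "u = green 0 L (h U)"
  define u' where "u' = green' 0 L (h U)"
  define \<mu> where "\<mu> = M U"
  have uU: "U t = u t" if "t \<in> {0..L}" for t
    using fp[of t] that T_in[OF that] by (simp add: S_def u_def)
  have du: "(u has_real_derivative u' t) (at t within {0..L})"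
    "(u' has_real_derivative - h U t) (at t within {0..L})" if "t \<in> {0..L}" for t
    unfolding u_def u'_def using green_deriv[OF ch[OF U] L that] by auto
  have ends: "u 0 = 0" "u L = 0" unfolding u_def using green_ends[OF L] by auto
  \<comment> \<open>Where \<open>u\<close> is negative, the clipping feeds 0 into \<open>F\<close>
    and into the absorption term; only nonnegative sources remain, so \<open>u\<close> is concave
    there.\<close>
  have u0: "u t \<ge> 0" if t: "t \<in> {0..L}" for t
  proof (rule concave_ge[OF du _ _ _ t])
    fix s assume s: "0 < s" "s < L" "u s < 0"
    then have "cl U s = 0" using uU[of s] by (simp add: cl_def)
    then have "h U s = (\<Sum>i\<in>I. a i s * max 0 (M U i))" using F0[of s] s by (simp add: h_def)
    also have "\<dots> \<ge> 0" using a0 s by (intro sum_nonneg mult_nonneg_nonneg) auto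
    finally show "- h U s \<le> 0" by simp
  qed (use ends in auto)
  have h_le: "h U s \<le> H" if s: "s \<in> {0..L}" for s
  proof -
    have "(\<Sum>i\<in>I. a i s * (max 0 (M U i) - max 0 (- M U i) * cl U s)) \<le> (\<Sum>i\<in>I. a i s * N)"
    proof (intro sum_mono mult_left_mono)
      fix i assume i: "i \<in> I"
      have "0 \<le> max 0 (- M U i) * cl U s" using cl_bd by simp
      then show "max 0 (M U i) - max 0 (- M U i) * cl U s \<le> N" using M_bd[of U i] N by linarith
    qed (use a0 s in auto)
    then show ?thesis using H[OF s cl_bd(1)[of U s]] by (simp add: h_def sum_distrib_left mult.commute)
  qed
  have u_le: "u t \<le> H * L\<^sup>2" if t: "t \<in> {0..L}" for t
  proof -
    \<comment> \<open>The parabola solves \<open>- v'' = H\<close> with zero boundary values, and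
      \<open>h U \<le> H\<close> makes the difference convex.\<close>
    have "u t - H * (t * (L - t)) / 2 \<le> 0"
    proof (rule convex_le[of 0 L "\<lambda>t. u t - H * (t * (L - t)) / 2" "\<lambda>t. u' t - H * (L - 2 * t) / 2" "\<lambda>t. - h U t + H"])
      fix s assume s: "s \<in> {0..L}"
      show "((\<lambda>t. u t - H * (t * (L - t)) / 2) has_real_derivative u' s - H * (L - 2 * s) / 2) (at s within {0..L})"
        using du(1)[OF s] by (auto intro!: derivative_eq_intros simp: field_simps)
      show "((\<lambda>t. u' t - H * (L - 2 * t) / 2) has_real_derivative - h U s + H) (at s within {0..L})"
        using du(2)[OF s] by (auto intro!: derivative_eq_intros)
    qed (use ends t h_le in auto)
    moreover have "t * (L - t) \<le> L * L" using t by (intro mult_mono) auto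
    then have "H * (t * (L - t)) \<le> H * (L * L)" using H0 by (rule mult_left_mono)
    moreover have "H * (L * L) \<ge> 0" using H0 by simp
    ultimately show ?thesis by (simp add: power2_eq_square)
  qed
  have clU: "cl U t = u t" if "t \<in> {0..L}" for t
    using u0[OF that] u_le[OF that] uU[OF that] by (simp add: cl_def C_def)
  have ell: "ell U i = Sup (u ` {sg i..ta i})" if "i \<in> I" for i
    unfolding ell_def using clU sub[OF that] by (intro arg_cong[of _ _ Sup] image_cong) auto
  have \<mu>: "\<mu> i = max (- N) (min N (\<mu> i + max r (min R (Sup (u ` {sg i..ta i}) + \<mu> i)) - Sup (u ` {sg i..ta i})))"
    if i: "i \<in> I" for i
  proof -
    have "U (slot i) = upd U i" using fp[of "slot i"] i by (simp add: S_def T_slot)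
    then have "\<mu> i = upd U i" using upd_bd[of U i] by (simp add: \<mu>_def M_def)
    then show ?thesis by (simp add: upd_def \<mu>_def ell[OF i])
  qed
  show ?thesis
  proof (rule that[of u u' \<mu>])
    show "(u' has_real_derivative - (F t (u t) + (\<Sum>i\<in>I. a i t * (max 0 (\<mu> i) - max 0 (- \<mu> i) * u t))))
        (at t within {0..L})" if "t \<in> {0..L}" for t
      using du(2)[OF that] clU[OF that] by (simp add: h_def \<mu>_def)
  qed (use du ends u0 u_le M_bd multiplier_cases[OF rR N \<mu>] in \<open>auto simp: \<mu>_def\<close>)
qed

section \<open>A priori estimates\<close>

text \<open>At an interior zero both \<open>u' + K u\<close> and \<open>u' - K u\<close> vanish, and their signs propagate to the
  right and to the left, respectively.\<close>

lemma positive_interior: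
  fixes u u' u2 :: "real \<Rightarrow> real"
  assumes u: "\<And>t. t \<in> {p..q} \<Longrightarrow> (u has_real_derivative u' t) (at t within {p..q})"
    and u': "\<And>t. t \<in> {p..q} \<Longrightarrow> (u' has_real_derivative u2 t) (at t within {p..q})"
    and u0: "\<And>t. t \<in> {p..q} \<Longrightarrow> u t \<ge> 0" and K: "K > 0"
    and le: "\<And>t. t \<in> {p..q} \<Longrightarrow> u2 t \<le> K\<^sup>2 * u t"
    and s: "s \<in> {p..q}" "u s > 0" and t: "p < t" "t < q"
  shows "u t > 0"
proof (rule ccontr)
  assume "\<not> u t > 0"
  then have ut: "u t = 0" using u0[of t] t by simp
  have "u' t = 0"
  proof (rule DERIV_local_min[of u "u' t" t "min (t - p) (q - t)"])
    show "(u has_real_derivative u' t) (at t)"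
      using u[of t] t at_within_interior[of t "{p..q}"] by simp
    show "\<forall>y. \<bar>t - y\<bar> < min (t - p) (q - t) \<longrightarrow> u t \<le> u y"
      using u0 ut by (auto simp: abs_real_def split: if_splits)
  qed (use t in auto)
  have exp_deriv: "((\<lambda>x. exp (c * x) * f x) has_real_derivative exp (c * x) * (c * f x + f' x)) (at x within X)"
    if "(f has_real_derivative f' x) (at x within X)" for f f' :: "real \<Rightarrow> real" and c x X
    using that by (auto intro!: derivative_eq_intros simp: algebra_simps)
  have right: "u x \<le> 0" if x: "t \<le> x" "x \<le> q" for x
  proof -
    \<comment> \<open>\<open>u'' - K\<^sup>2 u\<close> factors into two first-order operators.
      Integrating the first with the factor \<open>exp (- K * y)\<close> gives
      \<open>u' + K u \<le> 0\<close> to the right of \<open>t\<close>; integrating the second with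
      \<open>exp (K * y)\<close> shows that \<open>u\<close> cannot rise from its zero.\<close>
    have W: "exp (- K * y) * (u' y + K * u y) \<le> exp (- K * t) * (u' t + K * u t)" if y: "t \<le> y" "y \<le> q" for y
    proof (rule antimono_within[of p q "\<lambda>y. exp (- K * y) * (u' y + K * u y)"])
      fix z assume z: "z \<in> {p..q}"
      show "((\<lambda>y. exp (- K * y) * (u' y + K * u y)) has_real_derivative
          exp (- K * z) * (- K * (u' z + K * u z) + (u2 z + K * u' z))) (at z within {p..q})"
        using u[OF z] u'[OF z] by (intro exp_deriv) (auto intro!: derivative_eq_intros)
    next
      fix z assume z: "p < z" "z < q"
      have "- K * (u' z + K * u z) + (u2 z + K * u' z) \<le> 0"
        using le[of z] z by (simp add: algebra_simps power2_eq_square)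
      then show "exp (- K * z) * (- K * (u' z + K * u z) + (u2 z + K * u' z)) \<le> 0"
        by (simp add: mult_le_0_iff)
    qed (use t y in auto)
    have "exp (K * x) * u x \<le> exp (K * t) * u t"
    proof (rule antimono_within[of t q "\<lambda>y. exp (K * y) * u y" "\<lambda>z. exp (K * z) * (K * u z + u' z)"])
      fix z assume "z \<in> {t..q}"
      then have "(u has_real_derivative u' z) (at z within {t..q})"
        using u[of z] t by (auto intro: DERIV_subset)
      then show "((\<lambda>y. exp (K * y) * u y) has_real_derivative exp (K * z) * (K * u z + u' z)) (at z within {t..q})"
        by (rule exp_deriv)
    next
      fix z assume z: "t < z" "z < q"
      have "exp (- K * z) * (u' z + K * u z) \<le> 0" using W[of z] z ut \<open>u' t = 0\<close> by simp
      then show "exp (K * z) * (K * u z + u' z) \<le> 0" by (simp add: mult_le_0_iff add.commute)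
    qed (use x in auto)
    then show ?thesis using ut by (simp add: mult_le_0_iff)
  qed
  have left: "u x \<le> 0" if x: "p \<le> x" "x \<le> t" for x
  proof -
    have W: "exp (K * t) * (u' t - K * u t) \<le> exp (K * y) * (u' y - K * u y)" if y: "p \<le> y" "y \<le> t" for y
    proof (rule antimono_within[of p q "\<lambda>y. exp (K * y) * (u' y - K * u y)"])
      fix z assume z: "z \<in> {p..q}"
      show "((\<lambda>y. exp (K * y) * (u' y - K * u y)) has_real_derivative
          exp (K * z) * (K * (u' z - K * u z) + (u2 z - K * u' z))) (at z within {p..q})"
        using u[OF z] u'[OF z] by (intro exp_deriv) (auto intro!: derivative_eq_intros)
    next
      fix z assume z: "p < z" "z < q"
      have "K * (u' z - K * u z) + (u2 z - K * u' z) \<le> 0"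
        using le[of z] z by (simp add: algebra_simps power2_eq_square)
      then show "exp (K * z) * (K * (u' z - K * u z) + (u2 z - K * u' z)) \<le> 0"
        by (simp add: mult_le_0_iff)
    qed (use t y in auto)
    have "exp (- K * x) * u x \<le> exp (- K * t) * u t"
    proof (rule mono_within[of p t "\<lambda>y. exp (- K * y) * u y" "\<lambda>z. exp (- K * z) * (- K * u z + u' z)"])
      fix z assume "z \<in> {p..t}"
      then have "(u has_real_derivative u' z) (at z within {p..t})"
        using u[of z] t by (auto intro: DERIV_subset)
      then show "((\<lambda>y. exp (- K * y) * u y) has_real_derivative exp (- K * z) * (- K * u z + u' z)) (at z within {p..t})"
        by (rule exp_deriv)
    next
      fix z assume z: "p < z" "z < t"
      have "0 \<le> exp (K * z) * (u' z - K * u z)" using W[of z] z ut \<open>u' t = 0\<close> by simp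
      then show "0 \<le> exp (- K * z) * (- K * u z + u' z)" by (simp add: zero_le_mult_iff)
    qed (use x in auto)
    then show ?thesis using ut by (simp add: mult_le_0_iff)
  qed
  show False using left[of s] right[of s] s by force
qed

text \<open>By convexity the slope of \<open>u\<close> stays above \<open>- D\<close>. If
  \<open>u p\<close> were at least \<open>\<eta>\<close>, then \<open>u\<close> would remain above
  \<open>\<eta> / 2\<close> on a stretch whose length does not depend on \<beta>. As
  \<open>b\<close> does not vanish identically near \<open>p\<close>, the product of
  \<open>b\<close> and \<open>k u\<close> has a positive lower bound on a subinterval of that
  stretch, and a large \<beta> would drive \<open>u\<close> past \<open>C\<close>.\<close>

lemma small_at_left_end:
  fixes b k :: "real \<Rightarrow> real" and p q C D \<eta> :: real
  assumes pq: "p < q" and b: "continuous_on {p..q} b" and b0: "\<And>t. t \<in> {p..q} \<Longrightarrow> b t \<ge> 0"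
    and near: "\<And>\<epsilon>. \<epsilon> > 0 \<Longrightarrow> \<exists>t\<in>{p..min (p + \<epsilon>) q}. b t \<noteq> 0"
    and k: "continuous_on {0..} k" and k0: "\<And>s. s \<ge> 0 \<Longrightarrow> k s \<ge> 0" and kpos: "\<And>s. s > 0 \<Longrightarrow> k s > 0"
    and D: "D > 0" and \<eta>: "\<eta> > 0"
  obtains \<beta>0 where "\<beta>0 > 0" "\<And>\<beta> u u'. \<lbrakk>\<beta> > \<beta>0;
      \<And>t. t \<in> {p..q} \<Longrightarrow> (u has_real_derivative u' t) (at t within {p..q});
      \<And>t. t \<in> {p..q} \<Longrightarrow> (u' has_real_derivative \<beta> * b t * k (u t)) (at t within {p..q});
      \<And>t. t \<in> {p..q} \<Longrightarrow> 0 \<le> u t \<and> u t \<le> C; - D \<le> u' p\<rbrakk> \<Longrightarrow> u p < \<eta>"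
proof (cases "\<eta> \<le> C")
  case False
  have "u p < \<eta>" if "\<And>t. t \<in> {p..q} \<Longrightarrow> 0 \<le> u t \<and> u t \<le> C" for u :: "real \<Rightarrow> real"
    using that[of p] pq False by simp
  then show ?thesis using that[of 1] by fastforce
next
  case True
  define \<delta> where "\<delta> = min (q - p) (\<eta> / (2 * D))"
  have \<delta>: "\<delta> > 0" "p + \<delta> \<le> q" "D * \<delta> \<le> \<eta> / 2"
  proof -
    show "\<delta> > 0" using pq D \<eta> by (simp add: \<delta>_def)
    have le: "\<delta> \<le> q - p" "\<delta> \<le> \<eta> / (2 * D)" unfolding \<delta>_def by (rule min.cobounded1, rule min.cobounded2)
    then show "p + \<delta> \<le> q" by simp
    show "D * \<delta> \<le> \<eta> / 2" using le(2) D by (simp add: field_simps)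
  qed
  obtain t1 where "t1 \<in> {p..p + \<delta>}" "b t1 \<noteq> 0" using near[OF \<delta>(1)] \<delta>(2) by (auto simp: min_def)
  moreover have "continuous_on {p..p + \<delta>} b" using b \<delta> by (auto intro: continuous_on_subset)
  ultimately obtain c where c: "p < c" "c < p + \<delta>" "b c \<noteq> 0"
    using nonzero_interior[of p "p + \<delta>" b t1] \<delta> by auto
  have bc: "b c > 0" using b0[of c] c \<delta> by simp
  define b1 where "b1 = b c / 2"
  have b1: "b1 > 0" using bc by (simp add: b1_def)
  obtain e where e: "e > 0" "\<And>t. \<lbrakk>t \<in> {p..q}; \<bar>t - c\<bar> < e\<rbrakk> \<Longrightarrow> \<bar>b t - b c\<bar> < b1"
    using b[unfolded continuous_on_iff, rule_format, of c b1] b1 c \<delta> by (auto simp: dist_real_def)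
  define d where "d = min (c + e / 2) (p + \<delta>)"
  have d: "c < d" "d \<le> p + \<delta>" "d \<le> c + e / 2" using e c by (auto simp: d_def)
  have bge: "b t \<ge> b1" if "t \<in> {c..d}" for t
  proof -
    have "\<bar>b t - b c\<bar> < b1" using that d c \<delta> e(1) by (intro e(2)) auto
    then show ?thesis unfolding b1_def by linarith
  qed
  obtain \<kappa> where \<kappa>: "\<kappa> > 0" "\<And>s. s \<in> {\<eta> / 2..C} \<Longrightarrow> k s \<ge> \<kappa>"
  proof -
    have "\<exists>x\<in>{\<eta> / 2..C}. \<forall>y\<in>{\<eta> / 2..C}. k x \<le> k y"
      using True \<eta> by (intro continuous_attains_inf continuous_on_subset[OF k]) auto
    then obtain x where x: "x \<in> {\<eta> / 2..C}" "\<forall>y\<in>{\<eta> / 2..C}. k x \<le> k y" by blast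
    have "x > 0" using x(1) \<eta> by simp
    then show ?thesis using that[of "k x"] x kpos by blast
  qed
  \<comment> \<open>Integrating \<open>u'' \<ge> Q\<close> with
    \<open>Q = \<beta> * (b1 * \<kappa>)\<close> twice over \<open>[c, d]\<close>, starting from a
    slope of at least \<open>- D\<close>, gives
    \<open>u d \<ge> u c - D * (d - c) + Q * (d - c)\<^sup>2 / 2\<close>. \<open>\<beta>0\<close> is
    chosen so that the last term exceeds \<open>P\<close>, which is incompatible with
    \<open>u d \<le> C\<close>.\<close>
  define P where "P = C + D * (d - c) + 1"
  define \<beta>0 where "\<beta>0 = 2 * P / (b1 * \<kappa> * (d - c)\<^sup>2)"
  have P: "P > 0" using True \<eta> D d by (simp add: P_def add_pos_pos)
  have den: "b1 * \<kappa> * (d - c)\<^sup>2 > 0" using b1 \<kappa> d by simp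
  show ?thesis
  proof (rule that[of \<beta>0])
    show "\<beta>0 > 0" using P den by (simp add: \<beta>0_def)
    fix \<beta> and u u' :: "real \<Rightarrow> real"
    assume \<beta>: "\<beta> > \<beta>0"
      and u: "\<And>t. t \<in> {p..q} \<Longrightarrow> (u has_real_derivative u' t) (at t within {p..q})"
      and u': "\<And>t. t \<in> {p..q} \<Longrightarrow> (u' has_real_derivative \<beta> * b t * k (u t)) (at t within {p..q})"
      and ubd: "\<And>t. t \<in> {p..q} \<Longrightarrow> 0 \<le> u t \<and> u t \<le> C" and uD: "- D \<le> u' p"
    have \<beta>pos: "\<beta> > 0" using \<beta> \<open>\<beta>0 > 0\<close> by simp
    show "u p < \<eta>"
    proof (rule ccontr)
      assume "\<not> u p < \<eta>"
      have u'ge: "u' t \<ge> - D" if "t \<in> {p..q}" for t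
      proof -
        have "u' p \<le> u' t"
          by (rule mono_within[OF u']) (use that b0 k0 ubd \<beta>pos in auto)
        then show ?thesis using uD by simp
      qed
      have uge: "u t \<ge> \<eta> / 2" if t: "t \<in> {p..p + \<delta>}" for t
      proof -
        have "u p + D * p \<le> u t + D * t"
        proof (rule mono_within[of p q "\<lambda>t. u t + D * t" "\<lambda>t. u' t + D"])
          show "((\<lambda>t. u t + D * t) has_real_derivative u' s + D) (at s within {p..q})" if "s \<in> {p..q}" for s
            using u[OF that] by (auto intro!: derivative_eq_intros)
          show "0 \<le> u' s + D" if "p < s" "s < q" for s using u'ge[of s] that by simp
        qed (use t \<delta> in auto)
        moreover have "D * (t - p) \<le> D * \<delta>" using t D by (intro mult_left_mono) auto
        ultimately show ?thesis using \<open>\<not> u p < \<eta>\<close> \<delta>(3) by (simp add: algebra_simps)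
      qed
      define Q where "Q = \<beta> * (b1 * \<kappa>)"
      have Q: "\<beta> * b t * k (u t) \<ge> Q" if t: "t \<in> {c..d}" for t
      proof -
        have tt: "t \<in> {p..p + \<delta>}" "t \<in> {p..q}" using t c d \<delta> by auto
        have "k (u t) \<ge> \<kappa>" using uge[OF tt(1)] ubd[OF tt(2)] by (intro \<kappa>(2)) auto
        then have "b1 * \<kappa> \<le> b t * k (u t)" using bge[OF t] b1 \<kappa> by (intro mult_mono) auto
        then show ?thesis using \<beta>pos by (simp add: Q_def mult.assoc)
      qed
      have cd: "{c..d} \<subseteq> {p..q}" using c d \<delta> by auto
      have u'Q: "u' t \<ge> - D + Q * (t - c)" if t: "t \<in> {c..d}" for t
      proof -
        have "u' c - Q * c \<le> u' t - Q * t"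
        proof (rule mono_within[of c d "\<lambda>t. u' t - Q * t" "\<lambda>t. \<beta> * b t * k (u t) - Q"])
          show "((\<lambda>t. u' t - Q * t) has_real_derivative \<beta> * b s * k (u s) - Q) (at s within {c..d})" if "s \<in> {c..d}" for s
            using DERIV_subset[OF u' cd, of s] that cd by (auto intro!: derivative_eq_intros)
          show "0 \<le> \<beta> * b s * k (u s) - Q" if "c < s" "s < d" for s using Q[of s] that by simp
        qed (use t in auto)
        moreover have "u' c \<ge> - D" using u'ge[of c] c \<delta> by simp
        ultimately show ?thesis by (simp add: algebra_simps)
      qed
      have "u c + D * c - Q * (c - c)\<^sup>2 / 2 \<le> u d + D * d - Q * (d - c)\<^sup>2 / 2"
      proof (rule mono_within[of c d "\<lambda>t. u t + D * t - Q * (t - c)\<^sup>2 / 2" "\<lambda>t. u' t + D - Q * (t - c)"])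
        show "((\<lambda>t. u t + D * t - Q * (t - c)\<^sup>2 / 2) has_real_derivative u' s + D - Q * (s - c)) (at s within {c..d})"
          if "s \<in> {c..d}" for s
          using DERIV_subset[OF u cd, of s] that cd by (auto intro!: derivative_eq_intros)
        show "0 \<le> u' s + D - Q * (s - c)" if "c < s" "s < d" for s using u'Q[of s] that by simp
      qed (use d in auto)
      moreover have "u c \<ge> 0" "u d \<le> C" using ubd[of c] ubd[of d] cd d by auto
      moreover have "Q * (d - c)\<^sup>2 / 2 > P"
      proof -
        have "2 * P < \<beta> * (b1 * \<kappa> * (d - c)\<^sup>2)" using \<beta> den by (simp add: \<beta>0_def pos_divide_less_eq)
        then show ?thesis by (simp add: Q_def mult_ac)
      qed
      ultimately show False by (simp add: P_def algebra_simps)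
    qed
  qed
qed

lemma has_real_derivative_reflect:
  fixes f :: "real \<Rightarrow> real"
  assumes "(f has_real_derivative d) (at (- t) within {p..q})"
  shows "((\<lambda>t. f (- t)) has_real_derivative - d) (at t within {- q..- p})"
proof -
  have "(f has_real_derivative d) (at (- t) within uminus ` {- q..- p})" using assms by simp
  from DERIV_image_chain[OF this, of "- 1"] show ?thesis
    by (simp add: o_def DERIV_minus DERIV_ident)
qed

text \<open>Reflection at 0 exchanges the two ends and turns the upper slope bound at
  \<open>q\<close> into the lower one of the left-hand version.\<close>

lemma small_at_right_end:
  fixes b k :: "real \<Rightarrow> real" and p q C D \<eta> :: real
  assumes pq: "p < q" and b: "continuous_on {p..q} b" and b0: "\<And>t. t \<in> {p..q} \<Longrightarrow> b t \<ge> 0"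
    and near: "\<And>\<epsilon>. \<epsilon> > 0 \<Longrightarrow> \<exists>t\<in>{max (q - \<epsilon>) p..q}. b t \<noteq> 0"
    and k: "continuous_on {0..} k" and k0: "\<And>s. s \<ge> 0 \<Longrightarrow> k s \<ge> 0" and kpos: "\<And>s. s > 0 \<Longrightarrow> k s > 0"
    and D: "D > 0" and \<eta>: "\<eta> > 0"
  obtains \<beta>0 where "\<beta>0 > 0" "\<And>\<beta> u u'. \<lbrakk>\<beta> > \<beta>0;
      \<And>t. t \<in> {p..q} \<Longrightarrow> (u has_real_derivative u' t) (at t within {p..q});
      \<And>t. t \<in> {p..q} \<Longrightarrow> (u' has_real_derivative \<beta> * b t * k (u t)) (at t within {p..q});
      \<And>t. t \<in> {p..q} \<Longrightarrow> 0 \<le> u t \<and> u t \<le> C; u' q \<le> D\<rbrakk> \<Longrightarrow> u q < \<eta>"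
proof -
  have pq': "- q < - p" using pq by simp
  have c: "continuous_on {- q..- p} (\<lambda>t. b (- t))"
    by (rule continuous_on_compose2[OF b]) (auto intro!: continuous_intros)
  have nn: "b (- t) \<ge> 0" if "t \<in> {- q..- p}" for t using b0[of "- t"] that by simp
  have nr: "\<exists>t\<in>{- q..min (- q + \<epsilon>) (- p)}. b (- t) \<noteq> 0" if \<epsilon>: "\<epsilon> > 0" for \<epsilon>
  proof -
    obtain t where "t \<in> {max (q - \<epsilon>) p..q}" "b t \<noteq> 0" using near[OF \<epsilon>] by blast
    then show ?thesis by (intro bexI[of _ "- t"]) auto
  qed
  obtain \<beta>0 where \<beta>0: "\<beta>0 > 0" and small: "\<And>\<beta> u u'. \<lbrakk>\<beta> > \<beta>0;
      \<And>t. t \<in> {- q..- p} \<Longrightarrow> (u has_real_derivative u' t) (at t within {- q..- p});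
      \<And>t. t \<in> {- q..- p} \<Longrightarrow> (u' has_real_derivative \<beta> * b (- t) * k (u t)) (at t within {- q..- p});
      \<And>t. t \<in> {- q..- p} \<Longrightarrow> 0 \<le> u t \<and> u t \<le> C; - D \<le> u' (- q)\<rbrakk> \<Longrightarrow> u (- q) < \<eta>"
  proof (rule small_at_left_end[where C = C, OF pq' c nn nr k k0 kpos D \<eta>])
    fix \<beta>0 assume "\<beta>0 > 0" "\<And>\<beta> u u'. \<lbrakk>\<beta> > \<beta>0;
      \<And>t. t \<in> {- q..- p} \<Longrightarrow> (u has_real_derivative u' t) (at t within {- q..- p});
      \<And>t. t \<in> {- q..- p} \<Longrightarrow> (u' has_real_derivative \<beta> * b (- t) * k (u t)) (at t within {- q..- p});
      \<And>t. t \<in> {- q..- p} \<Longrightarrow> 0 \<le> u t \<and> u t \<le> C; - D \<le> u' (- q)\<rbrakk> \<Longrightarrow> u (- q) < \<eta>"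
    then show thesis by (rule that)
  qed
  show ?thesis
  proof (rule that[OF \<beta>0])
    fix \<beta> and u u' :: "real \<Rightarrow> real"
    assume \<beta>: "\<beta> > \<beta>0"
      and u: "\<And>t. t \<in> {p..q} \<Longrightarrow> (u has_real_derivative u' t) (at t within {p..q})"
      and u': "\<And>t. t \<in> {p..q} \<Longrightarrow> (u' has_real_derivative \<beta> * b t * k (u t)) (at t within {p..q})"
      and ubd: "\<And>t. t \<in> {p..q} \<Longrightarrow> 0 \<le> u t \<and> u t \<le> C" and uD: "u' q \<le> D"
    have "u (- (- q)) < \<eta>"
    proof (rule small[of \<beta> "\<lambda>t. u (- t)" "\<lambda>t. - u' (- t)"])
      fix t assume t: "t \<in> {- q..- p}"
      then have t': "- t \<in> {p..q}" by auto
      show "((\<lambda>t. u (- t)) has_real_derivative - u' (- t)) (at t within {- q..- p})"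
        by (rule has_real_derivative_reflect[OF u[OF t']])
      show "((\<lambda>t. - u' (- t)) has_real_derivative \<beta> * b (- t) * k (u (- t))) (at t within {- q..- p})"
        using DERIV_minus[OF has_real_derivative_reflect[OF u'[OF t']]] by simp
      show "0 \<le> u (- t) \<and> u (- t) \<le> C" by (rule ubd[OF t'])
    qed (use \<beta> uD in auto)
    then show "u q < \<eta>" by simp
  qed
qed

section \<open>Estimates on a single positivity interval, obtained by testing with its
  eigenfunction\<close>

locale principal_eigenfunction =
  fixes p q :: real and a \<phi> \<phi>' :: "real \<Rightarrow> real" and lam :: real
  assumes pq: "p < q" and a: "continuous_on {p..q} a" and a0: "\<And>t. t \<in> {p..q} \<Longrightarrow> a t \<ge> 0"
    and nontriv: "\<exists>t\<in>{p..q}. a t \<noteq> 0" and lam: "lam > 0"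
    and \<phi>: "\<And>t. t \<in> {p..q} \<Longrightarrow> (\<phi> has_real_derivative \<phi>' t) (at t within {p..q})"
    and \<phi>': "\<And>t. t \<in> {p..q} \<Longrightarrow> (\<phi>' has_real_derivative - lam * a t * \<phi> t) (at t within {p..q})"
    and \<phi>_ends: "\<phi> p = 0" "\<phi> q = 0" and \<phi>_pos: "\<And>t. p < t \<Longrightarrow> t < q \<Longrightarrow> \<phi> t > 0"
begin

lemma \<phi>_nonneg: "t \<in> {p..q} \<Longrightarrow> \<phi> t \<ge> 0"
  using \<phi>_pos[of t] \<phi>_ends by (cases "t = p \<or> t = q") auto

lemma \<phi>_cont: "continuous_on {p..q} \<phi>"
  using \<phi> by (rule DERIV_continuous_on)

lemma \<phi>'_antimono: "\<lbrakk>p \<le> x; x \<le> y; y \<le> q\<rbrakk> \<Longrightarrow> \<phi>' y \<le> \<phi>' x"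
  by (rule antimono_within[OF \<phi>']) (use a0 \<phi>_nonneg lam in auto)

lemma \<phi>'_ends: "\<phi>' p \<ge> 0" "\<phi>' q \<le> 0"
proof -
  define m where "m = (p + q) / 2"
  have m: "p < m" "m < q" using pq by (auto simp: m_def)
  obtain x where x: "p < x" "x < m" "\<phi> m - \<phi> p = \<phi>' x * (m - p)"
    using mvt_within[OF \<phi>, of p m] m by auto
  then have "\<phi>' x > 0" using \<phi>_pos[OF m] \<phi>_ends m by (metis diff_0_right diff_gt_0_iff_gt zero_less_mult_pos2)
  then show "\<phi>' p \<ge> 0" using \<phi>'_antimono[of p x] x m by simp
  obtain y where y: "m < y" "y < q" "\<phi> q - \<phi> m = \<phi>' y * (q - m)"
    using mvt_within[OF \<phi>, of m q] m by auto
  have "\<phi>' y < 0"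
  proof (rule ccontr)
    assume "\<not> \<phi>' y < 0"
    then have "\<phi>' y * (q - m) \<ge> 0" using m by simp
    then show False using y \<phi>_pos[OF m] \<phi>_ends by simp
  qed
  then show "\<phi>' q \<le> 0" using \<phi>'_antimono[of y q] y m by simp
qed

lemma weight_pos:
  assumes f: "continuous_on {p..q} f" "\<And>t. p < t \<Longrightarrow> t < q \<Longrightarrow> f t > 0" "\<And>t. t \<in> {p..q} \<Longrightarrow> f t \<ge> 0"
  shows "integral {p..q} (\<lambda>t. a t * f t * \<phi> t) > 0"
proof -
  obtain s where s: "p < s" "s < q" "a s \<noteq> 0" using nontriv nonzero_interior[OF pq a] by blast
  have "a s * f s * \<phi> s \<noteq> 0" using s \<phi>_pos[of s] f(2)[of s] by simp
  then show ?thesis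
    by (intro integral_pos_continuous[of _ _ _ s])
      (use a a0 f \<phi>_cont \<phi>_nonneg pq s in \<open>auto intro!: continuous_intros\<close>)
qed

lemma test_inequality:
  assumes u: "\<And>t. t \<in> {p..q} \<Longrightarrow> (u has_real_derivative u' t) (at t within {p..q})"
    and u': "\<And>t. t \<in> {p..q} \<Longrightarrow> (u' has_real_derivative u2 t) (at t within {p..q})"
    and ends: "u p \<ge> 0" "u q \<ge> 0" and z: "continuous_on {p..q} z"
    and le: "\<And>t. t \<in> {p..q} \<Longrightarrow> u2 t \<le> - a t * z t"
  shows "integral {p..q} (\<lambda>t. a t * (z t - lam * u t) * \<phi> t) \<le> 0"
proof -
  have cu: "continuous_on {p..q} u" using u by (rule DERIV_continuous_on)
  have "((\<lambda>t. u2 t * \<phi> t - u t * (- lam * a t * \<phi> t)) has_integral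
          (u' q * \<phi> q - u q * \<phi>' q) - (u' p * \<phi> p - u p * \<phi>' p)) {p..q}"
    using pq by (intro wronskian_has_integral u u' \<phi> \<phi>') auto
  then have hi: "((\<lambda>t. u2 t * \<phi> t - u t * (- lam * a t * \<phi> t)) has_integral (u p * \<phi>' p - u q * \<phi>' q)) {p..q}"
    by (simp add: \<phi>_ends)
  have "0 \<le> u p * \<phi>' p - u q * \<phi>' q"
    using ends \<phi>'_ends mult_nonneg_nonneg[of "u p" "\<phi>' p"] mult_nonneg_nonpos[of "u q" "\<phi>' q"] by linarith
  also have "\<dots> \<le> integral {p..q} (\<lambda>t. - (a t * (z t - lam * u t) * \<phi> t))"
  proof (rule has_integral_le[OF hi])
    show "((\<lambda>t. - (a t * (z t - lam * u t) * \<phi> t)) has_integral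
        integral {p..q} (\<lambda>t. - (a t * (z t - lam * u t) * \<phi> t))) {p..q}"
      by (intro integrable_integral integrable_continuous_real continuous_intros a z cu \<phi>_cont)
    fix t assume t: "t \<in> {p..q}"
    show "u2 t * \<phi> t - u t * (- lam * a t * \<phi> t) \<le> - (a t * (z t - lam * u t) * \<phi> t)"
      using mult_right_mono[OF le[OF t] \<phi>_nonneg[OF t]] by (simp add: algebra_simps)
  qed
  finally show ?thesis by simp
qed

definition bound :: "real \<Rightarrow> real \<Rightarrow> real" where
  "bound d c = c * integral {p..q} (\<lambda>t. a t * \<phi> t) * (q - p)\<^sup>2
     / (d * integral {p..q} (\<lambda>t. a t * ((t - p) * (q - t)) * \<phi> t))"

text \<open>Testing cancels the part \<open>lam * u\<close> and leaves an upper bound, proportional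
  to \<open>c / d\<close>, for the integral of \<open>u\<close> against the weight
  \<open>a t * \<phi> t\<close>. Concavity bounds the same integral below by a multiple of
  \<open>u s\<close>; \<open>bound\<close> is the quotient of the two.\<close>

lemma superlinear_bound:
  assumes d: "d > 0"
    and u: "\<And>t. t \<in> {p..q} \<Longrightarrow> (u has_real_derivative u' t) (at t within {p..q})"
    and u': "\<And>t. t \<in> {p..q} \<Longrightarrow> (u' has_real_derivative u2 t) (at t within {p..q})"
    and u0: "\<And>t. t \<in> {p..q} \<Longrightarrow> u t \<ge> 0" and conc: "\<And>t. t \<in> {p..q} \<Longrightarrow> u2 t \<le> 0"
    and le: "\<And>t. t \<in> {p..q} \<Longrightarrow> u2 t \<le> - a t * ((lam + d) * u t - c)" and s: "s \<in> {p..q}"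
  shows "u s \<le> bound d c"
proof -
  let ?e = "\<lambda>t. (t - p) * (q - t)"
  define J where "J = integral {p..q} (\<lambda>t. a t * ?e t * \<phi> t)"
  define I1 where "I1 = integral {p..q} (\<lambda>t. a t * \<phi> t)"
  have J: "J > 0" unfolding J_def by (rule weight_pos) (auto intro!: continuous_intros)
  have cu: "continuous_on {p..q} u" using u by (rule DERIV_continuous_on)
  have "integral {p..q} (\<lambda>t. a t * (((lam + d) * u t - c) - lam * u t) * \<phi> t) \<le> 0"
    by (rule test_inequality[OF u u' _ _ _ le]) (use u0 pq cu in \<open>auto intro!: continuous_intros\<close>)
  then have "integral {p..q} (\<lambda>t. d * (a t * u t * \<phi> t) - c * (a t * \<phi> t)) \<le> 0"
    by (simp add: algebra_simps)
  moreover have "(\<lambda>t. d * (a t * u t * \<phi> t)) integrable_on {p..q}" "(\<lambda>t. c * (a t * \<phi> t)) integrable_on {p..q}"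
    by (intro integrable_continuous_real continuous_intros a cu \<phi>_cont)+
  ultimately have 1: "d * integral {p..q} (\<lambda>t. a t * u t * \<phi> t) \<le> c * I1"
    by (simp add: integral_diff I1_def)
  have "integral {p..q} (\<lambda>t. u s / (q - p)\<^sup>2 * (a t * ?e t * \<phi> t)) \<le> integral {p..q} (\<lambda>t. a t * u t * \<phi> t)"
  proof (rule integral_le)
    fix t assume t: "t \<in> {p..q}"
    have "u t \<ge> u s * ?e t / (q - p)\<^sup>2"
      by (rule concave_ge_parabola[OF u u' _ _ _ pq s t]) (use u0 conc pq in auto)
    then have "a t * \<phi> t * (u s * ?e t / (q - p)\<^sup>2) \<le> a t * \<phi> t * u t"
      using a0[OF t] \<phi>_nonneg[OF t] by (intro mult_left_mono) auto
    then show "u s / (q - p)\<^sup>2 * (a t * ?e t * \<phi> t) \<le> a t * u t * \<phi> t" by (simp add: mult_ac)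
  qed (use pq in \<open>auto intro!: integrable_continuous_real continuous_intros a cu \<phi>_cont\<close>)
  then have "u s / (q - p)\<^sup>2 * J \<le> integral {p..q} (\<lambda>t. a t * u t * \<phi> t)"
    by (simp only: integral_mult_right J_def)
  then have "d * (u s / (q - p)\<^sup>2 * J) \<le> c * I1" 
    using mult_left_mono[OF _ less_imp_le[OF d]] 1 by (meson order_trans)
  then show ?thesis using d J pq by (simp add: bound_def flip: I1_def J_def) (simp add: field_simps)
qed

text \<open>Tested with \<open>\<phi>\<close>, a source of strength \<open>N\<close> must be
  balanced by \<open>lam * u\<close>, which is at most \<open>lam * R\<close>. This is what rules
  out a multiplier at its upper cap.\<close>

lemma forcing_bound:
  assumes u: "\<And>t. t \<in> {p..q} \<Longrightarrow> (u has_real_derivative u' t) (at t within {p..q})"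
    and u': "\<And>t. t \<in> {p..q} \<Longrightarrow> (u' has_real_derivative u2 t) (at t within {p..q})"
    and u0: "\<And>t. t \<in> {p..q} \<Longrightarrow> 0 \<le> u t \<and> u t \<le> R"
    and le: "\<And>t. t \<in> {p..q} \<Longrightarrow> u2 t \<le> - a t * N"
  shows "N \<le> lam * R"
proof -
  have cu: "continuous_on {p..q} u" using u by (rule DERIV_continuous_on)
  have I1: "integral {p..q} (\<lambda>t. a t * 1 * \<phi> t) > 0" by (rule weight_pos) auto
  have "(N - lam * R) * integral {p..q} (\<lambda>t. a t * 1 * \<phi> t) = integral {p..q} (\<lambda>t. (N - lam * R) * (a t * 1 * \<phi> t))"
    by simp
  also have "\<dots> \<le> integral {p..q} (\<lambda>t. a t * (N - lam * u t) * \<phi> t)"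
  proof (rule integral_le)
    fix t assume t: "t \<in> {p..q}"
    have "N - lam * R \<le> N - lam * u t" using u0[OF t] lam by simp
    then have "(N - lam * R) * (a t * \<phi> t) \<le> (N - lam * u t) * (a t * \<phi> t)"
      using a0[OF t] \<phi>_nonneg[OF t] by (intro mult_right_mono) auto
    then show "(N - lam * R) * (a t * 1 * \<phi> t) \<le> a t * (N - lam * u t) * \<phi> t" by (simp add: mult_ac)
  qed (auto intro!: integrable_continuous_real continuous_intros a cu \<phi>_cont)
  also have "\<dots> \<le> 0"
    by (rule test_inequality[OF u u' _ _ _ le]) (use u0 pq in auto)
  finally show ?thesis using I1 by (simp add: mult_le_0_iff)
qed

end

section \<open>Multiplicity for the one-dimensional problem\<close>

lemma Sup_image_attained:
  fixes u :: "real \<Rightarrow> real"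
  assumes "s \<le> t" "continuous_on {s..t} u"
  obtains x where "x \<in> {s..t}" "u x = Sup (u ` {s..t})" "\<And>y. y \<in> {s..t} \<Longrightarrow> u y \<le> Sup (u ` {s..t})"
proof -
  obtain x where x: "x \<in> {s..t}" "\<forall>y\<in>{s..t}. u y \<le> u x"
    using continuous_attains_sup[of "{s..t}" u] assms by auto
  have "Sup (u ` {s..t}) = u x" using x by (intro cSup_eq_maximum) auto
  then show ?thesis using that[of x] x by simp
qed

text \<open>The ends \<open>lo\<close> and \<open>hi\<close> are parameters because the same
  configuration is used for the radii and for their images in \<open>[0, L]\<close>. The gaps are
  numbered from 0: gap \<open>j\<close> is \<open>[ta j, sg (j + 1)]\<close>, and only the gaps 0
  and \<open>m\<close> may shrink to a point.\<close>

locale interlaced =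
  fixes m :: nat and sg ta :: "nat \<Rightarrow> real" and lo hi :: real
  assumes pts: "ta 0 = lo" "sg (m + 1) = hi" "ta 0 \<le> sg 1" "ta m \<le> sg (m + 1)"
      "\<And>i. i \<in> {1..m} \<Longrightarrow> sg i < ta i" "\<And>i. i \<in> {1..<m} \<Longrightarrow> ta i < sg (i + 1)"
begin

lemma ta_le_sg: "j \<le> m \<Longrightarrow> ta j \<le> sg (j + 1)"
  using pts(3,4) pts(6)[of j] by (cases "j = 0"; cases "j = m") (auto simp: less_imp_le)

lemma ta_mono: "i \<le> j \<Longrightarrow> j \<le> m \<Longrightarrow> ta i \<le> ta j"
proof (induction j)
  case (Suc j)
  have "ta j \<le> ta (Suc j)" using ta_le_sg[of j] pts(5)[of "Suc j"] Suc.prems by simp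
  then show ?case using Suc by (cases "i = Suc j") auto
qed simp

lemma sg_mono:
  assumes "1 \<le> i" "i \<le> j" "j \<le> m + 1"
  shows "sg i \<le> sg j"
proof (cases "i = j")
  case False
  then obtain l where l: "j = l + 1" "i \<le> l" "l \<le> m" using assms by (cases j) auto
  have "sg i < ta i" using pts(5)[of i] assms l by simp
  also have "ta i \<le> ta l" using ta_mono l by simp
  also have "\<dots> \<le> sg j" using ta_le_sg l by simp
  finally show ?thesis by simp
qed simp

lemma in_range:
  shows "i \<in> {1..m} \<Longrightarrow> lo \<le> sg i" "i \<in> {1..m} \<Longrightarrow> ta i \<le> hi" "j \<le> m \<Longrightarrow> lo \<le> ta j" "j \<le> m \<Longrightarrow> sg (j + 1) \<le> hi"
  using ta_mono[of 0 j] sg_mono[of 1 i] sg_mono[of "j + 1" "m + 1"] ta_mono[of i m] pts by auto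

end

locale alternating_weights = interlaced m sg ta 0 L
  for m :: nat and sg ta :: "nat \<Rightarrow> real" and L :: real +
  fixes a b :: "nat \<Rightarrow> real \<Rightarrow> real"
  assumes L: "L > 0"
    and a_cont: "\<And>i. i \<in> {1..m} \<Longrightarrow> continuous_on {0..L} (a i)"
    and a_nonneg: "\<And>i t. \<lbrakk>i \<in> {1..m}; t \<in> {0..L}\<rbrakk> \<Longrightarrow> a i t \<ge> 0"
    and a_nontriv: "\<And>i. i \<in> {1..m} \<Longrightarrow> \<exists>t\<in>{sg i..ta i}. a i t \<noteq> 0"
    and a_supp: "\<And>i t. \<lbrakk>i \<in> {1..m}; t \<in> {0..L} - {sg i..ta i}\<rbrakk> \<Longrightarrow> a i t = 0"
    and b_cont: "\<And>j. j \<in> {0..m} \<Longrightarrow> continuous_on {0..L} (b j)"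
    and b_nonneg: "\<And>j t. \<lbrakk>j \<in> {0..m}; t \<in> {0..L}\<rbrakk> \<Longrightarrow> b j t \<ge> 0"
    and b_supp: "\<And>j t. \<lbrakk>j \<in> {0..m}; t \<in> {0..L} - {ta j..sg (j + 1)}\<rbrakk> \<Longrightarrow> b j t = 0"
    and b_left: "\<And>j \<epsilon>. \<lbrakk>j \<in> {0..m}; ta j < sg (j + 1); \<epsilon> > 0\<rbrakk>
        \<Longrightarrow> \<exists>t\<in>{ta j..min (ta j + \<epsilon>) (sg (j + 1))}. b j t \<noteq> 0"
    and b_right: "\<And>j \<epsilon>. \<lbrakk>j \<in> {0..m}; ta j < sg (j + 1); \<epsilon> > 0\<rbrakk>
        \<Longrightarrow> \<exists>t\<in>{max (sg (j + 1) - \<epsilon>) (ta j)..sg (j + 1)}. b j t \<noteq> 0"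
begin

lemma sub_a: "i \<in> {1..m} \<Longrightarrow> {sg i..ta i} \<subseteq> {0..L}"
  using in_range(1,2)[of i] by simp

lemma sub_b: "j \<le> m \<Longrightarrow> {ta j..sg (j + 1)} \<subseteq> {0..L}"
  using in_range(3,4)[of j] by simp

text \<open>Neighbouring supports share an end point, so disjointness yields vanishing only in the
  open interval; continuity extends it to the ends.\<close>

lemma vanish_closed:
  assumes "p < q" "{p..q} \<subseteq> {0..L}" "continuous_on {0..L} f"
    and "\<And>t. p < t \<Longrightarrow> t < q \<Longrightarrow> f t = 0" and "t \<in> {p..q}"
  shows "f t = (0 :: real)"
proof (rule ccontr)
  assume "f t \<noteq> 0"
  then obtain s where "p < s" "s < q" "f s \<noteq> 0"
    using nonzero_interior[OF assms(1) continuous_on_subset[OF assms(3,2)] assms(5)] by blast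
  then show False using assms(4) by blast
qed

lemma a_vanish_a:
  assumes "i \<in> {1..m}" "l \<in> {1..m}" "l \<noteq> i" "t \<in> {sg i..ta i}"
  shows "a l t = 0"
proof (rule a_supp)
  have "t \<notin> {sg l..ta l}"
  proof (cases "l < i")
    case True
    have "1 \<le> l" "i \<le> m" using assms by auto
    then have "i - 1 \<in> {1..<m}" "i - 1 + 1 = i" "l \<le> i - 1" using True by auto
    then have "ta l \<le> ta (i - 1)" "ta (i - 1) < sg i" using ta_mono[of l "i - 1"] pts(6)[of "i - 1"] by auto
    then show ?thesis using assms by auto
  next
    case False
    have "1 \<le> i" "l \<le> m" "i < l" using assms False by auto
    then have "l - 1 \<in> {1..<m}" "l - 1 + 1 = l" "i \<le> l - 1" by auto
    then have "ta i \<le> ta (l - 1)" "ta (l - 1) < sg l" using ta_mono[of i "l - 1"] pts(6)[of "l - 1"] by auto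
    then show ?thesis using assms by auto
  qed
  then show "t \<in> {0..L} - {sg l..ta l}" using assms sub_a by blast
qed (rule assms)

lemma b_vanish_a:
  assumes i: "i \<in> {1..m}" and j: "j \<in> {0..m}" and t: "t \<in> {sg i..ta i}"
  shows "b j t = 0"
proof (rule vanish_closed[OF pts(5)[OF i] sub_a[OF i] b_cont[OF j] _ t])
  fix s assume s: "sg i < s" "s < ta i"
  have "s \<notin> {ta j..sg (j + 1)}"
  proof (cases "i \<le> j")
    case True
    then show ?thesis using ta_mono[of i j] j s by auto
  next
    case False
    then show ?thesis using sg_mono[of "j + 1" i] i s by auto
  qed
  then show "b j s = 0" using sub_a[OF i] s by (intro b_supp[OF j]) auto
qed

lemma a_vanish_b:
  assumes j: "j \<in> {0..m}" "ta j < sg (j + 1)" and l: "l \<in> {1..m}" and t: "t \<in> {ta j..sg (j + 1)}"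
  shows "a l t = 0"
proof (rule vanish_closed[OF j(2) sub_b a_cont[OF l] _ t])
  fix s assume s: "ta j < s" "s < sg (j + 1)"
  have "s \<notin> {sg l..ta l}"
  proof (cases "l \<le> j")
    case True
    then show ?thesis using ta_mono[of l j] j s by auto
  next
    case False
    then show ?thesis using sg_mono[of "j + 1" l] l s by auto
  qed
  then show "a l s = 0" using sub_b[of j] j s by (intro a_supp[OF l]) auto
qed (use j in auto)

lemma b_vanish_b:
  assumes j: "j \<in> {0..m}" "ta j < sg (j + 1)" and l: "l \<in> {0..m}" "l \<noteq> j" and t: "t \<in> {ta j..sg (j + 1)}"
  shows "b l t = 0"
proof (rule vanish_closed[OF j(2) sub_b b_cont[OF l(1)] _ t])
  fix s assume s: "ta j < s" "s < sg (j + 1)"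
  have "s \<notin> {ta l..sg (l + 1)}"
  proof (cases "l < j")
    case True
    then show ?thesis using sg_mono[of "l + 1" j] pts(5)[of j] j s by auto
  next
    case False
    then show ?thesis using ta_mono[of "j + 1" l] pts(5)[of "j + 1"] l s by auto
  qed
  then show "b l s = 0" using sub_b[of j] j s by (intro b_supp[OF l(1)]) auto
qed (use j in auto)

end

text \<open>The points \<open>sg i\<close> and \<open>ta i\<close> are the images of \<open>\<sigma>\<^sub>i\<close> and \<open>\<tau>\<^sub>i\<close> under the change of variables;
  \<open>y\<close> lies between all \<open>\<alpha>\<^sub>i g\<^sub>0\<^sup>i\<close> and \<open>\<lambda>\<^sub>0\<close>, and \<open>r\<close> is the threshold separating small from large.\<close>

locale indefinite_problem = alternating_weights +
  fixes \<alpha> :: "nat \<Rightarrow> real" and g k :: "nat \<Rightarrow> real \<Rightarrow> real" and y r :: real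
  assumes m: "m \<ge> 1" and \<alpha>: "\<And>i. i \<in> {1..m} \<Longrightarrow> \<alpha> i > 0"
    and g_cont: "\<And>i. i \<in> {1..m} \<Longrightarrow> continuous_on {0..} (g i)"
    and g_zero: "\<And>i. i \<in> {1..m} \<Longrightarrow> g i 0 = 0"
    and g_nonneg: "\<And>i s. \<lbrakk>i \<in> {1..m}; s \<ge> 0\<rbrakk> \<Longrightarrow> g i s \<ge> 0"
    and k_cont: "\<And>j. j \<in> {0..m} \<Longrightarrow> continuous_on {0..} (k j)"
    and k_zero: "\<And>j. j \<in> {0..m} \<Longrightarrow> k j 0 = 0"
    and k_pos: "\<And>j s. \<lbrakk>j \<in> {0..m}; s > 0\<rbrakk> \<Longrightarrow> k j s > 0"
    and k_lin: "\<And>j C. j \<in> {0..m} \<Longrightarrow> \<exists>K\<ge>0. \<forall>s\<in>{0..C}. k j s \<le> K * s"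
    and r: "r > 0" and y: "y < first_dirichlet_eigenvalue (\<lambda>t. \<Sum>i=1..m. a i t) 0 L"
    and g_small: "\<And>i s. \<lbrakk>i \<in> {1..m}; s \<in> {0..r}\<rbrakk> \<Longrightarrow> \<alpha> i * g i s \<le> y * s"
    and g_large: "\<And>i. i \<in> {1..m} \<Longrightarrow> \<exists>d>0. \<exists>c. \<forall>s\<ge>0.
        (first_dirichlet_eigenvalue (a i) (sg i) (ta i) + d) * s - c \<le> \<alpha> i * g i s"
begin

lemma k_nonneg: "\<lbrakk>j \<in> {0..m}; s \<ge> 0\<rbrakk> \<Longrightarrow> k j s \<ge> 0"
  using k_pos[of j s] k_zero[of j] by (cases "s = 0") auto

lemma y_nonneg: "y \<ge> 0"
proof -
  have "0 \<le> \<alpha> 1 * g 1 r" using \<alpha>[of 1] g_nonneg[of 1 r] m r by simp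
  then have "0 \<le> y * r" using g_small[of 1 r] m r by simp
  then show ?thesis using r by (simp add: zero_le_mult_iff)
qed

text \<open>Hides the eigenfunction of one interval behind two constants, so that these can be
  chosen for all \<open>i\<close> at once: \<open>R0\<close> comes from the growth of
  \<open>g i\<close> at infinity, and \<open>\<Lambda>\<close> is the first eigenvalue of the
  interval.\<close>

lemma interval_bounds:
  assumes i: "i \<in> {1..m}"
  shows "\<exists>R0 \<Lambda>. \<Lambda> \<ge> 0 \<and>
    (\<forall>u u' u2 s. (\<forall>t\<in>{sg i..ta i}. (u has_real_derivative u' t) (at t within {sg i..ta i}) \<and>
        (u' has_real_derivative u2 t) (at t within {sg i..ta i}) \<and> u t \<ge> 0 \<and>
        u2 t \<le> - a i t * (\<alpha> i * g i (u t))) \<longrightarrow> s \<in> {sg i..ta i} \<longrightarrow> u s \<le> R0) \<and>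
    (\<forall>u u' u2 R N. (\<forall>t\<in>{sg i..ta i}. (u has_real_derivative u' t) (at t within {sg i..ta i}) \<and>
        (u' has_real_derivative u2 t) (at t within {sg i..ta i}) \<and> 0 \<le> u t \<and> u t \<le> R \<and>
        u2 t \<le> - a i t * N) \<longrightarrow> N \<le> \<Lambda> * R)"
proof -
  have sub: "{sg i..ta i} \<subseteq> {0..L}" using sub_a[OF i] .
  have ca: "continuous_on {sg i..ta i} (a i)" using a_cont[OF i] sub by (rule continuous_on_subset)
  have a0: "a i t \<ge> 0" if "t \<in> {sg i..ta i}" for t using a_nonneg[OF i] sub that by blast
  obtain s0 where s0: "s0 \<in> {sg i..ta i}" "a i s0 \<noteq> 0" using a_nontriv[OF i] by blast
  obtain lam \<phi> \<phi>' where lam_eq: "lam = first_dirichlet_eigenvalue (a i) (sg i) (ta i)" and lam_pos: "lam > 0"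
    and \<phi>: "\<And>t. t \<in> {sg i..ta i} \<Longrightarrow> (\<phi> has_real_derivative \<phi>' t) (at t within {sg i..ta i})"
      "\<And>t. t \<in> {sg i..ta i} \<Longrightarrow> (\<phi>' has_real_derivative - lam * a i t * \<phi> t) (at t within {sg i..ta i})"
      "\<phi> (sg i) = 0" "\<phi> (ta i) = 0" "\<And>t. sg i < t \<Longrightarrow> t < ta i \<Longrightarrow> \<phi> t > 0"
    by (rule principal_eigenvalue[OF pts(5)[OF i] ca a0 s0]) (assumption, rule that)
  interpret principal_eigenfunction "sg i" "ta i" "a i" \<phi> \<phi>' lam
    by unfold_locales (use pts(5)[OF i] ca a0 s0 lam_pos \<phi> in auto)
  obtain d c where d: "d > 0" and large: "\<And>s. s \<ge> 0 \<Longrightarrow> (lam + d) * s - c \<le> \<alpha> i * g i s"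
    using g_large[OF i, folded lam_eq] by blast
  show ?thesis
  proof (rule exI[of _ "bound d c"], rule exI[of _ lam], intro conjI allI impI)
    fix u u' u2 s
    assume *: "\<forall>t\<in>{sg i..ta i}. (u has_real_derivative u' t) (at t within {sg i..ta i}) \<and>
        (u' has_real_derivative u2 t) (at t within {sg i..ta i}) \<and> u t \<ge> 0 \<and>
        u2 t \<le> - a i t * (\<alpha> i * g i (u t))" and s: "s \<in> {sg i..ta i}"
    show "u s \<le> bound d c"
    proof (rule superlinear_bound[OF d _ _ _ _ _ s])
      fix t assume t: "t \<in> {sg i..ta i}"
      have ut: "u t \<ge> 0" and u2: "u2 t \<le> - a i t * (\<alpha> i * g i (u t))" using * t by auto
      have "0 \<le> a i t * (\<alpha> i * g i (u t))" using a0[OF t] \<alpha>[OF i] g_nonneg[OF i ut] by simp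
      then show "u2 t \<le> 0" using u2 by simp
      have "a i t * ((lam + d) * u t - c) \<le> a i t * (\<alpha> i * g i (u t))"
        using a0[OF t] large[OF ut] by (intro mult_left_mono)
      then show "u2 t \<le> - a i t * ((lam + d) * u t - c)" using u2 by simp
    qed (use * in auto)
  next
    fix u u' u2 R N
    assume *: "\<forall>t\<in>{sg i..ta i}. (u has_real_derivative u' t) (at t within {sg i..ta i}) \<and>
        (u' has_real_derivative u2 t) (at t within {sg i..ta i}) \<and> 0 \<le> u t \<and> u t \<le> R \<and>
        u2 t \<le> - a i t * N"
    show "N \<le> lam * R" by (rule forcing_bound[of u u' u2]) (use * in auto)
  qed (use lam_pos in auto)
qed

end

lemma bounded_on_Icc:
  fixes f :: "real \<Rightarrow> real"
  assumes "continuous_on {p..q} f"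
  obtains B where "B > 0" "\<And>t. t \<in> {p..q} \<Longrightarrow> \<bar>f t\<bar> \<le> B"
proof -
  have "bounded (f ` {p..q})" using assms by (intro compact_imp_bounded compact_continuous_image compact_Icc)
  then show ?thesis using that by (auto simp: bounded_pos)
qed

context indefinite_problem
begin

abbreviation source :: "(nat \<Rightarrow> real) \<Rightarrow> real \<Rightarrow> real \<Rightarrow> real" where
  "source \<beta> t s \<equiv> (\<Sum>i=1..m. \<alpha> i * a i t * g i s) - (\<Sum>j=0..m. \<beta> j * b j t * k j s)"

text \<open>The truncation bounds the source from above independently of \<open>\<beta>\<close>; the level \<open>c i\<close> will be \<open>R\<close> on the
  intervals where the solution is large and \<open>r\<close> on the others.\<close>

definition truncated :: "(nat \<Rightarrow> real) \<Rightarrow> (nat \<Rightarrow> real) \<Rightarrow> real \<Rightarrow> real \<Rightarrow> real" where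
  "truncated c \<beta> t s = (\<Sum>i=1..m. \<alpha> i * a i t * g i (min s (c i))) - (\<Sum>j=0..m. \<beta> j * b j t * k j s)"

lemma truncated_cont:
  assumes c: "\<And>i. i \<in> {1..m} \<Longrightarrow> c i \<ge> 0"
  shows "continuous_on ({0..L} \<times> {0..}) (\<lambda>z. truncated c \<beta> (fst z) (snd z))"
proof -
  have fst: "continuous_on ({0..L} \<times> {0..}) (\<lambda>z. f (fst z))" if "continuous_on {0..L} f" for f :: "real \<Rightarrow> real"
    by (rule continuous_on_compose2[OF that]) (auto intro!: continuous_intros)
  have g: "continuous_on ({0..L} \<times> {0..}) (\<lambda>z. g i (min (snd z) (c i)))" if "i \<in> {1..m}" for i
    by (rule continuous_on_compose2[OF g_cont[OF that]]) (use c[OF that] in \<open>auto intro!: continuous_intros\<close>)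
  have k: "continuous_on ({0..L} \<times> {0..}) (\<lambda>z. k j (snd z))" if "j \<in> {0..m}" for j
    by (rule continuous_on_compose2[OF k_cont[OF that]]) (auto intro!: continuous_intros)
  show ?thesis unfolding truncated_def
    by (intro continuous_intros fst a_cont b_cont g k) auto
qed

text \<open>\<open>ta i\<close> is the left end of gap \<open>i\<close>, and \<open>sg i\<close> is
  the right end of gap \<open>i - 1\<close>. A nondegenerate gap falls under one of the two end
  estimates; a degenerate one lies at 0 or \<open>L\<close>, where \<open>u\<close> vanishes.
  Summing the thresholds of all gaps and both ends gives a number that dominates each of
  them.\<close>

lemma boundary_values_small:
  fixes C D \<eta> :: real
  assumes D: "D > 0" and \<eta>: "\<eta> > 0"
  obtains \<beta>star where "\<beta>star > 0"
    "\<And>\<beta> u u' u2 i. \<lbrakk>\<And>j. j \<in> {0..m} \<Longrightarrow> \<beta> j > \<beta>star;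
      \<And>t. t \<in> {0..L} \<Longrightarrow> (u has_real_derivative u' t) (at t within {0..L});
      \<And>t. t \<in> {0..L} \<Longrightarrow> (u' has_real_derivative u2 t) (at t within {0..L});
      \<And>j t. \<lbrakk>j \<in> {0..m}; ta j < sg (j + 1); t \<in> {ta j..sg (j + 1)}\<rbrakk> \<Longrightarrow> u2 t = \<beta> j * b j t * k j (u t);
      u 0 = 0; u L = 0; \<And>t. t \<in> {0..L} \<Longrightarrow> 0 \<le> u t \<and> u t \<le> C;
      \<And>i. i \<in> {1..m} \<Longrightarrow> - D \<le> u' (ta i) \<and> u' (sg i) \<le> D; i \<in> {1..m}\<rbrakk>
      \<Longrightarrow> u (sg i) < \<eta> \<and> u (ta i) < \<eta>"
proof -
  define left where "left = (\<lambda>j \<beta>0. \<forall>\<beta> u u'. \<beta> > \<beta>0 \<longrightarrow>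
      (\<forall>t\<in>{ta j..sg (j + 1)}. (u has_real_derivative u' t) (at t within {ta j..sg (j + 1)}) \<and>
        (u' has_real_derivative \<beta> * b j t * k j (u t)) (at t within {ta j..sg (j + 1)}) \<and>
        0 \<le> u t \<and> u t \<le> C) \<longrightarrow> - D \<le> u' (ta j) \<longrightarrow> u (ta j) < \<eta>)"
  define right where "right = (\<lambda>j \<beta>0. \<forall>\<beta> u u'. \<beta> > \<beta>0 \<longrightarrow>
      (\<forall>t\<in>{ta j..sg (j + 1)}. (u has_real_derivative u' t) (at t within {ta j..sg (j + 1)}) \<and>
        (u' has_real_derivative \<beta> * b j t * k j (u t)) (at t within {ta j..sg (j + 1)}) \<and>
        0 \<le> u t \<and> u t \<le> C) \<longrightarrow> u' (sg (j + 1)) \<le> D \<longrightarrow> u (sg (j + 1)) < \<eta>)"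
  have bc: "continuous_on {ta j..sg (j + 1)} (b j)" "\<And>t. t \<in> {ta j..sg (j + 1)} \<Longrightarrow> b j t \<ge> 0"
    if "j \<in> {0..m}" for j
    using continuous_on_subset[OF b_cont[OF that] sub_b] b_nonneg[OF that] sub_b[of j] that by auto
  have "\<forall>j\<in>{0..m}. \<exists>\<beta>0. \<beta>0 > 0 \<and> (ta j < sg (j + 1) \<longrightarrow> left j \<beta>0)"
  proof
    fix j assume j: "j \<in> {0..m}"
    show "\<exists>\<beta>0. \<beta>0 > 0 \<and> (ta j < sg (j + 1) \<longrightarrow> left j \<beta>0)"
    proof (cases "ta j < sg (j + 1)")
      case True
      show ?thesis
        by (rule small_at_left_end[where C = C, OF True bc[OF j] b_left[OF j True] k_cont[OF j]
              k_nonneg[OF j] k_pos[OF j] D \<eta>])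
          (assumption+, unfold left_def, blast)
    qed (use zero_less_one in blast)
  qed
  then obtain \<beta>l where \<beta>l: "\<And>j. j \<in> {0..m} \<Longrightarrow> \<beta>l j > 0"
    "\<And>j. j \<in> {0..m} \<Longrightarrow> ta j < sg (j + 1) \<Longrightarrow> left j (\<beta>l j)" by metis
  have "\<forall>j\<in>{0..m}. \<exists>\<beta>0. \<beta>0 > 0 \<and> (ta j < sg (j + 1) \<longrightarrow> right j \<beta>0)"
  proof
    fix j assume j: "j \<in> {0..m}"
    show "\<exists>\<beta>0. \<beta>0 > 0 \<and> (ta j < sg (j + 1) \<longrightarrow> right j \<beta>0)"
    proof (cases "ta j < sg (j + 1)")
      case True
      show ?thesis
        by (rule small_at_right_end[where C = C, OF True bc[OF j] b_right[OF j True] k_cont[OF j]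
              k_nonneg[OF j] k_pos[OF j] D \<eta>])
          (assumption+, unfold right_def, blast)
    qed (use zero_less_one in blast)
  qed
  then obtain \<beta>r where \<beta>r: "\<And>j. j \<in> {0..m} \<Longrightarrow> \<beta>r j > 0"
    "\<And>j. j \<in> {0..m} \<Longrightarrow> ta j < sg (j + 1) \<Longrightarrow> right j (\<beta>r j)" by metis
  define \<beta>star where "\<beta>star = (\<Sum>j=0..m. \<beta>l j + \<beta>r j)"
  have \<beta>star: "\<beta>l j \<le> \<beta>star \<and> \<beta>r j \<le> \<beta>star" if j: "j \<in> {0..m}" for j
  proof -
    have "\<beta>l j + \<beta>r j \<le> \<beta>star" unfolding \<beta>star_def
      by (rule member_le_sum[OF j]) (use \<beta>l(1) \<beta>r(1) in \<open>auto intro!: less_imp_le add_pos_pos\<close>)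
    then show ?thesis using \<beta>l(1)[OF j] \<beta>r(1)[OF j] by linarith
  qed
  show ?thesis
  proof (rule that[of \<beta>star])
    show "\<beta>star > 0" using \<beta>star[of 0] \<beta>l(1)[of 0] by simp
    fix \<beta> and u u' u2 :: "real \<Rightarrow> real" and i
    assume \<beta>: "\<And>j. j \<in> {0..m} \<Longrightarrow> \<beta> j > \<beta>star"
      and u: "\<And>t. t \<in> {0..L} \<Longrightarrow> (u has_real_derivative u' t) (at t within {0..L})"
      and u': "\<And>t. t \<in> {0..L} \<Longrightarrow> (u' has_real_derivative u2 t) (at t within {0..L})"
      and u2: "\<And>j t. \<lbrakk>j \<in> {0..m}; ta j < sg (j + 1); t \<in> {ta j..sg (j + 1)}\<rbrakk> \<Longrightarrow> u2 t = \<beta> j * b j t * k j (u t)"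
      and ends: "u 0 = 0" "u L = 0" and ubd: "\<And>t. t \<in> {0..L} \<Longrightarrow> 0 \<le> u t \<and> u t \<le> C"
      and uD: "\<And>i. i \<in> {1..m} \<Longrightarrow> - D \<le> u' (ta i) \<and> u' (sg i) \<le> D" and i: "i \<in> {1..m}"
    have loc: "(u has_real_derivative u' t) (at t within {ta j..sg (j + 1)}) \<and>
        (u' has_real_derivative \<beta> j * b j t * k j (u t)) (at t within {ta j..sg (j + 1)}) \<and>
        0 \<le> u t \<and> u t \<le> C" if j: "j \<in> {0..m}" "ta j < sg (j + 1)" and t: "t \<in> {ta j..sg (j + 1)}" for j t
    proof -
      have sub: "{ta j..sg (j + 1)} \<subseteq> {0..L}" using sub_b j by simp
      then have tL: "t \<in> {0..L}" using t by blast
      show ?thesis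
        using DERIV_subset[OF u[OF tL] sub] DERIV_subset[OF u'[OF tL] sub, unfolded u2[OF j t]] ubd[OF tL] by blast
    qed
    have "u (ta i) < \<eta>"
    proof (cases "ta i < sg (i + 1)")
      case True
      have j: "i \<in> {0..m}" using i by simp
      have "\<beta> i > \<beta>l i" using \<beta>[OF j] \<beta>star[OF j] by linarith
      then show ?thesis using \<beta>l(2)[OF j True] loc[OF j True] uD[OF i] unfolding left_def by blast
    next
      case False
      then have "i = m" "ta i = L" using pts(2,4) pts(6)[of i] i by force+
      then show ?thesis using ends \<eta> by simp
    qed
    moreover have "u (sg i) < \<eta>"
    proof -
      define j where "j = i - 1"
      have j: "j \<in> {0..m}" and ij: "i = j + 1" using i by (auto simp: j_def)
      show ?thesis
      proof (cases "ta j < sg (j + 1)")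
        case True
        have "\<beta> j > \<beta>r j" using \<beta>[OF j] \<beta>star[OF j] by linarith
        then show ?thesis using \<beta>r(2)[OF j True] loc[OF j True] uD[OF i] unfolding right_def ij by blast
      next
        case False
        then have "j = 0" using pts(6)[of j] i ij by force
        then have "sg i = 0" using False pts(1,3) ij by simp
        then show ?thesis using ends \<eta> by simp
      qed
    qed
    ultimately show "u (sg i) < \<eta> \<and> u (ta i) < \<eta>" by simp
  qed
qed

end

lemma sum_single:
  fixes f :: "'a \<Rightarrow> real"
  assumes "finite A" "i \<in> A" "\<And>l. l \<in> A \<Longrightarrow> l \<noteq> i \<Longrightarrow> f l = 0"
  shows "sum f A = f i"
  using assms by (simp add: sum.remove sum.neutral)

context indefinite_problem
begin

text \<open>As \<open>y\<close> is below the first eigenvalue of the total weight, some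
  \<open>\<psi>\<close> positive on all of \<open>[0, L]\<close> solves the linear equation with a
  rate \<open>\<kappa> \<ge> y\<close>. On interval \<open>i\<close> the total weight is
  \<open>a i\<close>, so \<open>\<eta> / p0\<close> times \<open>\<psi>\<close> is a supersolution
  there and at least \<open>\<eta>\<close> at both ends. \<open>p0\<close> and \<open>p1\<close> are
  the minimum and the maximum of \<open>\<psi>\<close>, the same for all \<open>i\<close>.\<close>

lemma supersolution:
  obtains p0 p1 where "0 < p0" "p0 \<le> p1"
    "\<And>i u u' u2 \<eta> t. \<lbrakk>i \<in> {1..m}; \<eta> \<ge> 0;
      \<And>t. t \<in> {sg i..ta i} \<Longrightarrow> (u has_real_derivative u' t) (at t within {sg i..ta i});
      \<And>t. t \<in> {sg i..ta i} \<Longrightarrow> (u' has_real_derivative u2 t) (at t within {sg i..ta i});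
      \<And>t. t \<in> {sg i..ta i} \<Longrightarrow> u t \<ge> 0; u (sg i) \<le> \<eta>; u (ta i) \<le> \<eta>;
      \<And>t. t \<in> {sg i..ta i} \<Longrightarrow> u2 t \<ge> - a i t * (y * u t); t \<in> {sg i..ta i}\<rbrakk> \<Longrightarrow> u t \<le> \<eta> / p0 * p1"
proof -
  let ?A = "\<lambda>t. \<Sum>i=1..m. a i t"
  have cA: "continuous_on {0..L} ?A" by (intro continuous_intros a_cont)
  have A0: "?A t \<ge> 0" if "t \<in> {0..L}" for t using a_nonneg that by (intro sum_nonneg) auto
  obtain s where s: "s \<in> {sg 1..ta 1}" "a 1 s \<noteq> 0" using a_nontriv[of 1] m by auto
  have s0: "s \<in> {0..L}" using sub_a[of 1] s m by auto
  have "?A s = a 1 s" by (rule sum_single) (use a_vanish_a[of 1 _ s] s m in auto)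
  then have As: "?A s \<noteq> 0" using s by simp
  obtain \<kappa> \<psi> \<psi>' where \<kappa>: "y \<le> \<kappa>" and \<psi>0: "\<And>t. t \<in> {0..L} \<Longrightarrow> \<psi> t > 0"
    and \<psi>: "\<And>t. t \<in> {0..L} \<Longrightarrow> (\<psi> has_real_derivative \<psi>' t) (at t within {0..L})"
    and \<psi>': "\<And>t. t \<in> {0..L} \<Longrightarrow> (\<psi>' has_real_derivative - \<kappa> * ?A t * \<psi> t) (at t within {0..L})"
  proof (rule principal_eigenvalue[OF L cA A0 s0 As])
    fix lam
    assume "lam = first_dirichlet_eigenvalue ?A 0 L" and "\<And>y. y < lam \<Longrightarrow> \<exists>\<kappa> \<psi> \<psi>'. y \<le> \<kappa> \<and> (\<forall>t\<in>{0..L}. \<psi> t > 0 \<and>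
        (\<psi> has_real_derivative \<psi>' t) (at t within {0..L}) \<and>
        (\<psi>' has_real_derivative - \<kappa> * ?A t * \<psi> t) (at t within {0..L}))"
    then have "\<exists>\<kappa> \<psi> \<psi>'. y \<le> \<kappa> \<and> (\<forall>t\<in>{0..L}. \<psi> t > 0 \<and>
        (\<psi> has_real_derivative \<psi>' t) (at t within {0..L}) \<and>
        (\<psi>' has_real_derivative - \<kappa> * ?A t * \<psi> t) (at t within {0..L}))" using y by blast
    then show thesis using that by blast
  qed
  have c\<psi>: "continuous_on {0..L} \<psi>" using \<psi> by (rule DERIV_continuous_on)
  obtain x0 where x0: "x0 \<in> {0..L}" "\<And>t. t \<in> {0..L} \<Longrightarrow> \<psi> x0 \<le> \<psi> t"
    using continuous_attains_inf[OF compact_Icc _ c\<psi>] L by auto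
  obtain x1 where x1: "x1 \<in> {0..L}" "\<And>t. t \<in> {0..L} \<Longrightarrow> \<psi> t \<le> \<psi> x1"
    using continuous_attains_sup[OF compact_Icc _ c\<psi>] L by auto
  show ?thesis
  proof (rule that[of "\<psi> x0" "\<psi> x1"])
    fix i and u u' u2 :: "real \<Rightarrow> real" and \<eta> t
    assume i: "i \<in> {1..m}" and \<eta>: "\<eta> \<ge> 0"
      and u: "\<And>t. t \<in> {sg i..ta i} \<Longrightarrow> (u has_real_derivative u' t) (at t within {sg i..ta i})"
      and u': "\<And>t. t \<in> {sg i..ta i} \<Longrightarrow> (u' has_real_derivative u2 t) (at t within {sg i..ta i})"
      and u0: "\<And>t. t \<in> {sg i..ta i} \<Longrightarrow> u t \<ge> 0" and ends: "u (sg i) \<le> \<eta>" "u (ta i) \<le> \<eta>"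
      and u2: "\<And>t. t \<in> {sg i..ta i} \<Longrightarrow> u2 t \<ge> - a i t * (y * u t)" and t: "t \<in> {sg i..ta i}"
    have sub: "{sg i..ta i} \<subseteq> {0..L}" using sub_a[OF i] .
    define c where "c = \<eta> / \<psi> x0"
    have c: "c \<ge> 0" using \<eta> \<psi>0[OF x0(1)] by (simp add: c_def)
    have \<eta>_le: "\<eta> \<le> c * \<psi> s" if "s \<in> {sg i..ta i}" for s
    proof -
      have "c * \<psi> x0 \<le> c * \<psi> s" using x0(2)[of s] that sub c by (intro mult_left_mono) auto
      then show ?thesis using \<psi>0[OF x0(1)] by (simp add: c_def)
    qed
    have "u t \<le> c * \<psi> t"
    proof (rule maximum_principle[OF u u' _ _ _ _ _ _ t])
      fix s assume s: "s \<in> {sg i..ta i}"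
      then have sL: "s \<in> {0..L}" using sub by blast
      show "(\<psi> has_real_derivative \<psi>' s) (at s within {sg i..ta i})"
        using \<psi>[OF sL] sub by (rule DERIV_subset)
      show "(\<psi>' has_real_derivative - \<kappa> * ?A s * \<psi> s) (at s within {sg i..ta i})"
        using \<psi>'[OF sL] sub by (rule DERIV_subset)
      show "\<psi> s > 0" using \<psi>0[OF sL] .
    next
      fix s assume "sg i < s" "s < ta i"
      then have s: "s \<in> {sg i..ta i}" by simp
      then have sL: "s \<in> {0..L}" using sub by blast
      have As: "?A s = a i s" by (rule sum_single) (use a_vanish_a[OF i _ _ s] i in auto)
      have nn: "a i s * (u s * \<psi> s) \<ge> 0"
        using a_nonneg[OF i sL] u0[OF s] \<psi>0[OF sL] by simp
      have "- \<kappa> * (a i s * (u s * \<psi> s)) \<le> - y * (a i s * (u s * \<psi> s))"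
        using \<kappa> nn by (intro mult_right_mono) auto
      also have "\<dots> = - a i s * (y * u s) * \<psi> s" by simp
      also have "\<dots> \<le> u2 s * \<psi> s" using u2[OF s] \<psi>0[OF sL] by (intro mult_right_mono) auto
      finally show "u s * (- \<kappa> * ?A s * \<psi> s) \<le> u2 s * \<psi> s" unfolding As by (simp add: mult_ac)
    qed (use ends \<eta>_le[of "sg i"] \<eta>_le[of "ta i"] pts(5)[OF i] in auto)
    also have "\<dots> \<le> c * \<psi> x1" using x1(2)[of t] t sub c by (intro mult_left_mono) auto
    finally show "u t \<le> \<eta> / \<psi> x0 * \<psi> x1" by (simp add: c_def)
  qed (use \<psi>0[OF x0(1)] x0 x1 in auto)
qed

text \<open>All constants are fixed before \<beta> and \<open>J\<close> appear, so one threshold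
  serves every \<open>J\<close>. The final clause identifies \<open>J\<close> from the solution, and
  this is what makes different sets give different solutions.\<close>

theorem multiplicity:
  obtains \<beta>star where "\<beta>star > 0"
    "\<And>\<beta> J. \<lbrakk>\<And>j. j \<in> {0..m} \<Longrightarrow> \<beta> j > \<beta>star; J \<subseteq> {1..m}; J \<noteq> {}\<rbrakk> \<Longrightarrow> \<exists>u u'.
      (\<forall>t\<in>{0..L}. (u has_real_derivative u' t) (at t within {0..L}) \<and>
        (u' has_real_derivative - source \<beta> t (u t)) (at t within {0..L})) \<and>
      u 0 = 0 \<and> u L = 0 \<and> (\<forall>t\<in>{0..L}. u t \<ge> 0) \<and> (\<forall>t. 0 < t \<longrightarrow> t < L \<longrightarrow> u t > 0) \<and>
      (\<forall>i\<in>{1..m}. (i \<in> J \<longrightarrow> (\<exists>t\<in>{sg i..ta i}. r \<le> u t)) \<and> (i \<notin> J \<longrightarrow> (\<forall>t\<in>{sg i..ta i}. u t < r)))"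
proof -
  define P where "P = (\<lambda>i R0. \<forall>u u' u2 s. (\<forall>t\<in>{sg i..ta i}.
      (u has_real_derivative u' t) (at t within {sg i..ta i}) \<and>
      (u' has_real_derivative u2 t) (at t within {sg i..ta i}) \<and> u t \<ge> 0 \<and>
      u2 t \<le> - a i t * (\<alpha> i * g i (u t))) \<longrightarrow> s \<in> {sg i..ta i} \<longrightarrow> u s \<le> R0)"
  define Q where "Q = (\<lambda>i \<Lambda>. \<forall>u u' u2 R N. (\<forall>t\<in>{sg i..ta i}.
      (u has_real_derivative u' t) (at t within {sg i..ta i}) \<and>
      (u' has_real_derivative u2 t) (at t within {sg i..ta i}) \<and> 0 \<le> u t \<and> u t \<le> R \<and>
      u2 t \<le> - a i t * N) \<longrightarrow> N \<le> \<Lambda> * R)"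
  have "\<forall>i\<in>{1..m}. \<exists>R0 \<Lambda>. \<Lambda> \<ge> 0 \<and> P i R0 \<and> Q i \<Lambda>"
    unfolding P_def Q_def using interval_bounds by blast
  then obtain R0 \<Lambda> where *: "\<And>i. i \<in> {1..m} \<Longrightarrow> \<Lambda> i \<ge> 0 \<and> P i (R0 i) \<and> Q i (\<Lambda> i)" by metis
  have \<Lambda>0: "\<Lambda> i \<ge> 0" if "i \<in> {1..m}" for i using *[OF that] by blast
  have R0: "u s \<le> R0 i" if "i \<in> {1..m}" "\<forall>t\<in>{sg i..ta i}. (u has_real_derivative u' t) (at t within {sg i..ta i}) \<and>
        (u' has_real_derivative u2 t) (at t within {sg i..ta i}) \<and> u t \<ge> 0 \<and>
        u2 t \<le> - a i t * (\<alpha> i * g i (u t))" "s \<in> {sg i..ta i}" for i u u' u2 s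
    using *[OF that(1)] that(2,3) unfolding P_def by blast
  have \<Lambda>: "N \<le> \<Lambda> i * R" if "i \<in> {1..m}" "\<forall>t\<in>{sg i..ta i}. (u has_real_derivative u' t) (at t within {sg i..ta i}) \<and>
        (u' has_real_derivative u2 t) (at t within {sg i..ta i}) \<and> 0 \<le> u t \<and> u t \<le> R \<and>
        u2 t \<le> - a i t * N" for i u u' u2 R N
    using *[OF that(1)] that(2) unfolding Q_def by blast
  \<comment> \<open>Larger than every a priori bound \<open>R0 i\<close>, so that a maximum equal to
    \<open>R\<close> is contradictory.\<close>
  define R where "R = r + 1 + (\<Sum>i=1..m. \<bar>R0 i\<bar>)"
  have R: "R > r" "\<And>i. i \<in> {1..m} \<Longrightarrow> R > R0 i"
  proof -
    have "0 \<le> (\<Sum>i=1..m. \<bar>R0 i\<bar>)" by (intro sum_nonneg) auto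
    then show "R > r" unfolding R_def by linarith
    fix i assume i: "i \<in> {1..m}"
    have "\<bar>R0 i\<bar> \<le> (\<Sum>i=1..m. \<bar>R0 i\<bar>)" by (rule member_le_sum[OF i]) auto
    then show "R > R0 i" using r unfolding R_def by linarith
  qed
  have "\<forall>i\<in>{1..m}. \<exists>B. B > 0 \<and> (\<forall>s\<in>{0..R}. \<alpha> i * g i s \<le> B)"
  proof
    fix i assume i: "i \<in> {1..m}"
    have "continuous_on {0..R} (\<lambda>s. \<alpha> i * g i s)"
      by (intro continuous_intros continuous_on_subset[OF g_cont[OF i]]) auto
    then obtain B where "B > 0" "\<And>s. s \<in> {0..R} \<Longrightarrow> \<bar>\<alpha> i * g i s\<bar> \<le> B" by (rule bounded_on_Icc) blast
    then show "\<exists>B. B > 0 \<and> (\<forall>s\<in>{0..R}. \<alpha> i * g i s \<le> B)" by (meson abs_le_D1)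
  qed
  then obtain G where G: "\<And>i. i \<in> {1..m} \<Longrightarrow> G i > 0" "\<And>i s. i \<in> {1..m} \<Longrightarrow> s \<in> {0..R} \<Longrightarrow> \<alpha> i * g i s \<le> G i"
    by metis
  \<comment> \<open>The cap must beat \<open>\<Lambda> i * R\<close>, which excludes
    \<open>\<mu> i = N\<close>. It must also beat \<open>y\<close>, for values up to
    \<open>r\<close>, and \<open>G i / r\<close>, for values above, so that at
    \<open>\<mu> i = - N\<close> the absorption outweighs the source for every
    \<open>u \<ge> 0\<close>.\<close>
  define N where "N = y + 1 + (\<Sum>i=1..m. \<Lambda> i * R + G i / r)"
  have R_pos: "R > 0" using R r by simp
  have N: "N > 0" "\<And>i. i \<in> {1..m} \<Longrightarrow> N > \<Lambda> i * R" "\<And>i. i \<in> {1..m} \<Longrightarrow> N \<ge> G i / r" "N \<ge> y"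
  proof -
    have nn: "0 \<le> \<Lambda> i * R + G i / r" "0 \<le> \<Lambda> i * R" "0 \<le> G i / r" if "i \<in> {1..m}" for i
      using \<Lambda>0[OF that] G(1)[OF that] R_pos r by auto
    have le: "\<Lambda> i * R + G i / r \<le> (\<Sum>i=1..m. \<Lambda> i * R + G i / r)" if i: "i \<in> {1..m}" for i
      by (rule member_le_sum[OF i]) (use nn in auto)
    have "0 \<le> (\<Sum>i=1..m. \<Lambda> i * R + G i / r)" using nn by (intro sum_nonneg) auto
    then show "N > 0" "N \<ge> y" using y_nonneg by (auto simp: N_def)
    show "N > \<Lambda> i * R" "N \<ge> G i / r" if "i \<in> {1..m}" for i
      using le[OF that] nn[OF that] y_nonneg unfolding N_def by linarith+
  qed
  have g_le_N: "\<alpha> i * g i (min s R) \<le> N * s" if i: "i \<in> {1..m}" and s: "s \<ge> 0" for i s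
  proof (cases "s \<le> r")
    case True
    then have "\<alpha> i * g i (min s R) \<le> y * s" using g_small[OF i, of s] s R by (simp add: min_def)
    also have "\<dots> \<le> N * s" using N(4) s by (rule mult_right_mono)
    finally show ?thesis .
  next
    case False
    have "\<alpha> i * g i (min s R) \<le> G i" using G(2)[OF i, of "min s R"] s R_pos by simp
    also have "\<dots> \<le> G i / r * s" using G(1)[OF i] r False by (simp add: field_simps)
    also have "\<dots> \<le> N * s" using N(3)[OF i] s by (rule mult_right_mono)
    finally show ?thesis .
  qed
  have "continuous_on {0..L} (\<lambda>t. \<Sum>i=1..m. a i t * (G i + N))"
    by (intro continuous_intros a_cont)
  \<comment> \<open>Bounds the truncated source and the multipliers from above whatever \<beta> is,
    since the terms with \<beta> only lower the source.\<close>
  then obtain H where H: "H > 0" "\<And>t. t \<in> {0..L} \<Longrightarrow> \<bar>\<Sum>i=1..m. a i t * (G i + N)\<bar> \<le> H"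
    by (rule bounded_on_Icc) blast
  define C where "C = H * L\<^sup>2"
  have C: "C > 0" using H L by (simp add: C_def)
  \<comment> \<open>By the mean value theorem the slope is at most \<open>C / (ta i - sg i)\<close>
    in modulus somewhere in interval \<open>i\<close>. From there \<open>u'' \<ge> - H\<close> lets
    it fall by at most \<open>H * L\<close> on the way to \<open>ta i\<close> and, going backwards,
    rise by at most \<open>H * L\<close> on the way to \<open>sg i\<close>.\<close>
  define D where "D = 1 + H * L + (\<Sum>i=1..m. C / (ta i - sg i))"
  have Dnn: "0 \<le> C / (ta i - sg i)" if "i \<in> {1..m}" for i using C pts(5)[OF that] by simp
  have D: "D > 0" "\<And>i. i \<in> {1..m} \<Longrightarrow> H * L + C / (ta i - sg i) \<le> D"
  proof -
    have "0 \<le> (\<Sum>i=1..m. C / (ta i - sg i))" using Dnn by (intro sum_nonneg) auto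
    then show "D > 0" using H L unfolding D_def by (smt (verit) mult_pos_pos)
    fix i assume i: "i \<in> {1..m}"
    have "C / (ta i - sg i) \<le> (\<Sum>i=1..m. C / (ta i - sg i))"
      by (rule member_le_sum[OF i]) (use Dnn in auto)
    then show "H * L + C / (ta i - sg i) \<le> D" by (simp add: D_def)
  qed
  obtain p0 p1 where p: "0 < p0" "p0 \<le> p1"
    and super: "\<And>i u u' u2 \<eta> t. \<lbrakk>i \<in> {1..m}; \<eta> \<ge> 0;
      \<And>t. t \<in> {sg i..ta i} \<Longrightarrow> (u has_real_derivative u' t) (at t within {sg i..ta i});
      \<And>t. t \<in> {sg i..ta i} \<Longrightarrow> (u' has_real_derivative u2 t) (at t within {sg i..ta i});
      \<And>t. t \<in> {sg i..ta i} \<Longrightarrow> u t \<ge> 0; u (sg i) \<le> \<eta>; u (ta i) \<le> \<eta>;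
      \<And>t. t \<in> {sg i..ta i} \<Longrightarrow> u2 t \<ge> - a i t * (y * u t); t \<in> {sg i..ta i}\<rbrakk> \<Longrightarrow> u t \<le> \<eta> / p0 * p1"
    by (rule supersolution) blast
  \<comment> \<open>Makes \<open>\<eta> / p0 * p1\<close> equal to \<open>r / 2\<close>, so that a
    subsolution with boundary values below \<open>\<eta>\<close> stays strictly below
    \<open>r\<close>.\<close>
  define \<eta> where "\<eta> = r * p0 / (2 * p1)"
  have \<eta>: "\<eta> > 0" "\<eta> / p0 * p1 < r" "\<eta> < r"
  proof -
    have p1: "p1 > 0" using p by simp
    show "\<eta> > 0" using p p1 r by (simp add: \<eta>_def)
    show "\<eta> / p0 * p1 < r" using p p1 r by (simp add: \<eta>_def)
    have "r * p0 < r * (2 * p1)" using p p1 r by (intro mult_strict_left_mono) auto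
    then show "\<eta> < r" using p1 by (simp add: \<eta>_def pos_divide_less_eq)
  qed
  obtain \<beta>star where \<beta>star: "\<beta>star > 0"
    and small: "\<And>\<beta> u u' u2 i. \<lbrakk>\<And>j. j \<in> {0..m} \<Longrightarrow> \<beta> j > \<beta>star;
      \<And>t. t \<in> {0..L} \<Longrightarrow> (u has_real_derivative u' t) (at t within {0..L});
      \<And>t. t \<in> {0..L} \<Longrightarrow> (u' has_real_derivative u2 t) (at t within {0..L});
      \<And>j t. \<lbrakk>j \<in> {0..m}; ta j < sg (j + 1); t \<in> {ta j..sg (j + 1)}\<rbrakk> \<Longrightarrow> u2 t = \<beta> j * b j t * k j (u t);
      u 0 = 0; u L = 0; \<And>t. t \<in> {0..L} \<Longrightarrow> 0 \<le> u t \<and> u t \<le> C;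
      \<And>i. i \<in> {1..m} \<Longrightarrow> - D \<le> u' (ta i) \<and> u' (sg i) \<le> D; i \<in> {1..m}\<rbrakk>
      \<Longrightarrow> u (sg i) < \<eta> \<and> u (ta i) < \<eta>"
    by (rule boundary_values_small[where C = C, OF D(1) \<eta>(1)]) blast
  show ?thesis
  proof (rule that[OF \<beta>star])
    fix \<beta> :: "nat \<Rightarrow> real" and J
    assume \<beta>: "\<And>j. j \<in> {0..m} \<Longrightarrow> \<beta> j > \<beta>star" and J: "J \<subseteq> {1..m}" "J \<noteq> {}"
    have \<beta>0: "\<beta> j > 0" if "j \<in> {0..m}" for j using \<beta>[OF that] \<beta>star by simp
    have finJ: "finite J" using J finite_subset by blast
    define c where "c = (\<lambda>i. if i \<in> J then R else r)"
    have c: "c i > 0" "c i \<le> R" for i using r R by (auto simp: c_def)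
    define F where "F = truncated c \<beta>"
    have F0: "F t 0 = 0" if "t \<in> {0..L}" for t
    proof -
      have "min 0 (c i) = 0" for i using c(1)[of i] by simp
      then show ?thesis by (simp add: F_def truncated_def g_zero k_zero)
    qed
    have Bk: "0 \<le> (\<Sum>j=0..m. \<beta> j * b j t * k j s)" if "t \<in> {0..L}" "s \<ge> 0" for t s
      using \<beta>0 b_nonneg k_nonneg that by (intro sum_nonneg mult_nonneg_nonneg) (auto simp: less_imp_le)
    have F_le: "F t s + N * (\<Sum>i\<in>J. a i t) \<le> H" if t: "t \<in> {0..L}" and s: "s \<ge> 0" for t s
    proof -
      have "F t s \<le> (\<Sum>i=1..m. \<alpha> i * a i t * g i (min s (c i)))"
        using Bk[OF t s] by (simp add: F_def truncated_def)
      also have "\<dots> \<le> (\<Sum>i=1..m. a i t * G i)"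
      proof (rule sum_mono)
        fix i assume i: "i \<in> {1..m}"
        have "min s (c i) \<in> {0..R}" using s c[of i] by (auto simp: min_def)
        then have "a i t * (\<alpha> i * g i (min s (c i))) \<le> a i t * G i"
          using G(2)[OF i] a_nonneg[OF i t] by (intro mult_left_mono) auto
        then show "\<alpha> i * a i t * g i (min s (c i)) \<le> a i t * G i" by (simp add: mult_ac)
      qed
      finally have "F t s \<le> (\<Sum>i=1..m. a i t * G i)" .
      moreover have "N * (\<Sum>i\<in>J. a i t) \<le> N * (\<Sum>i=1..m. a i t)"
        using N(1) J a_nonneg t by (intro mult_left_mono sum_mono2) auto
      ultimately have "F t s + N * (\<Sum>i\<in>J. a i t) \<le> (\<Sum>i=1..m. a i t * (G i + N))"
        by (simp add: distrib_left sum.distrib sum_distrib_left mult.commute)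
      then show ?thesis using H(2)[OF t] by linarith
    qed
    obtain u u' \<mu> where u: "\<And>t. t \<in> {0..L} \<Longrightarrow> (u has_real_derivative u' t) (at t within {0..L})"
      and u'_raw: "\<And>t. t \<in> {0..L} \<Longrightarrow> (u' has_real_derivative
        - (F t (u t) + (\<Sum>i\<in>J. a i t * (max 0 (\<mu> i) - max 0 (- \<mu> i) * u t)))) (at t within {0..L})"
      and u_ends: "u 0 = 0" "u L = 0" and ubd_raw: "\<And>t. t \<in> {0..L} \<Longrightarrow> 0 \<le> u t \<and> u t \<le> H * L\<^sup>2"
      and \<mu>N: "\<And>i. i \<in> J \<Longrightarrow> \<bar>\<mu> i\<bar> \<le> N"
      and \<mu>0: "\<And>i. \<lbrakk>i \<in> J; \<mu> i = 0\<rbrakk> \<Longrightarrow> r \<le> Sup (u ` {sg i..ta i}) \<and> Sup (u ` {sg i..ta i}) \<le> R"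
      and \<mu>pos: "\<And>i. \<lbrakk>i \<in> J; \<mu> i > 0\<rbrakk> \<Longrightarrow> Sup (u ` {sg i..ta i}) \<le> R \<and> (\<mu> i < N \<longrightarrow> Sup (u ` {sg i..ta i}) = R)"
      and \<mu>neg: "\<And>i. \<lbrakk>i \<in> J; \<mu> i < 0\<rbrakk> \<Longrightarrow> r \<le> Sup (u ` {sg i..ta i}) \<and> (- N < \<mu> i \<longrightarrow> Sup (u ` {sg i..ta i}) = r)"
    proof (rule bvp_with_multipliers[of L F J a sg ta r R N H])
      show "continuous_on ({0..L} \<times> {0..}) (\<lambda>z. F (fst z) (snd z))"
        unfolding F_def using c(1) by (intro truncated_cont less_imp_le)
      show "0 \<le> sg i \<and> sg i \<le> ta i \<and> ta i \<le> L" if "i \<in> J" for i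
        using in_range(1,2)[of i] pts(5)[of i] that J by auto
    next
      fix u u' :: "real \<Rightarrow> real" and \<mu> :: "nat \<Rightarrow> real"
      assume "\<And>t. t \<in> {0..L} \<Longrightarrow> (u has_real_derivative u' t) (at t within {0..L})"
        "\<And>t. t \<in> {0..L} \<Longrightarrow> (u' has_real_derivative
        - (F t (u t) + (\<Sum>i\<in>J. a i t * (max 0 (\<mu> i) - max 0 (- \<mu> i) * u t)))) (at t within {0..L})"
        "u 0 = 0" "u L = 0" "\<And>t. t \<in> {0..L} \<Longrightarrow> 0 \<le> u t \<and> u t \<le> H * L\<^sup>2"
        "\<And>i. i \<in> J \<Longrightarrow> \<bar>\<mu> i\<bar> \<le> N"
        "\<And>i. \<lbrakk>i \<in> J; \<mu> i = 0\<rbrakk> \<Longrightarrow> r \<le> Sup (u ` {sg i..ta i}) \<and> Sup (u ` {sg i..ta i}) \<le> R"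
        "\<And>i. \<lbrakk>i \<in> J; \<mu> i > 0\<rbrakk> \<Longrightarrow> Sup (u ` {sg i..ta i}) \<le> R \<and> (\<mu> i < N \<longrightarrow> Sup (u ` {sg i..ta i}) = R)"
        "\<And>i. \<lbrakk>i \<in> J; \<mu> i < 0\<rbrakk> \<Longrightarrow> r \<le> Sup (u ` {sg i..ta i}) \<and> (- N < \<mu> i \<longrightarrow> Sup (u ` {sg i..ta i}) = r)"
      then show thesis by (rule that)
    qed (use L F0 finJ a_cont a_nonneg R N(1) F_le J in auto)
    define u2 where "u2 = (\<lambda>t. - (F t (u t) + (\<Sum>i\<in>J. a i t * (max 0 (\<mu> i) - max 0 (- \<mu> i) * u t))))"
    have u': "(u' has_real_derivative u2 t) (at t within {0..L})" if "t \<in> {0..L}" for t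
      unfolding u2_def using u'_raw[OF that] .
    have ubd: "0 \<le> u t \<and> u t \<le> C" if "t \<in> {0..L}" for t using ubd_raw[OF that] by (simp add: C_def)
    have cu: "continuous_on {0..L} u" using u by (rule DERIV_continuous_on)
    have u2_ge: "u2 t \<ge> - H" if t: "t \<in> {0..L}" for t
    proof -
      have "(\<Sum>i\<in>J. a i t * (max 0 (\<mu> i) - max 0 (- \<mu> i) * u t)) \<le> (\<Sum>i\<in>J. a i t * N)"
      proof (intro sum_mono mult_left_mono)
        fix i assume i: "i \<in> J"
        have "0 \<le> max 0 (- \<mu> i) * u t" using ubd[OF t] by simp
        then show "max 0 (\<mu> i) - max 0 (- \<mu> i) * u t \<le> N" using \<mu>N[OF i] N(1) by linarith
      qed (use a_nonneg t J in auto)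
      also have "\<dots> = N * (\<Sum>i\<in>J. a i t)" by (simp add: sum_distrib_left mult.commute)
      finally show ?thesis using F_le[OF t, of "u t"] ubd[OF t] unfolding u2_def by linarith
    qed
    have u2_b: "u2 t = \<beta> j * b j t * k j (u t)"
      if j: "j \<in> {0..m}" "ta j < sg (j + 1)" and t: "t \<in> {ta j..sg (j + 1)}" for j t
    proof -
      have a_zero: "a l t = 0" if "l \<in> {1..m}" for l using a_vanish_b[OF j that t] .
      have "(\<Sum>j=0..m. \<beta> j * b j t * k j (u t)) = \<beta> j * b j t * k j (u t)"
        by (rule sum_single) (use j b_vanish_b[OF j _ _ t] in auto)
      moreover have "(\<Sum>i=1..m. \<alpha> i * a i t * g i (min (u t) (c i))) = 0"
        using a_zero by (intro sum.neutral) auto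
      moreover have "(\<Sum>i\<in>J. a i t * (max 0 (\<mu> i) - max 0 (- \<mu> i) * u t)) = 0"
        using a_zero J by (intro sum.neutral) auto
      ultimately show ?thesis by (simp add: u2_def F_def truncated_def)
    qed
    have F_a: "F t s = a i t * (\<alpha> i * g i (min s (c i)))" if i: "i \<in> {1..m}" and t: "t \<in> {sg i..ta i}" for i t s
    proof -
      have "(\<Sum>j=0..m. \<beta> j * b j t * k j s) = 0"
        using b_vanish_a[OF i _ t] by (intro sum.neutral) auto
      moreover have "(\<Sum>i=1..m. \<alpha> i * a i t * g i (min s (c i))) = \<alpha> i * a i t * g i (min s (c i))"
        by (rule sum_single) (use i a_vanish_a[OF i _ _ t] in auto)
      ultimately show ?thesis by (simp add: F_def truncated_def)
    qed
    have u2_in: "u2 t = - a i t * (\<alpha> i * g i (min (u t) R) + (max 0 (\<mu> i) - max 0 (- \<mu> i) * u t))"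
      if i: "i \<in> J" and t: "t \<in> {sg i..ta i}" for i t
    proof -
      have i': "i \<in> {1..m}" using i J by blast
      have "(\<Sum>i\<in>J. a i t * (max 0 (\<mu> i) - max 0 (- \<mu> i) * u t)) = a i t * (max 0 (\<mu> i) - max 0 (- \<mu> i) * u t)"
        by (rule sum_single[OF finJ i]) (use a_vanish_a[OF i' _ _ t] J in auto)
      then show ?thesis using i by (simp add: u2_def F_a[OF i' t] c_def algebra_simps)
    qed
    have u2_out: "u2 t = - a i t * (\<alpha> i * g i (min (u t) r))"
      if i: "i \<in> {1..m}" "i \<notin> J" and t: "t \<in> {sg i..ta i}" for i t
    proof -
      have "(\<Sum>i\<in>J. a i t * (max 0 (\<mu> i) - max 0 (- \<mu> i) * u t)) = 0"
      proof (intro sum.neutral ballI)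
        fix l assume "l \<in> J"
        then have "l \<in> {1..m}" "l \<noteq> i" using J i by auto
        then show "a l t * (max 0 (\<mu> l) - max 0 (- \<mu> l) * u t) = 0" using a_vanish_a[OF i(1) _ _ t] by simp
      qed
      then show ?thesis using i by (simp add: u2_def F_a[OF i(1) t] c_def)
    qed
    have loc: "(u has_real_derivative u' t) (at t within {sg i..ta i})"
      "(u' has_real_derivative u2 t) (at t within {sg i..ta i})" "u t \<ge> 0" "a i t \<ge> 0"
      if i: "i \<in> {1..m}" and t: "t \<in> {sg i..ta i}" for i t
      using DERIV_subset[OF u sub_a[OF i]] DERIV_subset[OF u' sub_a[OF i]] ubd a_nonneg[OF i] sub_a[OF i] t
      by blast+
    have slopes: "- D \<le> u' (ta i) \<and> u' (sg i) \<le> D" if i: "i \<in> {1..m}" for i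
    proof -
      have lt: "sg i < ta i" using pts(5)[OF i] .
      have rng: "0 \<le> sg i" "ta i \<le> L" using in_range(1,2)[OF i] by auto
      have mono: "u' x + H * x \<le> u' z + H * z" if "0 \<le> x" "x \<le> z" "z \<le> L" for x z
      proof (rule mono_within[of 0 L "\<lambda>x. u' x + H * x" "\<lambda>x. u2 x + H"])
        show "((\<lambda>x. u' x + H * x) has_real_derivative u2 t + H) (at t within {0..L})" if "t \<in> {0..L}" for t
          using u'[OF that] by (auto intro!: derivative_eq_intros)
        show "0 \<le> u2 t + H" if "0 < t" "t < L" for t using u2_ge[of t] that by simp
      qed (use that in auto)
      obtain x where x: "sg i < x" "x < ta i" "u (ta i) - u (sg i) = u' x * (ta i - sg i)"
        using mvt_within[OF u rng(1) lt rng(2)] by blast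
      have "\<bar>u (ta i) - u (sg i)\<bar> \<le> C" using ubd[of "ta i"] ubd[of "sg i"] rng lt by auto
      then have "\<bar>u' x\<bar> \<le> C / (ta i - sg i)" using x lt by (simp add: abs_mult pos_le_divide_eq)
      moreover have "u' x + H * x \<le> u' (ta i) + H * ta i" "u' (sg i) + H * sg i \<le> u' x + H * x"
        using mono x rng by auto
      moreover have "H * (ta i - x) \<le> H * L" "H * (x - sg i) \<le> H * L"
        using H(1) x rng by (intro mult_left_mono; simp)+
      ultimately show ?thesis using D(2)[OF i] by (simp add: right_diff_distrib abs_le_iff)
    qed
    have bdry: "u (sg i) < \<eta> \<and> u (ta i) < \<eta>" if i: "i \<in> {1..m}" for i
      using small[OF \<beta> u u' u2_b u_ends ubd slopes i] by blast
    have below: "u t < r" if i: "i \<in> {1..m}" and t: "t \<in> {sg i..ta i}"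
      and le: "\<And>t. t \<in> {sg i..ta i} \<Longrightarrow> u2 t \<ge> - a i t * (y * u t)" for i t
    proof -
      have "u t \<le> \<eta> / p0 * p1"
        by (rule super[of i \<eta> u u' u2 t]) (use i t \<eta> loc[OF i] bdry[OF i] le in \<open>auto simp: less_imp_le\<close>)
      then show ?thesis using \<eta> by simp
    qed
    have att: "\<exists>x\<in>{sg i..ta i}. u x = Sup (u ` {sg i..ta i}) \<and> (\<forall>z\<in>{sg i..ta i}. u z \<le> Sup (u ` {sg i..ta i}))"
      if i: "i \<in> {1..m}" for i
      using Sup_image_attained[of "sg i" "ta i" u] pts(5)[OF i] continuous_on_subset[OF cu sub_a[OF i]]
      by (metis less_imp_le)
    \<comment> \<open>A negative multiplier would make \<open>u\<close> a subsolution on the interval with boundary values below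
      \<open>\<eta>\<close>, hence too small; a positive one is excluded by the a priori bound \<open>R0 i\<close> or by the size of \<open>N\<close>.\<close>
    have \<mu>_zero: "\<mu> i = 0" if iJ: "i \<in> J" for i
    proof -
      have i: "i \<in> {1..m}" using iJ J by blast
      let ?S = "Sup (u ` {sg i..ta i})"
      obtain x where x: "x \<in> {sg i..ta i}" "u x = ?S" "\<And>z. z \<in> {sg i..ta i} \<Longrightarrow> u z \<le> ?S"
        using att[OF i] by blast
      have "\<not> \<mu> i < 0"
      proof
        assume neg: "\<mu> i < 0"
        have "u x < r"
        \<comment> \<open>If the cap is not reached, the maximum is exactly \<open>r\<close>, so all
          values lie in the range where \<open>g_small\<close> applies. At the cap the absorption
          outweighs the source, and \<open>u\<close> is convex.\<close>
        proof (cases "- N < \<mu> i")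
          case True
          then have S: "?S = r" using \<mu>neg[OF iJ neg] by simp
          show ?thesis
          proof (rule below[OF i x(1)])
            fix t assume t: "t \<in> {sg i..ta i}"
            have ut: "0 \<le> u t" "u t \<le> r" using loc(3)[OF i t] x(3)[OF t] S by auto
            have "\<alpha> i * g i (min (u t) R) \<le> y * u t" using g_small[OF i, of "u t"] ut R by (simp add: min_def)
            moreover have "0 \<le> max 0 (- \<mu> i) * u t" using ut by simp
            ultimately have "\<alpha> i * g i (min (u t) R) + (max 0 (\<mu> i) - max 0 (- \<mu> i) * u t) \<le> y * u t"
              using neg by simp
            from mult_left_mono[OF this loc(4)[OF i t]]
            show "- a i t * (y * u t) \<le> u2 t" by (simp add: u2_in[OF iJ t])
          qed
        next
          case False
          then have \<mu>: "\<mu> i = - N" using \<mu>N[OF iJ] by linarith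
          have "u x \<le> \<eta>"
          proof (rule convex_le[OF loc(1,2)[OF i] _ _ _ x(1)])
            fix t assume "sg i < t" "t < ta i"
            then have t: "t \<in> {sg i..ta i}" by simp
            have "\<alpha> i * g i (min (u t) R) + (max 0 (\<mu> i) - max 0 (- \<mu> i) * u t) \<le> 0"
              using g_le_N[OF i loc(3)[OF i t]] N(1) \<mu> by simp
            from mult_left_mono[OF this loc(4)[OF i t]]
            show "0 \<le> u2 t" by (simp add: u2_in[OF iJ t])
          qed (use bdry[OF i] in auto)
          then show ?thesis using \<eta>(3) by simp
        qed
        then show False using \<mu>neg[OF iJ neg] x(2) by simp
      qed
      moreover have "\<not> \<mu> i > 0"
      proof
        assume pos: "\<mu> i > 0"
        have uR: "u t \<le> R" if "t \<in> {sg i..ta i}" for t using \<mu>pos[OF iJ pos] x(3)[OF that] by simp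
        have u2_eq: "u2 t = - a i t * (\<alpha> i * g i (u t) + \<mu> i)" if "t \<in> {sg i..ta i}" for t
          using u2_in[OF iJ that] uR[OF that] pos by (simp add: min_def max_def)
        have g0: "0 \<le> \<alpha> i * g i (u t)" if "t \<in> {sg i..ta i}" for t
          using \<alpha>[OF i] g_nonneg[OF i loc(3)[OF i that]] by simp
        show False
        proof (cases "\<mu> i < N")
          case True
          then have S: "?S = R" using \<mu>pos[OF iJ pos] by simp
          have "u x \<le> R0 i"
          proof (rule R0[OF i _ x(1)], intro ballI conjI)
            fix t assume t: "t \<in> {sg i..ta i}"
            have "a i t * (\<alpha> i * g i (u t)) \<le> a i t * (\<alpha> i * g i (u t) + \<mu> i)"
              using loc(4)[OF i t] pos by (intro mult_left_mono) auto
            then show "u2 t \<le> - a i t * (\<alpha> i * g i (u t))" by (simp add: u2_eq[OF t])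
          qed (use loc[OF i] in auto)
          then show False using R(2)[OF i] S x(2) by simp
        next
          case False
          then have \<mu>: "\<mu> i = N" using \<mu>N[OF iJ] by linarith
          have "N \<le> \<Lambda> i * R"
          proof (rule \<Lambda>[OF i, of u u' u2], intro ballI conjI)
            fix t assume t: "t \<in> {sg i..ta i}"
            have "a i t * N \<le> a i t * (\<alpha> i * g i (u t) + \<mu> i)"
              using loc(4)[OF i t] g0[OF t] \<mu> by (intro mult_left_mono) auto
            then show "u2 t \<le> - a i t * N" by (simp add: u2_eq[OF t])
          qed (use loc[OF i] uR in auto)
          then show False using N(2)[OF i] by simp
        qed
      qed
      ultimately show ?thesis by simp
    qed
    \<comment> \<open>Outside \<open>J\<close> the truncation at \<open>r\<close> keeps the source
      below \<open>a i t * (y * u t)\<close> even where \<open>u\<close> might exceed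
      \<open>r\<close>, so the comparison is not circular.\<close>
    have small_out: "u t < r" if i: "i \<in> {1..m}" "i \<notin> J" and t: "t \<in> {sg i..ta i}" for i t
    proof (rule below[OF i(1) t])
      fix t assume t: "t \<in> {sg i..ta i}"
      have ut: "0 \<le> u t" using loc(3)[OF i(1) t] .
      have "\<alpha> i * g i (min (u t) r) \<le> y * min (u t) r" using g_small[OF i(1), of "min (u t) r"] ut r by simp
      also have "\<dots> \<le> y * u t" using y_nonneg by (intro mult_left_mono) auto
      finally have "a i t * (\<alpha> i * g i (min (u t) r)) \<le> a i t * (y * u t)"
        using loc(4)[OF i(1) t] by (rule mult_left_mono)
      then show "- a i t * (y * u t) \<le> u2 t" by (simp add: u2_out[OF i t])
    qed
    have large_in: "\<exists>t\<in>{sg i..ta i}. r \<le> u t" and le_R: "\<And>t. t \<in> {sg i..ta i} \<Longrightarrow> u t \<le> R" if iJ: "i \<in> J" for i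
    proof -
      have i: "i \<in> {1..m}" using iJ J by blast
      show "\<exists>t\<in>{sg i..ta i}. r \<le> u t" using att[OF i] \<mu>0[OF iJ \<mu>_zero[OF iJ]] by metis
      show "u t \<le> R" if "t \<in> {sg i..ta i}" for t
        using att[OF i] \<mu>0[OF iJ \<mu>_zero[OF iJ]] that by force
    qed
    \<comment> \<open>On each positivity interval \<open>u\<close> is now known to lie below the
      truncation level, and off that interval its weight vanishes, so the truncation changes
      nothing.\<close>
    have u2_source: "u2 t = - source \<beta> t (u t)" if t: "t \<in> {0..L}" for t
    proof -
      have "\<alpha> i * a i t * g i (min (u t) (c i)) = \<alpha> i * a i t * g i (u t)" if i: "i \<in> {1..m}" for i
      proof (cases "t \<in> {sg i..ta i}")
        case True
        have "u t \<le> c i"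
          using le_R[OF _ True] small_out[OF i _ True] by (cases "i \<in> J") (auto simp: c_def)
        then show ?thesis by (simp add: min_def)
      next
        case False
        then show ?thesis using a_supp[OF i, of t] t by simp
      qed
      then have "(\<Sum>i=1..m. \<alpha> i * a i t * g i (min (u t) (c i))) = (\<Sum>i=1..m. \<alpha> i * a i t * g i (u t))"
        by (rule sum.cong[OF refl])
      then have "F t (u t) = source \<beta> t (u t)" by (simp only: F_def truncated_def)
      then show ?thesis using \<mu>_zero by (simp add: u2_def)
    qed
    have u_pos: "u t > 0" if t: "0 < t" "t < L" for t
    proof -
      have "\<forall>j\<in>{0..m}. \<exists>B. B > 0 \<and> (\<forall>t\<in>{0..L}. b j t \<le> B)"
        using bounded_on_Icc[OF b_cont] by (metis abs_le_D1)
      then obtain Bb where Bb: "\<And>j. j \<in> {0..m} \<Longrightarrow> Bb j > 0" "\<And>j t. j \<in> {0..m} \<Longrightarrow> t \<in> {0..L} \<Longrightarrow> b j t \<le> Bb j"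
        by metis
      have "\<forall>j\<in>{0..m}. \<exists>K\<ge>0. \<forall>s\<in>{0..C}. k j s \<le> K * s" using k_lin by blast
      then obtain K where K: "\<And>j. j \<in> {0..m} \<Longrightarrow> K j \<ge> 0" "\<And>j s. j \<in> {0..m} \<Longrightarrow> s \<in> {0..C} \<Longrightarrow> k j s \<le> K j * s"
        by metis
      \<comment> \<open>A constant with \<open>u'' \<le> Q * u\<close>, obtained from the linear
        bounds on the \<open>k j\<close> over \<open>{0..C}\<close>. It may depend on \<beta>, as
        only strict positivity is at stake; the summand 1 makes \<open>sqrt Q\<close>
        positive.\<close>
      define Q where "Q = 1 + (\<Sum>j=0..m. \<beta> j * Bb j * K j)"
      have "0 \<le> (\<Sum>j=0..m. \<beta> j * Bb j * K j)"
        using \<beta>0 Bb(1) K(1) by (intro sum_nonneg mult_nonneg_nonneg) (auto simp: less_imp_le)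
      then have Q: "Q > 0" by (simp add: Q_def)
      obtain i where iJ: "i \<in> J" using J by blast
      then have i: "i \<in> {1..m}" using J by blast
      obtain s where s: "s \<in> {sg i..ta i}" "r \<le> u s" using large_in[OF iJ] by blast
      show ?thesis
      proof (rule positive_interior[of 0 L u u' u2 "sqrt Q" s])
        fix t assume t: "t \<in> {0..L}"
        have "0 \<le> (\<Sum>i=1..m. \<alpha> i * a i t * g i (u t))"
          using \<alpha> a_nonneg g_nonneg ubd t by (intro sum_nonneg mult_nonneg_nonneg) (auto simp: less_imp_le)
        then have "u2 t \<le> (\<Sum>j=0..m. \<beta> j * b j t * k j (u t))" by (simp add: u2_source[OF t])
        also have "\<dots> \<le> (\<Sum>j=0..m. \<beta> j * Bb j * K j * u t)"
        proof (rule sum_mono)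
          fix j assume j: "j \<in> {0..m}"
          have "\<beta> j * b j t * k j (u t) \<le> \<beta> j * Bb j * (K j * u t)"
            using \<beta>0[OF j] Bb(1)[OF j] Bb(2)[OF j t] b_nonneg[OF j t] K(2)[OF j, of "u t"] ubd[OF t] k_nonneg[OF j, of "u t"]
            by (intro mult_mono) auto
          then show "\<beta> j * b j t * k j (u t) \<le> \<beta> j * Bb j * K j * u t" by (simp add: mult.assoc)
        qed
        also have "\<dots> = (\<Sum>j=0..m. \<beta> j * Bb j * K j) * u t" by (simp add: sum_distrib_right)
        also have "\<dots> \<le> Q * u t" using ubd[OF t] by (intro mult_right_mono) (auto simp: Q_def)
        finally show "u2 t \<le> (sqrt Q)\<^sup>2 * u t" using Q by simp
      qed (use u u' ubd Q s r sub_a[OF i] t in auto)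
    qed
    show "\<exists>u u'. (\<forall>t\<in>{0..L}. (u has_real_derivative u' t) (at t within {0..L}) \<and>
        (u' has_real_derivative - source \<beta> t (u t)) (at t within {0..L})) \<and>
      u 0 = 0 \<and> u L = 0 \<and> (\<forall>t\<in>{0..L}. u t \<ge> 0) \<and> (\<forall>t. 0 < t \<longrightarrow> t < L \<longrightarrow> u t > 0) \<and>
      (\<forall>i\<in>{1..m}. (i \<in> J \<longrightarrow> (\<exists>t\<in>{sg i..ta i}. r \<le> u t)) \<and> (i \<notin> J \<longrightarrow> (\<forall>t\<in>{sg i..ta i}. u t < r)))"
    proof (rule exI[of _ u], rule exI[of _ u'], intro conjI ballI allI impI)
      fix t assume t: "t \<in> {0..L}"
      show "(u' has_real_derivative - source \<beta> t (u t)) (at t within {0..L})"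
        using u'[OF t] by (simp only: u2_source[OF t])
    qed (use u u_ends ubd u_pos large_in small_out in auto)
  qed
qed

end

section \<open>Radial solutions on the annulus\<close>

lemma closure_annulus: "closure (annulus R1 R2) \<subseteq> {x. R1 \<le> norm x \<and> norm x \<le> R2}"
proof (rule closure_minimal)
  show "closed {x::real^'n. R1 \<le> norm x \<and> norm x \<le> R2}"
    by (intro closed_Collect_conj closed_Collect_le continuous_intros)
qed (auto simp: annulus_def)

lemma frontier_annulus:
  fixes x :: "real^'n"
  assumes x: "x \<in> frontier (annulus R1 R2)"
  shows "norm x = R1 \<or> norm x = R2"
proof -
  have "open {x::real^'n. R1 < norm x \<and> norm x < R2}"
    by (intro open_Collect_conj open_Collect_less continuous_intros)
  then have "x \<notin> annulus R1 R2" using x by (simp add: frontier_def interior_open annulus_def)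
  moreover have "R1 \<le> norm x \<and> norm x \<le> R2" using x closure_annulus[of R1 R2] by (auto simp: frontier_def)
  ultimately show ?thesis by (auto simp: annulus_def)
qed

text \<open>With \<open>q = v' / r\<close> the gradient is \<open>q\<close> times \<open>x\<close>,
  and with \<open>p = q' / r\<close> the Hessian is \<open>q\<close> times the identity plus
  \<open>p\<close> times the matrix of the products \<open>x $ i * x $ j\<close>. Its trace, the
  dimension times \<open>q\<close> plus \<open>p * r\<^sup>2\<close>, is the radial Laplacian. Radii
  stay away from 0, so \<open>q\<close> and \<open>p\<close> are continuous up to the
  boundary.\<close>

lemma radial_classical_solution:
  fixes v v' v2 :: "real \<Rightarrow> real" and f :: "real \<Rightarrow> real \<Rightarrow> real"
  assumes R: "0 < R1" "R1 < R2"
    and v: "\<And>r. r \<in> {R1..R2} \<Longrightarrow> (v has_real_derivative v' r) (at r within {R1..R2})"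
    and v': "\<And>r. r \<in> {R1..R2} \<Longrightarrow> (v' has_real_derivative v2 r) (at r within {R1..R2})"
    and v2: "continuous_on {R1..R2} v2" and ends: "v R1 = 0" "v R2 = 0"
    and eq: "\<And>r. R1 < r \<Longrightarrow> r < R2 \<Longrightarrow> - (v2 r + (real CARD('n) - 1) / r * v' r) = f r (v r)"
  shows "classical_dirichlet_solution (annulus R1 R2 :: (real^'n) set) (\<lambda>x s. f (norm x) s) (\<lambda>x. v (norm x))"
proof -
  define q where "q = (\<lambda>r. v' r / r)"
  define p where "p = (\<lambda>r. v2 r / r\<^sup>2 - v' r / r ^ 3)"
  define Du where "Du = (\<lambda>x :: real^'n. q (norm x) *\<^sub>R x)"
  define D2u where "D2u = (\<lambda>x :: real^'n. \<chi> i j. (if i = j then q (norm x) else 0) + p (norm x) * (x $ i * x $ j))"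
  have sub: "norm x \<in> {R1..R2}" "x \<noteq> 0" if "x \<in> closure (annulus R1 R2)" for x :: "real^'n"
    using that closure_annulus[of R1 R2] R by auto
  have cv: "continuous_on {R1..R2} v" "continuous_on {R1..R2} v'"
    using DERIV_continuous_on[OF v] DERIV_continuous_on[OF v'] by auto
  have cq: "continuous_on {R1..R2} q" unfolding q_def using cv R by (intro continuous_intros) auto
  have cp: "continuous_on {R1..R2} p" unfolding p_def using cv v2 R by (intro continuous_intros) auto
  have comp: "continuous_on (closure (annulus R1 R2)) (\<lambda>x :: real^'n. h (norm x))"
    if "continuous_on {R1..R2} h" for h :: "real \<Rightarrow> real"
    by (rule continuous_on_compose2[OF that]) (use sub(1) in \<open>auto intro!: continuous_intros\<close>)
  have interior: "R1 < norm x" "norm x < R2" "x \<noteq> 0" if "x \<in> annulus R1 R2" for x :: "real^'n"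
    using that R by (auto simp: annulus_def)
  have at: "(h has_real_derivative h' r) (at r)"
    if "R1 < r" "r < R2" "\<And>r. r \<in> {R1..R2} \<Longrightarrow> (h has_real_derivative h' r) (at r within {R1..R2})" for h h' r
    using that(3)[of r] that(1,2) at_within_interior[of r "{R1..R2}"] by simp
  show ?thesis unfolding classical_dirichlet_solution_def
  proof (rule exI[of _ Du], rule exI[of _ D2u], intro conjI ballI)
    show "continuous_on (closure (annulus R1 R2)) (\<lambda>x :: real^'n. v (norm x))" by (rule comp[OF cv(1)])
    show "continuous_on (closure (annulus R1 R2)) Du" unfolding Du_def by (intro continuous_intros comp cq)
    have diag: "continuous_on (closure (annulus R1 R2)) (\<lambda>x :: real^'n. if i = j then q (norm x) else 0)" for i j :: 'n
      using comp[OF cq] by (cases "i = j") auto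
    have quad: "continuous_on (closure (annulus R1 R2)) (\<lambda>x :: real^'n. p (norm x) * (x $ i * x $ j))" for i j
      by (intro continuous_intros comp cp)
    show "continuous_on (closure (annulus R1 R2)) D2u" unfolding D2u_def
      by (intro continuous_on_vec_lambda continuous_on_add diag quad)
  next
    fix x :: "real^'n" assume x: "x \<in> annulus R1 R2"
    note r = interior[OF x]
    have n: "(norm has_derivative (\<lambda>h. sgn x \<bullet> h)) (at x)"
      using has_derivative_norm[OF r(3)] by (simp add: inner_commute)
    have "(v has_derivative (*) (v' (norm x))) (at (norm x))"
      using at[OF r(1,2) v] by (simp add: has_field_derivative_def)
    from has_derivative_compose[OF n this]
    show "((\<lambda>x. v (norm x)) has_derivative (\<lambda>h. Du x \<bullet> h)) (at x)"
      by (simp add: Du_def q_def sgn_div_norm divide_inverse mult.assoc)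
    have "(q has_real_derivative p r * r) (at r within {R1..R2})" if "r \<in> {R1..R2}" for r
    proof -
      have "(v2 r * r - v' r * 1) / (r * r) = p r * r"
        using that R by (simp add: p_def field_simps power2_eq_square power3_eq_cube)
      moreover have "(q has_real_derivative (v2 r * r - v' r * 1) / (r * r)) (at r within {R1..R2})"
        unfolding q_def using v'[OF that] that R by (auto intro!: derivative_eq_intros)
      ultimately show ?thesis by simp
    qed
    from at[OF r(1,2) this] have "(q has_derivative (*) (p (norm x) * norm x)) (at (norm x))"
      by (simp add: has_field_derivative_def)
    from has_derivative_compose[OF n this]
    have "((\<lambda>x. q (norm x)) has_derivative (\<lambda>h. p (norm x) * norm x * (sgn x \<bullet> h))) (at x)" .
    moreover have "p (norm x) * norm x * (sgn x \<bullet> h) = p (norm x) * (x \<bullet> h)" for h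
      using r(3) by (simp add: sgn_div_norm)
    ultimately have "((\<lambda>x. q (norm x)) has_derivative (\<lambda>h. p (norm x) * (x \<bullet> h))) (at x)" by simp
    then have "(Du has_derivative (\<lambda>h. q (norm x) *\<^sub>R h + (p (norm x) * (x \<bullet> h)) *\<^sub>R x)) (at x)"
      unfolding Du_def by (auto intro!: derivative_eq_intros)
    moreover have "D2u x *v h = q (norm x) *\<^sub>R h + (p (norm x) * (x \<bullet> h)) *\<^sub>R x" for h
    proof (subst vec_eq_iff, intro allI)
      fix i
      have "(D2u x *v h) $ i = (\<Sum>j\<in>UNIV. (if i = j then q (norm x) * h $ j else 0) + p (norm x) * x $ i * (x $ j * h $ j))"
        unfolding matrix_vector_mult_def D2u_def by (auto intro!: sum.cong simp: algebra_simps)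
      also have "\<dots> = q (norm x) * h $ i + p (norm x) * x $ i * (x \<bullet> h)"
        by (simp add: sum.distrib inner_vec_def sum_distrib_left)
      finally show "(D2u x *v h) $ i = (q (norm x) *\<^sub>R h + (p (norm x) * (x \<bullet> h)) *\<^sub>R x) $ i"
        by simp
    qed
    ultimately show "(Du has_derivative (\<lambda>h. D2u x *v h)) (at x)" by simp
    have "(\<Sum>i\<in>UNIV. D2u x $ i $ i) = real CARD('n) * q (norm x) + p (norm x) * (norm x)\<^sup>2"
      by (simp add: D2u_def sum.distrib power2_norm_eq_inner inner_vec_def flip: sum_distrib_left)
    also have "\<dots> = v2 (norm x) + (real CARD('n) - 1) / norm x * v' (norm x)"
      using r(3) by (simp add: q_def p_def field_simps power2_eq_square power3_eq_cube)
    finally show "- (\<Sum>i\<in>UNIV. D2u x $ i $ i) = f (norm x) (v (norm x))" using eq[OF r(1,2)] by simp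
  next
    fix x :: "real^'n" assume "x \<in> frontier (annulus R1 R2)"
    then show "v (norm x) = 0" using frontier_annulus ends by metis
  qed
qed

section \<open>Growth conditions at zero and at infinity, turned into inequalities\<close>

lemma Limsup_ratio_bound:
  fixes f :: "real \<Rightarrow> real"
  assumes "Limsup (at_right 0) (\<lambda>s. ereal (f s / s)) < ereal c"
  obtains d where "d > 0" "\<And>s. \<lbrakk>0 < s; s < d\<rbrakk> \<Longrightarrow> f s \<le> c * s"
proof -
  have "eventually (\<lambda>s. ereal (f s / s) < ereal c) (at_right 0)" using assms by (rule Limsup_lessD)
  then obtain d where d: "d > 0" "\<And>s. 0 < s \<Longrightarrow> s < d \<Longrightarrow> f s / s < c"
    unfolding eventually_at_right_field by auto
  have "f s \<le> c * s" if "0 < s" "s < d" for s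
    using d(2)[OF that] that by (simp add: divide_less_eq)
  then show ?thesis using that d by blast
qed

text \<open>Near zero the upper limit controls the ratio, away from zero boundedness does. Such a
  bound on the absorbing terms is what keeps a solution from touching zero in the interior.\<close>

lemma linear_bound:
  fixes f :: "real \<Rightarrow> real"
  assumes f: "continuous_on {0..} f" "f 0 = 0"
    and lim: "Limsup (at_right 0) (\<lambda>s. ereal (f s / s)) < \<infinity>"
  shows "\<exists>K\<ge>0. \<forall>s\<in>{0..C}. f s \<le> K * s"
proof -
  obtain c where c: "Limsup (at_right 0) (\<lambda>s. ereal (f s / s)) < ereal c"
    using lim by (metis ereal_dense2 less_PInf_Ex_of_nat)
  obtain d where d: "d > 0" "\<And>s. \<lbrakk>0 < s; s < d\<rbrakk> \<Longrightarrow> f s \<le> c * s" using Limsup_ratio_bound[OF c] by blast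
  have "continuous_on {0..C} f" using f(1) by (rule continuous_on_subset) auto
  then obtain B where B: "B > 0" "\<And>s. s \<in> {0..C} \<Longrightarrow> \<bar>f s\<bar> \<le> B" by (rule bounded_on_Icc) blast
  define K where "K = \<bar>c\<bar> + B / d"
  have "f s \<le> K * s" if s: "s \<in> {0..C}" for s
  proof (cases "s < d")
    case True
    have "f s \<le> \<bar>c\<bar> * s"
    proof (cases "s = 0")
      case False
      then have "f s \<le> c * s" using d(2) True s by simp
      also have "\<dots> \<le> \<bar>c\<bar> * s" using s by (intro mult_right_mono) auto
      finally show ?thesis .
    qed (use f in simp)
    moreover have "0 \<le> B / d * s" using B(1) d s by simp
    ultimately show ?thesis by (simp add: K_def distrib_right)
  next
    case False
    have "f s \<le> B" using B(2)[OF s] by simp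
    also have "\<dots> \<le> B / d * s" using False B(1) d by (simp add: field_simps)
    also have "\<dots> \<le> K * s" using s by (intro mult_right_mono) (auto simp: K_def)
    finally show ?thesis .
  qed
  then show ?thesis using B(1) d by (intro exI[of _ K]) (auto simp: K_def)
qed

text \<open>Positivity of \<open>f\<close> makes the upper limit nonnegative, hence a real number,
  so the extended-real product can be evaluated. The strict inequality then leaves room for a slope
  \<open>c\<close> between this limit and \<open>lam / \<alpha>\<close>, and
  \<open>\<alpha> * c\<close> serves as \<open>y\<close>.\<close>

lemma slope_below:
  fixes f :: "real \<Rightarrow> real" and \<alpha> lam :: real
  assumes \<alpha>: "\<alpha> > 0" and f0: "f 0 = 0" and pos: "\<And>s. s > 0 \<Longrightarrow> f s > 0"
    and fin: "Limsup (at_right 0) (\<lambda>s. ereal (f s / s)) < \<infinity>"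
    and lt: "ereal \<alpha> * Limsup (at_right 0) (\<lambda>s. ereal (f s / s)) < ereal lam"
  shows "\<exists>y d. y < lam \<and> d > 0 \<and> (\<forall>s\<in>{0..d}. \<alpha> * f s \<le> y * s)"
proof -
  let ?l = "Limsup (at_right 0) (\<lambda>s. ereal (f s / s))"
  have "eventually (\<lambda>s :: real. 0 < s) (at_right 0)" by (simp add: eventually_at_right_less)
  then have "eventually (\<lambda>s. 0 \<le> ereal (f s / s)) (at_right 0)"
    by eventually_elim (use pos in \<open>simp add: less_imp_le\<close>)
  then have "0 \<le> ?l" by (intro le_Limsup) auto
  then obtain l where l: "?l = ereal l" using fin by (cases ?l) auto
  then have "\<alpha> * l < lam" using lt by simp
  then have "l < lam / \<alpha>" using \<alpha> by (simp add: pos_less_divide_eq mult.commute)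
  then obtain c where c: "l < c" "c < lam / \<alpha>" using dense by blast
  obtain d where d: "d > 0" "\<And>s. \<lbrakk>0 < s; s < d\<rbrakk> \<Longrightarrow> f s \<le> c * s"
    using Limsup_ratio_bound[of f c] l c by auto
  have "\<alpha> * f s \<le> \<alpha> * c * s" if s: "s \<in> {0..d / 2}" for s
  proof (cases "s = 0")
    case False
    then have "f s \<le> c * s" using d s by simp
    then show ?thesis using \<alpha> by (simp add: mult.assoc mult_left_mono)
  qed (simp add: f0)
  moreover have "\<alpha> * c < lam" using c \<alpha> by (simp add: pos_less_divide_eq mult.commute)
  ultimately have "\<alpha> * c < lam \<and> d / 2 > 0 \<and> (\<forall>s\<in>{0..d / 2}. \<alpha> * f s \<le> \<alpha> * c * s)" using d(1) by simp
  then show ?thesis by blast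
qed

text \<open>The lower limit may be infinite, so a real slope \<open>c\<close> strictly between
  \<open>lam / \<alpha>\<close> and this limit is fixed first. For arguments too small for the ratio
  to exceed \<open>c\<close>, the subtracted constant makes the left-hand side nonpositive.\<close>

lemma slope_above:
  fixes f :: "real \<Rightarrow> real" and \<alpha> lam :: real
  assumes \<alpha>: "\<alpha> > 0" and nn: "\<And>s. s \<ge> 0 \<Longrightarrow> f s \<ge> 0"
    and gt: "ereal \<alpha> * Liminf at_top (\<lambda>s. ereal (f s / s)) > ereal lam"
  shows "\<exists>d>0. \<exists>c. \<forall>s\<ge>0. (lam + d) * s - c \<le> \<alpha> * f s"
proof -
  let ?l = "Liminf at_top (\<lambda>s. ereal (f s / s))"
  obtain c where c: "lam / \<alpha> < c" "ereal c < ?l"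
  proof (cases ?l)
    case (real l)
    then have "lam / \<alpha> < l" using gt \<alpha> by (simp add: pos_divide_less_eq mult.commute)
    then show ?thesis using that dense[of "lam / \<alpha>" l] real by auto
  next
    case PInf
    then show ?thesis using that[of "lam / \<alpha> + 1"] by simp
  next
    case MInf
    then show ?thesis using gt \<alpha> by simp
  qed
  have "eventually (\<lambda>s. ereal c < ereal (f s / s)) at_top" using c(2) by (rule less_LiminfD)
  then obtain s0 where s0: "\<And>s. s \<ge> s0 \<Longrightarrow> c < f s / s" by (auto simp: eventually_at_top_linorder)
  define d where "d = \<alpha> * c - lam"
  have d: "d > 0" using c(1) \<alpha> by (simp add: d_def pos_divide_less_eq mult.commute)
  have "(lam + d) * s - \<bar>lam + d\<bar> * max 1 s0 \<le> \<alpha> * f s" if s: "s \<ge> 0" for s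
  proof (cases "s \<ge> max 1 s0")
    case True
    then have "c * s < f s" using s0[of s] by (simp add: pos_less_divide_eq)
    then have "\<alpha> * (c * s) \<le> \<alpha> * f s" using \<alpha> by simp
    moreover have "0 \<le> \<bar>lam + d\<bar> * max 1 s0" by simp
    moreover have "(lam + d) * s = \<alpha> * (c * s)" by (simp add: d_def)
    ultimately show ?thesis by linarith
  next
    case False
    have "(lam + d) * s \<le> \<bar>lam + d\<bar> * max 1 s0" using s False by (intro mult_mono) auto
    moreover have "0 \<le> \<alpha> * f s" using \<alpha> nn[OF s] by simp
    ultimately show ?thesis by linarith
  qed
  then show ?thesis using d by blast
qed

section \<open>The change of variables between radii and the interval \<open>[0, L]\<close>\<close>

locale annulus_radii =
  fixes R1 R2 :: real and N :: nat
  assumes R: "0 < R1" "R1 < R2" and N: "N \<ge> 1"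
begin

definition L :: real where "L = hvar R1 N R2"

lemma hvar_deriv:
  "r \<in> {R1..R2} \<Longrightarrow> (hvar R1 N has_real_derivative r powr (1 - real N)) (at r within {R1..R2})"
  unfolding hvar_def[abs_def]
  by (intro integral_has_real_derivative continuous_intros) (use R in auto)

lemma hvar_R1: "hvar R1 N R1 = 0"
  by (simp add: hvar_def)

lemma hvar_cont: "continuous_on {R1..R2} (hvar R1 N)"
  using hvar_deriv by (rule DERIV_continuous_on)

lemma hvar_less: "\<lbrakk>R1 \<le> r; r < s; s \<le> R2\<rbrakk> \<Longrightarrow> hvar R1 N r < hvar R1 N s"
proof -
  assume rs: "R1 \<le> r" "r < s" "s \<le> R2"
  obtain z where z: "r < z" "z < s" "hvar R1 N s - hvar R1 N r = z powr (1 - real N) * (s - r)"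
    using mvt_within[OF hvar_deriv rs] by blast
  have "z powr (1 - real N) * (s - r) > 0" using z rs R by simp
  then show ?thesis using z by simp
qed

lemma hvar_le: "\<lbrakk>R1 \<le> r; r \<le> s; s \<le> R2\<rbrakk> \<Longrightarrow> hvar R1 N r \<le> hvar R1 N s"
  using hvar_less[of r s] by (cases "r = s") auto

lemma hvar_le_iff: "\<lbrakk>r \<in> {R1..R2}; s \<in> {R1..R2}\<rbrakk> \<Longrightarrow> hvar R1 N r \<le> hvar R1 N s \<longleftrightarrow> r \<le> s"
  using hvar_less[of s r] hvar_le[of r s] by (cases "r \<le> s") auto

lemma hvar_inj: "inj_on (hvar R1 N) {R1..R2}"
  by (rule inj_onI) (metis hvar_le_iff order.antisym order.refl)

lemma L_pos: "L > 0"
  using hvar_less[of R1 R2] R by (simp add: L_def hvar_R1)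

lemma hvar_image: "hvar R1 N ` {R1..R2} = {0..L}"
proof
  show "hvar R1 N ` {R1..R2} \<subseteq> {0..L}"
    using hvar_le[of R1] hvar_le[of _ R2] R by (auto simp: L_def hvar_R1)
  show "{0..L} \<subseteq> hvar R1 N ` {R1..R2}"
  proof
    fix t assume "t \<in> {0..L}"
    then obtain r where "R1 \<le> r" "r \<le> R2" "hvar R1 N r = t"
      using IVT'[of "hvar R1 N" R1 t R2] hvar_cont R by (auto simp: L_def hvar_R1)
    then show "t \<in> hvar R1 N ` {R1..R2}" by auto
  qed
qed

lemma hvar_in: "r \<in> {R1..R2} \<Longrightarrow> hvar R1 N r \<in> {0..L}"
  using hvar_image by blast

lemma rvar_hvar: "r \<in> {R1..R2} \<Longrightarrow> rvar R1 R2 N (hvar R1 N r) = r"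
  unfolding rvar_def by (rule inv_into_f_f[OF hvar_inj])

lemma hvar_rvar: "t \<in> {0..L} \<Longrightarrow> hvar R1 N (rvar R1 R2 N t) = t"
  and rvar_in: "t \<in> {0..L} \<Longrightarrow> rvar R1 R2 N t \<in> {R1..R2}"
  unfolding rvar_def hvar_image[symmetric] by (rule f_inv_into_f, assumption) (rule inv_into_into)

lemma rvar_cont: "continuous_on {0..L} (rvar R1 R2 N)"
  using continuous_on_inv[OF hvar_cont compact_Icc] rvar_hvar by (simp add: hvar_image)

lemma weight_hvar: "r \<in> {R1..R2} \<Longrightarrow> weight R1 R2 N f (hvar R1 N r) = r ^ (2 * (N - 1)) * f r"
  by (simp add: weight_def rvar_hvar)

lemma weight_cont: "continuous_on {R1..R2} f \<Longrightarrow> continuous_on {0..L} (weight R1 R2 N f)"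
  unfolding weight_def
  by (intro continuous_intros rvar_cont continuous_on_compose2[OF _ rvar_cont]) (use rvar_in in auto)

lemma weight_nonneg: "\<lbrakk>\<And>r. r \<in> {R1..R2} \<Longrightarrow> f r \<ge> 0; t \<in> {0..L}\<rbrakk> \<Longrightarrow> weight R1 R2 N f t \<ge> 0"
  using rvar_in[of t] R by (simp add: weight_def)

lemma weight_nonzero: "\<lbrakk>r \<in> {R1..R2}; f r \<noteq> 0\<rbrakk> \<Longrightarrow> weight R1 R2 N f (hvar R1 N r) \<noteq> 0"
  using R by (simp add: weight_hvar)

lemma weight_supp:
  assumes "p \<in> {R1..R2}" "q \<in> {R1..R2}" "\<And>r. r \<in> {R1..R2} - {p..q} \<Longrightarrow> f r = 0"
    and t: "t \<in> {0..L} - {hvar R1 N p..hvar R1 N q}"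
  shows "weight R1 R2 N f t = 0"
proof -
  have "rvar R1 R2 N t \<in> {R1..R2} - {p..q}"
    using t rvar_in[of t] hvar_rvar[of t] hvar_le_iff[of p "rvar R1 R2 N t"] hvar_le_iff[of "rvar R1 R2 N t" q] assms(1,2)
    by auto
  then show ?thesis using assms(3) by (simp add: weight_def)
qed

text \<open>Needed to carry the hypotheses on arbitrarily small one-sided neighbourhoods from the
  radii over to \<open>[0, L]\<close>.\<close>

lemma hvar_close:
  assumes "\<epsilon> > 0" "s \<in> {R1..R2}"
  obtains d where "d > 0" "\<And>r. \<lbrakk>r \<in> {R1..R2}; \<bar>r - s\<bar> \<le> d\<rbrakk> \<Longrightarrow> \<bar>hvar R1 N r - hvar R1 N s\<bar> < \<epsilon>"
proof -
  obtain d where d: "d > 0" "\<And>r. \<lbrakk>r \<in> {R1..R2}; dist r s < d\<rbrakk> \<Longrightarrow> dist (hvar R1 N r) (hvar R1 N s) < \<epsilon>"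
    using hvar_cont assms unfolding continuous_on_iff by metis
  show ?thesis
    by (rule that[of "d / 2"]) (use d in \<open>auto simp: dist_real_def\<close>)
qed

text \<open>The power in \<open>weight\<close> is there to cancel the square of
  \<open>r powr (1 - real N)\<close>, the derivative of the change of variables.\<close>

lemma powr_weight: "r > 0 \<Longrightarrow> r powr (1 - real N) * r powr (1 - real N) * r ^ (2 * (N - 1)) = 1"
proof -
  assume r: "r > 0"
  have "r ^ (2 * (N - 1)) = r powr (2 * (real N - 1))"
    using powr_realpow[OF r, of "2 * (N - 1)"] N by (simp add: of_nat_diff)
  then show ?thesis using r by (simp flip: powr_add)
qed

text \<open>For \<open>v r = u (h r)\<close> the chain rule gives
  \<open>v'' = u'' h'\<^sup>2 + u' h''\<close>, and since \<open>h'' = - (N - 1) / r * h'\<close>,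
  the last term is cancelled by the first-order part of the radial Laplacian. This is why the
  equation in \<open>t\<close> has no first-order term.\<close>

lemma radial_ode:
  fixes u u' :: "real \<Rightarrow> real" and F f :: "real \<Rightarrow> real \<Rightarrow> real"
  assumes card: "N = CARD('n)"
    and u: "\<And>t. t \<in> {0..L} \<Longrightarrow> (u has_real_derivative u' t) (at t within {0..L})"
    and u': "\<And>t. t \<in> {0..L} \<Longrightarrow> (u' has_real_derivative - F t (u t)) (at t within {0..L})"
    and ends: "u 0 = 0" "u L = 0"
    and F: "\<And>r s. r \<in> {R1..R2} \<Longrightarrow> F (hvar R1 N r) s = r ^ (2 * (N - 1)) * f r s"
    and f: "continuous_on {R1..R2} (\<lambda>r. f r (u (hvar R1 N r)))"
  shows "classical_dirichlet_solution (annulus R1 R2 :: (real^'n) set) (\<lambda>x s. f (norm x) s) (\<lambda>x. u (hvar R1 N (norm x)))"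
proof -
  define v where "v = (\<lambda>r. u (hvar R1 N r))"
  define v' where "v' = (\<lambda>r. u' (hvar R1 N r) * r powr (1 - real N))"
  define v2 where "v2 = (\<lambda>r. - f r (v r) - (real N - 1) / r * v' r)"
  have dv: "(v has_real_derivative v' r) (at r within {R1..R2})" if r: "r \<in> {R1..R2}" for r
    unfolding v_def v'_def
    using DERIV_image_chain[of u _ "hvar R1 N" r "{R1..R2}", OF _ hvar_deriv[OF r]] u[OF hvar_in[OF r]]
    by (simp add: hvar_image o_def)
  have dv': "(v' has_real_derivative v2 r) (at r within {R1..R2})" if r: "r \<in> {R1..R2}" for r
  proof -
    have r0: "r > 0" using r R by simp
    have 1: "((\<lambda>r. u' (hvar R1 N r)) has_real_derivative - F (hvar R1 N r) (v r) * r powr (1 - real N)) (at r within {R1..R2})"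
      using DERIV_image_chain[of u' "- F (hvar R1 N r) (u (hvar R1 N r))" "hvar R1 N" r "{R1..R2}", OF _ hvar_deriv[OF r]] u'[OF hvar_in[OF r]]
      by (simp add: hvar_image o_def v_def)
    have 2: "((\<lambda>r. r powr (1 - real N)) has_real_derivative (1 - real N) * r powr (1 - real N - 1)) (at r within {R1..R2})"
      using has_real_derivative_powr[OF r0] by (rule has_field_derivative_at_within)
    have pw: "r powr (1 - real N - 1) = r powr (1 - real N) / r"
      using powr_diff[of r "1 - real N" 1] r0 by simp
    have alg: "(1 - n) * (P / r) * w = - ((n - 1) / r * (w * P))" for n P w :: real
      by (simp add: divide_inverse algebra_simps)
    have "- F (hvar R1 N r) (v r) * r powr (1 - real N) * r powr (1 - real N) = - f r (v r)"
      using powr_weight[OF r0] by (simp add: F[OF r] mult_ac)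
    then have "- F (hvar R1 N r) (v r) * r powr (1 - real N) * r powr (1 - real N)
        + (1 - real N) * r powr (1 - real N - 1) * u' (hvar R1 N r) = v2 r"
      unfolding pw alg v2_def v'_def by simp
    then show ?thesis unfolding v'_def using DERIV_mult[OF 1 2] by (simp add: mult.commute)
  qed
  have "continuous_on {R1..R2} v'" using dv' by (rule DERIV_continuous_on)
  then have cv2: "continuous_on {R1..R2} v2" unfolding v2_def v_def
    using R by (intro continuous_intros f) auto
  have v_ends: "v R1 = 0" "v R2 = 0" using ends by (simp_all add: v_def hvar_R1 L_def)
  have "classical_dirichlet_solution (annulus R1 R2 :: (real^'n) set) (\<lambda>x s. f (norm x) s) (\<lambda>x. v (norm x))"
    by (rule radial_classical_solution[OF R dv dv' cv2 v_ends]) (use card in \<open>auto simp: v2_def\<close>)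
  then show ?thesis by (simp add: v_def)
qed

end

theorem theorem5p1:
  fixes R1 R2 :: real and m :: nat
    and \<alpha> :: "nat \<Rightarrow> real"
    and A B g k :: "nat \<Rightarrow> real \<Rightarrow> real"
    and \<sigma> \<tau> :: "nat \<Rightarrow> real"
  assumes dim: "CARD('n::finite) \<ge> 2"
    and radii: "0 < R1" "R1 < R2"
    and m: "m \<ge> 1"
    and alpha_pos: "\<forall>i\<in>{1..m}. \<alpha> i > 0"
    and A_cont: "\<forall>i\<in>{1..m}. continuous_on {R1..R2} (A i) \<and> (\<forall>r\<in>{R1..R2}. A i r \<ge> 0)"
    and B_cont: "\<forall>j\<in>{0..m}. continuous_on {R1..R2} (B j) \<and> (\<forall>r\<in>{R1..R2}. B j r \<ge> 0)"
    and g_cont: "\<forall>i\<in>{1..m}. continuous_on {0..} (g i) \<and> (\<forall>s\<ge>0. g i s \<ge> 0)"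
    and k_cont: "\<forall>j\<in>{0..m}. continuous_on {0..} (k j) \<and> (\<forall>s\<ge>0. k j s \<ge> 0)"
    \<comment> \<open>(h1*)\<close>
    and h1_pts: "\<tau> 0 = R1" "\<sigma> (m + 1) = R2" "\<tau> 0 \<le> \<sigma> 1" "\<tau> m \<le> \<sigma> (m + 1)"
      "\<forall>i\<in>{1..m}. \<sigma> i < \<tau> i" "\<forall>i\<in>{1..<m}. \<tau> i < \<sigma> (i + 1)"
    and h1_A: "\<forall>i\<in>{1..m}. (\<exists>r\<in>{\<sigma> i..\<tau> i}. A i r \<noteq> 0) \<and>
                            (\<forall>r\<in>{R1..R2} - {\<sigma> i..\<tau> i}. A i r = 0)"
    and h1_B: "\<forall>j\<in>{0..m}. (\<forall>r\<in>{R1..R2} - {\<tau> j..\<sigma> (j + 1)}. B j r = 0) \<and>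
                 (\<tau> j < \<sigma> (j + 1) \<longrightarrow>
                    (\<forall>\<epsilon>>0. (\<exists>r\<in>{\<tau> j..min (\<tau> j + \<epsilon>) (\<sigma> (j + 1))}. B j r \<noteq> 0) \<and>
                            (\<exists>r\<in>{max (\<sigma> (j + 1) - \<epsilon>) (\<tau> j)..\<sigma> (j + 1)}. B j r \<noteq> 0)))"
    \<comment> \<open>(h2)\<close>
    and h2_g: "\<forall>i\<in>{1..m}. g i 0 = 0 \<and> (\<forall>s>0. g i s > 0)"
    and h2_k: "\<forall>j\<in>{0..m}. k j 0 = 0 \<and> (\<forall>s>0. k j s > 0)"
    \<comment> \<open>(h3)\<close>
    and h3_g0: "\<forall>i\<in>{1..m}. Limsup (at_right 0) (\<lambda>s. ereal (g i s / s)) < \<infinity>"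
    and h3_ginf: "\<forall>i\<in>{1..m}. Liminf at_top (\<lambda>s. ereal (g i s / s)) > 0"
    and h3_k0: "\<forall>j\<in>{0..m}. Limsup (at_right 0) (\<lambda>s. ereal (k j s / s)) < \<infinity>"
    \<comment> \<open>conditions on \<alpha>_i g_0^i and \<alpha>_i g_\<infinity>^i\<close>
    and cond0: "\<forall>i\<in>{1..m}. ereal (\<alpha> i) * Limsup (at_right 0) (\<lambda>s. ereal (g i s / s)) <
        ereal (first_dirichlet_eigenvalue
                 (\<lambda>t. \<Sum>l=1..m. weight R1 R2 CARD('n) (A l) t) 0 (hvar R1 CARD('n) R2))"
    and condinf: "\<forall>i\<in>{1..m}. ereal (\<alpha> i) * Liminf at_top (\<lambda>s. ereal (g i s / s)) >
        ereal (first_dirichlet_eigenvalue (weight R1 R2 CARD('n) (A i))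
                 (hvar R1 CARD('n) (\<sigma> i)) (hvar R1 CARD('n) (\<tau> i)))"
  shows "\<exists>\<beta>star > 0. \<forall>\<beta> :: nat \<Rightarrow> real. (\<forall>j\<in>{0..m+1}. \<beta> j > \<beta>star) \<longrightarrow>
           (\<exists>S :: (real^'n \<Rightarrow> real) set. finite S \<and> card S \<ge> 2 ^ m - 1 \<and>
              (\<forall>u\<in>S. \<forall>v\<in>S. u \<noteq> v \<longrightarrow> (\<exists>x\<in>annulus R1 R2. u x \<noteq> v x)) \<and>
              (\<forall>u\<in>S.
                 classical_dirichlet_solution (annulus R1 R2)
                   (\<lambda>x s. (\<Sum>i=1..m. \<alpha> i * A i (norm x) * g i s)
                          - (\<Sum>j=0..m. \<beta> j * B j (norm x) * k j s)) u \<and>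
                 (\<forall>x\<in>annulus R1 R2. u x > 0) \<and>
                 (\<exists>U. \<forall>x\<in>closure (annulus R1 R2). u x = U (norm x))))"
proof -
  define N where "N = CARD('n)"
  have N: "N \<ge> 2" using dim by (simp add: N_def)
  interpret annulus_radii R1 R2 N by unfold_locales (use radii N in auto)
  interpret R: interlaced m \<sigma> \<tau> R1 R2
    by unfold_locales (use h1_pts in auto)
  let ?h = "hvar R1 N"
  define a where "a = (\<lambda>i. weight R1 R2 N (A i))"
  define b where "b = (\<lambda>j. weight R1 R2 N (B j))"
  have \<tau>_in: "\<tau> j \<in> {R1..R2}" and \<sigma>_in: "\<sigma> (j + 1) \<in> {R1..R2}" if "j \<le> m" for j
    using R.in_range(3,4)[OF that] R.ta_le_sg[OF that] by auto
  have \<sigma>_in': "\<sigma> i \<in> {R1..R2}" and \<tau>_in': "\<tau> i \<in> {R1..R2}" if "i \<in> {1..m}" for i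
    using \<sigma>_in[of "i - 1"] \<tau>_in[of i] that by auto
  have "\<forall>i\<in>{1..m}. \<exists>y d. y < first_dirichlet_eigenvalue (\<lambda>t. \<Sum>l=1..m. a l t) 0 L \<and> d > 0 \<and>
      (\<forall>s\<in>{0..d}. \<alpha> i * g i s \<le> y * s)"
    using alpha_pos h2_g h3_g0 cond0 unfolding L_def unfolding a_def N_def by (intro ballI slope_below) auto
  then obtain yi di where yi: "\<And>i. i \<in> {1..m} \<Longrightarrow> yi i < first_dirichlet_eigenvalue (\<lambda>t. \<Sum>l=1..m. a l t) 0 L"
    and di: "\<And>i. i \<in> {1..m} \<Longrightarrow> di i > 0"
    and small: "\<And>i s. \<lbrakk>i \<in> {1..m}; s \<in> {0..di i}\<rbrakk> \<Longrightarrow> \<alpha> i * g i s \<le> yi i * s"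
    by metis
  \<comment> \<open>One slope and one threshold for all \<open>i\<close>: among finitely many, the
    largest slope is still below the eigenvalue and the smallest threshold still positive.\<close>
  define y where "y = Max (yi ` {1..m})"
  define r where "r = Min (di ` {1..m})"
  have ne: "yi ` {1..m} \<noteq> {}" "di ` {1..m} \<noteq> {}" using m by auto
  interpret indefinite_problem m "\<lambda>i. ?h (\<sigma> i)" "\<lambda>j. ?h (\<tau> j)" L a b \<alpha> g k y r
  proof unfold_locales
    show "?h (\<tau> 0) = 0" "?h (\<sigma> (m + 1)) = L" using h1_pts by (simp_all add: hvar_R1 L_def)
    show "?h (\<tau> 0) \<le> ?h (\<sigma> 1)" using \<tau>_in[of 0] \<sigma>_in[of 0] h1_pts(3) by (simp add: hvar_le_iff)
    show "?h (\<tau> m) \<le> ?h (\<sigma> (m + 1))" using \<tau>_in[of m] \<sigma>_in[of m] h1_pts(4) by (simp add: hvar_le_iff)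
    show "?h (\<sigma> i) < ?h (\<tau> i)" if "i \<in> {1..m}" for i
      using \<sigma>_in'[OF that] \<tau>_in'[OF that] R.pts(5)[OF that] by (intro hvar_less) auto
    show "?h (\<tau> i) < ?h (\<sigma> (i + 1))" if "i \<in> {1..<m}" for i
      using \<tau>_in[of i] \<sigma>_in[of i] R.pts(6)[OF that] that by (intro hvar_less) auto
    show "L > 0" by (rule L_pos)
    show "continuous_on {0..L} (a i)" if "i \<in> {1..m}" for i
      unfolding a_def using A_cont that by (intro weight_cont) auto
    show "a i t \<ge> 0" if "i \<in> {1..m}" "t \<in> {0..L}" for i t
      unfolding a_def using A_cont that by (intro weight_nonneg) auto
    show "\<exists>t\<in>{?h (\<sigma> i)..?h (\<tau> i)}. a i t \<noteq> 0" if i: "i \<in> {1..m}" for i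
    proof -
      obtain s where s: "s \<in> {\<sigma> i..\<tau> i}" "A i s \<noteq> 0" using h1_A i by blast
      have "s \<in> {R1..R2}" using s \<sigma>_in'[OF i] \<tau>_in'[OF i] by auto
      then show ?thesis unfolding a_def using s \<sigma>_in'[OF i] \<tau>_in'[OF i]
        by (intro bexI[of _ "?h s"] weight_nonzero) (auto simp: hvar_le_iff)
    qed
    show "a i t = 0" if "i \<in> {1..m}" "t \<in> {0..L} - {?h (\<sigma> i)..?h (\<tau> i)}" for i t
      unfolding a_def by (rule weight_supp[OF \<sigma>_in' \<tau>_in']) (use h1_A that in auto)
    show "continuous_on {0..L} (b j)" if "j \<in> {0..m}" for j
      unfolding b_def using B_cont that by (intro weight_cont) auto
    show "b j t \<ge> 0" if "j \<in> {0..m}" "t \<in> {0..L}" for j t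
      unfolding b_def using B_cont that by (intro weight_nonneg) auto
    show "b j t = 0" if j: "j \<in> {0..m}" "t \<in> {0..L} - {?h (\<tau> j)..?h (\<sigma> (j + 1))}" for j t
    proof -
      have jm: "j \<le> m" using j by simp
      show ?thesis unfolding b_def by (rule weight_supp[OF \<tau>_in[OF jm] \<sigma>_in[OF jm]]) (use h1_B j in auto)
    qed
    show "\<exists>t\<in>{?h (\<tau> j)..min (?h (\<tau> j) + \<epsilon>) (?h (\<sigma> (j + 1)))}. b j t \<noteq> 0"
      if j: "j \<in> {0..m}" and lt: "?h (\<tau> j) < ?h (\<sigma> (j + 1))" and \<epsilon>: "\<epsilon> > 0" for j \<epsilon>
    proof -
      have ti: "\<tau> j \<in> {R1..R2}" and si: "\<sigma> (j + 1) \<in> {R1..R2}" using \<tau>_in[of j] \<sigma>_in[of j] j by auto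
      have "\<tau> j < \<sigma> (j + 1)" using lt hvar_le_iff[OF si ti] by linarith
      moreover obtain d where d: "d > 0"
        "\<And>s. \<lbrakk>s \<in> {R1..R2}; \<bar>s - \<tau> j\<bar> \<le> d\<rbrakk> \<Longrightarrow> \<bar>?h s - ?h (\<tau> j)\<bar> < \<epsilon>"
        using hvar_close[OF \<epsilon> ti] by blast
      ultimately obtain s where s: "s \<in> {\<tau> j..min (\<tau> j + d) (\<sigma> (j + 1))}" "B j s \<noteq> 0"
        using h1_B j by blast
      have sR: "s \<in> {R1..R2}" using s ti si by auto
      have "\<bar>?h s - ?h (\<tau> j)\<bar> < \<epsilon>" using s by (intro d(2)[OF sR]) auto
      then show ?thesis unfolding b_def using s sR ti si
        by (intro bexI[of _ "?h s"] weight_nonzero) (auto simp: hvar_le_iff)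
    qed
    show "\<exists>t\<in>{max (?h (\<sigma> (j + 1)) - \<epsilon>) (?h (\<tau> j))..?h (\<sigma> (j + 1))}. b j t \<noteq> 0"
      if j: "j \<in> {0..m}" and lt: "?h (\<tau> j) < ?h (\<sigma> (j + 1))" and \<epsilon>: "\<epsilon> > 0" for j \<epsilon>
    proof -
      have ti: "\<tau> j \<in> {R1..R2}" and si: "\<sigma> (j + 1) \<in> {R1..R2}" using \<tau>_in[of j] \<sigma>_in[of j] j by auto
      have "\<tau> j < \<sigma> (j + 1)" using lt hvar_le_iff[OF si ti] by linarith
      moreover obtain d where d: "d > 0"
        "\<And>s. \<lbrakk>s \<in> {R1..R2}; \<bar>s - \<sigma> (j + 1)\<bar> \<le> d\<rbrakk> \<Longrightarrow> \<bar>?h s - ?h (\<sigma> (j + 1))\<bar> < \<epsilon>"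
        using hvar_close[OF \<epsilon> si] by blast
      ultimately obtain s where s: "s \<in> {max (\<sigma> (j + 1) - d) (\<tau> j)..\<sigma> (j + 1)}" "B j s \<noteq> 0"
        using h1_B j by blast
      have sR: "s \<in> {R1..R2}" using s ti si by auto
      have "\<bar>?h s - ?h (\<sigma> (j + 1))\<bar> < \<epsilon>" using s by (intro d(2)[OF sR]) auto
      then show ?thesis unfolding b_def using s sR ti si
        by (intro bexI[of _ "?h s"] weight_nonzero) (auto simp: hvar_le_iff)
    qed
    show "\<exists>K\<ge>0. \<forall>s\<in>{0..C}. k j s \<le> K * s" if "j \<in> {0..m}" for j C
      using k_cont h2_k h3_k0 that by (intro linear_bound) auto
    show "r > 0" unfolding r_def using di ne by simp
    show "y < first_dirichlet_eigenvalue (\<lambda>t. \<Sum>i=1..m. a i t) 0 L" unfolding y_def using yi ne by simp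
    show "\<alpha> i * g i s \<le> y * s" if i: "i \<in> {1..m}" and s: "s \<in> {0..r}" for i s
    proof -
      have "r \<le> di i" "yi i \<le> y" unfolding r_def y_def using i by auto
      then have "\<alpha> i * g i s \<le> yi i * s" using s by (intro small[OF i]) auto
      also have "\<dots> \<le> y * s" using \<open>yi i \<le> y\<close> s by (intro mult_right_mono) auto
      finally show ?thesis .
    qed
    show "\<exists>d>0. \<exists>c. \<forall>s\<ge>0. (first_dirichlet_eigenvalue (a i) (?h (\<sigma> i)) (?h (\<tau> i)) + d) * s - c \<le> \<alpha> i * g i s"
      if i: "i \<in> {1..m}" for i
      using alpha_pos g_cont condinf i unfolding a_def N_def by (intro slope_above) auto
  qed (use m alpha_pos g_cont k_cont h2_g h2_k in auto)
  define sol where "sol = (\<lambda>\<beta> J u u'. (\<forall>t\<in>{0..L}. (u has_real_derivative u' t) (at t within {0..L}) \<and>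
        (u' has_real_derivative - source \<beta> t (u t)) (at t within {0..L})) \<and>
      u 0 = 0 \<and> u L = 0 \<and> (\<forall>t\<in>{0..L}. u t \<ge> 0) \<and> (\<forall>t. 0 < t \<longrightarrow> t < L \<longrightarrow> u t > 0) \<and>
      (\<forall>i\<in>{1..m}. (i \<in> J \<longrightarrow> (\<exists>t\<in>{?h (\<sigma> i)..?h (\<tau> i)}. r \<le> u t)) \<and>
        (i \<notin> J \<longrightarrow> (\<forall>t\<in>{?h (\<sigma> i)..?h (\<tau> i)}. u t < r))))"
  obtain \<beta>star where \<beta>star: "\<beta>star > 0" and solutions:
    "\<And>\<beta> J. \<lbrakk>\<And>j. j \<in> {0..m} \<Longrightarrow> \<beta> j > \<beta>star; J \<subseteq> {1..m}; J \<noteq> {}\<rbrakk> \<Longrightarrow> \<exists>u u'. sol \<beta> J u u'"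
    unfolding sol_def by (rule multiplicity) blast
  show ?thesis
  proof (rule exI[of _ \<beta>star], intro conjI allI impI)
    fix \<beta> :: "nat \<Rightarrow> real" assume \<beta>: "\<forall>j\<in>{0..m+1}. \<beta> j > \<beta>star"
    define f where "f = (\<lambda>\<rho> s. (\<Sum>i=1..m. \<alpha> i * A i \<rho> * g i s) - (\<Sum>j=0..m. \<beta> j * B j \<rho> * k j s))"
    define Js where "Js = Pow {1..m} - {{}}"
    have "\<forall>J\<in>Js. \<exists>u u'. sol \<beta> J u u'"
      using \<beta> by (intro ballI solutions) (auto simp: Js_def)
    then obtain U U' where "\<And>J. J \<in> Js \<Longrightarrow> sol \<beta> J (U J) (U' J)" by metis
    note U = this[unfolded sol_def]
    define w where "w = (\<lambda>J (x :: real^'n). U J (?h (norm x)))"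
    have solves: "classical_dirichlet_solution (annulus R1 R2) (\<lambda>x s. f (norm x) s) (w J)" if J: "J \<in> Js" for J
      unfolding w_def
    proof (rule radial_ode[OF N_def, where u' = "U' J" and F = "source \<beta>"])
      show "source \<beta> (?h \<rho>) s = \<rho> ^ (2 * (N - 1)) * f \<rho> s" if "\<rho> \<in> {R1..R2}" for \<rho> s
        by (simp add: a_def b_def weight_hvar[OF that] f_def right_diff_distrib sum_distrib_left mult_ac)
      have "\<And>t. t \<in> {0..L} \<Longrightarrow> (U J has_real_derivative U' J t) (at t within {0..L})" using U J by blast
      then have cU: "continuous_on {0..L} (U J)" by (rule DERIV_continuous_on)
      have cUh: "continuous_on {R1..R2} (\<lambda>\<rho>. U J (?h \<rho>))"
        by (rule continuous_on_compose2[OF cU hvar_cont]) (use hvar_in in auto)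
      have nn: "U J (?h \<rho>) \<ge> 0" if "\<rho> \<in> {R1..R2}" for \<rho> using U J hvar_in[OF that] by blast
      have "continuous_on {R1..R2} (\<lambda>\<rho>. G (U J (?h \<rho>)))" if "continuous_on {0..} G" for G :: "real \<Rightarrow> real"
        by (rule continuous_on_compose2[OF that cUh]) (use nn in auto)
      then show "continuous_on {R1..R2} (\<lambda>\<rho>. f \<rho> (U J (?h \<rho>)))"
        unfolding f_def using A_cont B_cont g_cont k_cont by (intro continuous_intros) auto
    qed (use U J in auto)
    have differ: "\<exists>x\<in>annulus R1 R2. w J x \<noteq> w J' x"
      if J: "J \<in> Js" "J' \<in> Js" and i: "i \<in> {1..m}" "i \<in> J" "i \<notin> J'" for J J' i
    proof -
      obtain t where t: "t \<in> {?h (\<sigma> i)..?h (\<tau> i)}" "r \<le> U J t" using U J(1) i by blast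
      then have lt: "U J' t < r" using U J(2) i by blast
      have tL: "t \<in> {0..L}" using sub_a[OF i(1)] t by blast
      define \<rho> where "\<rho> = rvar R1 R2 N t"
      have \<rho>: "\<rho> \<in> {R1..R2}" "?h \<rho> = t" using rvar_in[OF tL] hvar_rvar[OF tL] by (simp_all add: \<rho>_def)
      \<comment> \<open>A positivity interval may reach the boundary of the annulus, but a point
        with value at least \<open>r > 0\<close> does not lie on it, so the two solutions already
        differ inside.\<close>
      have "U J t > 0" using t(2) r by linarith
      then have "\<rho> \<noteq> R1" "\<rho> \<noteq> R2" using \<rho>(2) U J(1) by (auto simp: hvar_R1 L_def)
      then have \<rho>': "R1 < \<rho>" "\<rho> < R2" using \<rho>(1) by auto
      define x :: "real^'n" where "x = \<rho> *\<^sub>R axis undefined 1"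
      have "norm x = \<rho>" using \<rho>' radii by (simp add: x_def)
      then have "x \<in> annulus R1 R2" "w J x \<noteq> w J' x"
        using \<rho>' \<rho>(2) t(2) lt by (auto simp: annulus_def w_def)
      then show ?thesis by blast
    qed
    have distinct: "\<exists>x\<in>annulus R1 R2. w J x \<noteq> w J' x" if J: "J \<in> Js" "J' \<in> Js" "J \<noteq> J'" for J J'
    proof -
      obtain i where "i \<in> J \<and> i \<notin> J' \<or> i \<in> J' \<and> i \<notin> J" using J(3) by blast
      then show ?thesis using differ[of J J' i] differ[of J' J i] J(1,2) by (auto simp: Js_def)
    qed
    then have "inj_on w Js" by (intro inj_onI) metis
    then have card: "card (w ` Js) = 2 ^ m - 1"
      by (simp add: card_image Js_def card_Diff_subset card_Pow)
    have pos: "w J x > 0" if "J \<in> Js" "x \<in> annulus R1 R2" for J x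
      using U[OF that(1)] that(2) hvar_less[of R1 "norm x"] hvar_less[of "norm x" R2]
      by (auto simp: w_def annulus_def hvar_R1 L_def)
    have radial: "\<exists>V. \<forall>x\<in>closure (annulus R1 R2). w J x = V (norm x)" for J
      by (rule exI[of _ "\<lambda>\<rho>. U J (?h \<rho>)"]) (simp add: w_def)
    show "\<exists>S :: (real^'n \<Rightarrow> real) set. finite S \<and> card S \<ge> 2 ^ m - 1 \<and>
              (\<forall>u\<in>S. \<forall>v\<in>S. u \<noteq> v \<longrightarrow> (\<exists>x\<in>annulus R1 R2. u x \<noteq> v x)) \<and>
              (\<forall>u\<in>S.
                 classical_dirichlet_solution (annulus R1 R2)
                   (\<lambda>x s. (\<Sum>i=1..m. \<alpha> i * A i (norm x) * g i s)
                          - (\<Sum>j=0..m. \<beta> j * B j (norm x) * k j s)) u \<and>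
                 (\<forall>x\<in>annulus R1 R2. u x > 0) \<and>
                 (\<exists>U. \<forall>x\<in>closure (annulus R1 R2). u x = U (norm x)))"
    proof (rule exI[of _ "w ` Js"], intro conjI ballI impI)
      show "finite (w ` Js)" by (simp add: Js_def)
      show "2 ^ m - 1 \<le> card (w ` Js)" by (simp add: card)
      fix u assume "u \<in> w ` Js"
      then obtain J where J: "J \<in> Js" "u = w J" by blast
      show "classical_dirichlet_solution (annulus R1 R2)
          (\<lambda>x s. (\<Sum>i=1..m. \<alpha> i * A i (norm x) * g i s) - (\<Sum>j=0..m. \<beta> j * B j (norm x) * k j s)) u"
        using solves[OF J(1)] J(2) by (simp add: f_def)
      show "u x > 0" if "x \<in> annulus R1 R2" for x using pos[OF J(1) that] J(2) by simp
      show "\<exists>U. \<forall>x\<in>closure (annulus R1 R2). u x = U (norm x)" using radial J(2) by simp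
      fix v assume "v \<in> w ` Js" "u \<noteq> v"
      then show "\<exists>x\<in>annulus R1 R2. u x \<noteq> v x" using distinct J by blast
    qed
  qed (rule \<beta>star)
qed

end
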